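(* Let $\mathrm{FD}(\mu,\gamma)$ denote a locally overdispersed or underdispersed factorial dispersion model with unit dispersion function $v$ on $\Psi_0$, such that either $\inf\Psi_0\le0$ or $\sup\Psi_0=\infty$. Assume that for some $p\in\mathbb{R}$ and some constant $c_0\ne0$ the unit dispersion function satisfies $v(\mu)\sim c_0\mu^p$ as either $\mu\downarrow0$ or $\mu\to\infty$. Then for each $\mu\in\Omega_p$ $$c^{-1}\cdot\mathrm{FD}(c\mu,c^{2-p}\gamma)\overset{D}{\longrightarrow}\mathrm{PT}_p(\mu,\gamma c_0)\quad\text{as }c\downarrow0\text{ or }c\to\infty,$$ respectively. In the case $c\downarrow0$, the model $\mathrm{FD}(\mu,\gamma)$ is required to be infinitely dilatable, and if $c^{2-p}\to\infty$ the model is required to be infinitely divisible.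
   Context: The factorial cumulant generating function (FCGF) of a random variable $X$ is $C(t)=C(t;X)=\log\mathrm{E}[(1+t)^X]$ for $t>-1$, with $\mathrm{dom}(C)=\{t>-1:C(t)<\infty\}$. $\mathcal{C}$ is the set of FCGFs with $\mathrm{int}(\mathrm{dom}(C))\ne\emptyset$; equalities between FCGFs are understood to hold in a neighbourhood of zero. Dilation: for $c>0$, $c\cdot X$ denotes a random variable (or its distribution) with FCGF $C(t;c\cdot X)=C(ct;X)$, provided the right-hand side is an FCGF; $X$ is infinitely dilatable if $c\cdot X$ exists for every $c>0$. For discrete ($\{0,1,2,\dots\}$-valued) $X$ and $c\leq 1$ dilation is binomial thinning and always exists. Tilting: for $C\in\mathcal{C}$ and $\theta\in\mathrm{dom}(C)$, $C_\theta(t)=C(\theta+t)-C(\theta)$. Let $\Theta_0\subseteq\mathrm{dom}(C)$ be a non-degenerate interval on which $\ddot C$ has constant nonzero sign (positive: locally overdispersed; negative: locally underdispersed), and $\Psi_0=\dot C(\Theta_0)$. The (local) unit dispersion function is $v=\ddot C\circ\dot C^{-1}$ on $\Psi_0$. Factorial dispersion model (reproductive form) generated by $C$: $\mathrm{FD}(\mu,\gamma)$ is the distribution with FCGF $t\mapsto\gamma^{-1}C_\theta(\gamma t)$, where $\mu=\dot C(\theta)\in\Psi_0$, $\theta\in\Theta_0$, and $\gamma>0$ ranges over those values for which this is an FCGF. It has mean $\mu$ and dispersion (variance minus mean) $\gamma v(\mu)$. The left-hand side of the convergence is considered for those $c$ for which it is defined (in particular $c\mu\in\Psi_0$). Power dispersion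 models: $\Omega_0=\mathbb{R}$ and $\Omega_p=\mathbb{R}_+=(0,\infty)$ for $p\ne0$. $\mathrm{PT}_p(\mu,\gamma)$ denotes the factorial dispersion model with mean $\mu$ and power dispersion function $\gamma\mu^p$ (a negative second parameter corresponds to an underdispersed model). For $p\ge1$ and $\gamma>0$ it is the Poisson-Tweedie mixture: the mixed Poisson distribution $\mathrm{Po}(X)$ with $X\sim\mathrm{Tw}_p(\mu,\gamma)$, where $\mathrm{Tw}_p(\mu,\gamma)$ is the Tweedie exponential dispersion model with mean $\mu$ and variance $\gamma\mu^p$. $\overset{D}{\to}$ denotes convergence in distribution, and $f\sim g$ means $f/g\to1$. *)

theory Defs
  imports "HOL-Probability.Probability" "HOL-Library.Landau_Symbols"
begin

text \<open>Random variables are real valued and enter only through their distributions, which are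
  measures satisfying the library predicate \<^const>\<open>real_distribution\<close>.\<close>

section \<open>Factorial cumulant generating functions\<close>

text \<open>The value is \<open>\<infinity>\<close> where the expectation diverges; the function is only meaningful for
  \<open>t > -1\<close>.\<close>

definition fcgf :: "real measure \<Rightarrow> real \<Rightarrow> ereal" where
  "fcgf M t =
     (if integrable M (\<lambda>x. (1 + t) powr x) then ereal (ln (\<integral>x. (1 + t) powr x \<partial>M)) else \<infinity>)"

definition fcgf_dom :: "real measure \<Rightarrow> real set" where
  "fcgf_dom M = {t. -1 < t \<and> fcgf M t < \<infinity>}"

text \<open>The distributions whose factorial cumulant generating function belongs to the class
  \<open>\<C>\<close>.\<close>

definition fcgf_class :: "real measure \<Rightarrow> bool" where
  "fcgf_class M \<longleftrightarrow> real_distribution M \<and> interior (fcgf_dom M) \<noteq> {}"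

text \<open>Equality of factorial cumulant generating functions is equality in a neighbourhood of zero,
  the value \<open>\<infinity>\<close> included. On the class \<open>\<C>\<close> this determines the distribution.\<close>

definition has_fcgf :: "real measure \<Rightarrow> (real \<Rightarrow> ereal) \<Rightarrow> bool" where
  "has_fcgf L K \<longleftrightarrow> fcgf_class L \<and> (\<forall>\<^sub>F t in nhds 0. fcgf L t = K t)"

text \<open>First and second derivative. They are taken relative to the domain, an interval, so that
  they are one-sided at an end point belonging to the domain.\<close>

definition fcgf_deriv :: "real measure \<Rightarrow> real \<Rightarrow> real" where
  "fcgf_deriv M \<theta> =
     vector_derivative (\<lambda>t. real_of_ereal (fcgf M t)) (at \<theta> within fcgf_dom M)"

definition fcgf_deriv2 :: "real measure \<Rightarrow> real \<Rightarrow> real" where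
  "fcgf_deriv2 M \<theta> = vector_derivative (fcgf_deriv M) (at \<theta> within fcgf_dom M)"

definition fcgf_tilt :: "real measure \<Rightarrow> real \<Rightarrow> real \<Rightarrow> ereal" where
  "fcgf_tilt M \<theta> t = fcgf M (\<theta> + t) - fcgf M \<theta>"


section \<open>Dilation and infinite divisibility\<close>

definition is_dilation :: "real \<Rightarrow> real measure \<Rightarrow> real measure \<Rightarrow> bool" where
  "is_dilation c L L' \<longleftrightarrow> 0 < c \<and> has_fcgf L' (\<lambda>t. fcgf L (c * t))"

definition infinitely_dilatable :: "real measure \<Rightarrow> bool" where
  "infinitely_dilatable L \<longleftrightarrow> (\<forall>c>0. \<exists>L'. is_dilation c L L')"

text \<open>The \<open>n\<close>-fold convolution power is written as the iterated convolution starting from the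
  point mass at \<open>0\<close>.\<close>

definition infinitely_divisible :: "real measure \<Rightarrow> bool" where
  "infinitely_divisible L \<longleftrightarrow>
     (\<forall>n\<ge>1. \<exists>Q. real_distribution Q \<and> L = ((\<lambda>N. Q \<star> N) ^^ n) (return borel 0))"


section \<open>Factorial dispersion models\<close>

text \<open>\<open>M\<close> is the distribution whose factorial cumulant generating function generates the model and
  \<open>\<Theta>\<close> the canonical parameter set \<open>\<Theta>\<^sub>0\<close>. The alternative is local overdispersion versus local
  underdispersion.\<close>

definition fd_model :: "real measure \<Rightarrow> real set \<Rightarrow> bool" where
  "fd_model M \<Theta> \<longleftrightarrow>
     fcgf_class M \<and> \<Theta> \<subseteq> fcgf_dom M \<and> is_interval \<Theta> \<and> (\<exists>a\<in>\<Theta>. \<exists>b\<in>\<Theta>. a < b) \<and>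
     (\<forall>\<theta>\<in>\<Theta>. (\<lambda>t. real_of_ereal (fcgf M t)) differentiable (at \<theta> within fcgf_dom M)) \<and>
     (\<forall>\<theta>\<in>\<Theta>. fcgf_deriv M differentiable (at \<theta> within fcgf_dom M)) \<and>
     ((\<forall>\<theta>\<in>\<Theta>. 0 < fcgf_deriv2 M \<theta>) \<or> (\<forall>\<theta>\<in>\<Theta>. fcgf_deriv2 M \<theta> < 0))"

definition mean_domain :: "real measure \<Rightarrow> real set \<Rightarrow> real set" where
  "mean_domain M \<Theta> = fcgf_deriv M ` \<Theta>"

text \<open>Only meaningful on \<^term>\<open>mean_domain M \<Theta>\<close>.\<close>

definition unit_dispersion :: "real measure \<Rightarrow> real set \<Rightarrow> real \<Rightarrow> real" where
  "unit_dispersion M \<Theta> = fcgf_deriv2 M \<circ> inv_into \<Theta> (fcgf_deriv M)"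

text \<open>\<^term>\<open>is_FD M \<Theta> \<mu> \<gamma> L\<close>: the distribution \<open>FD(\<mu>, \<gamma>)\<close> exists and equals \<open>L\<close>.\<close>

definition is_FD ::
    "real measure \<Rightarrow> real set \<Rightarrow> real \<Rightarrow> real \<Rightarrow> real measure \<Rightarrow> bool" where
  "is_FD M \<Theta> \<mu> \<gamma> L \<longleftrightarrow>
     0 < \<gamma> \<and> (\<exists>\<theta>\<in>\<Theta>. fcgf_deriv M \<theta> = \<mu> \<and>
       has_fcgf L (\<lambda>t. ereal (1 / \<gamma>) * fcgf_tilt M \<theta> (\<gamma> * t)))"

definition fd_infinitely_dilatable :: "real measure \<Rightarrow> real set \<Rightarrow> bool" where
  "fd_infinitely_dilatable M \<Theta> \<longleftrightarrow> (\<forall>\<mu> \<gamma> L. is_FD M \<Theta> \<mu> \<gamma> L \<longrightarrow> infinitely_dilatable L)"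

definition fd_infinitely_divisible :: "real measure \<Rightarrow> real set \<Rightarrow> bool" where
  "fd_infinitely_divisible M \<Theta> \<longleftrightarrow> (\<forall>\<mu> \<gamma> L. is_FD M \<Theta> \<mu> \<gamma> L \<longrightarrow> infinitely_divisible L)"


section \<open>Power dispersion models\<close>

definition power_domain :: "real \<Rightarrow> real set" where
  "power_domain p = (if p = 0 then UNIV else {0<..})"

text \<open>The case distinction is needed because \<open>0 powr 0 = 0\<close>, whereas for \<open>p = 0\<close> the power is the
  constant \<open>1\<close> on all of the real line.\<close>

definition power_fun :: "real \<Rightarrow> real \<Rightarrow> real" where
  "power_fun p \<mu> = (if p = 0 then 1 else \<mu> powr p)"

text \<open>\<^term>\<open>is_PT p \<mu> d L\<close>: the distribution \<open>PT\<^sub>p(\<mu>, d)\<close> exists and equals \<open>L\<close>. That is, \<open>L\<close> is the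
  member with mean \<open>\<mu>\<close> of a factorial dispersion model whose dispersion function
  \<open>m \<mapsto> \<gamma> v(m)\<close> is \<open>m \<mapsto> d m\<^sup>p\<close>. The model is local, as in general no single generator has
  all of \<open>\<Omega>\<^sub>p\<close> as its mean domain: for \<open>p = 1\<close>, the generator \<open>C(t) = exp t - 1\<close>, \<open>t > -1\<close>, only
  gives means above \<open>exp (-1)\<close>. A negative \<open>d\<close> is an underdispersed model.\<close>

definition is_PT :: "real \<Rightarrow> real \<Rightarrow> real \<Rightarrow> real measure \<Rightarrow> bool" where
  "is_PT p \<mu> d L \<longleftrightarrow>
     (\<exists>M \<Theta> \<gamma>. fd_model M \<Theta> \<and> mean_domain M \<Theta> \<subseteq> power_domain p \<and>
        (\<forall>m\<in>mean_domain M \<Theta>. \<gamma> * unit_dispersion M \<Theta> m = d * power_fun p m) \<and>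
        is_FD M \<Theta> \<mu> \<gamma> L)"

end

theory Submission
  imports Defs "HOL-Complex_Analysis.Complex_Analysis" "HOL-Real_Asymp.Real_Asymp"
begin

text \<open>
  A factorial cumulant generating function is the logarithm of a moment generating function in the
  variable \<open>t = exp s - 1\<close>. Write \<open>C\<close> for that of the generator, and choose \<open>\<theta>\<^sub>n\<close> with
  \<open>C' \<theta>\<^sub>n = c\<^sub>n \<mu>\<close>. Near \<open>0\<close>, the \<open>n\<close>-th dilated member of the model has the function
  \<open>D\<^sub>n t = (C (\<theta>\<^sub>n + \<kappa>\<^sub>n t) - C \<theta>\<^sub>n) / (\<kappa>\<^sub>n c\<^sub>n)\<close>, where \<open>\<kappa>\<^sub>n = c\<^sub>n powr (1 - p) * \<gamma>\<close>. The theorem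
  follows from the convergence of these functions.

  First, "near \<open>0\<close>" may depend on \<open>n\<close>. A moment generating function comes from a positive
  measure, and by Landau's lemma it converges wherever it has an analytic continuation along the real
  line (\<open>mgf_extends_along_interval\<close>, \<open>fcgf_extends\<close>). So the formula for \<open>D\<^sub>n\<close> holds as long as
  \<open>\<theta>\<^sub>n + \<kappa>\<^sub>n t\<close> stays in the interior of the domain of \<open>C\<close>, and convergence on a fixed interval
  gives a weak limit by the continuity theorem of Curtiss (\<open>mgf_continuity\<close>).

  Secondly, let \<open>\<mu> > 0\<close>. The derivative \<open>m\<^sub>n\<close> of \<open>D\<^sub>n\<close> satisfies
  \<open>m\<^sub>n' = \<gamma> c\<^sub>n powr (- p) * v (c\<^sub>n m\<^sub>n)\<close> with initial value \<open>\<mu>\<close>, and by hypothesis the right-hand side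
  is asymptotic to \<open>\<gamma> c0 m\<^sub>n powr p\<close>. In the coordinate that separates the variables of the limiting
  equation, all \<open>m\<^sub>n\<close> move with speed close to \<open>1\<close>. This gives a common interval of existence and the
  convergence of \<open>m\<^sub>n\<close> and \<open>D\<^sub>n\<close> to the solution of \<open>m' = \<gamma> c0 m powr p\<close> and its primitive
  (\<open>positive_mean_limit\<close>). The weak limit generates the required power dispersion model by itself
  (\<open>is_PT_I\<close>).

  Thirdly, \<open>\<mu> \<le> 0\<close> is possible only for \<open>p = 0\<close>. Then the limiting function would be the
  quadratic \<open>d t\<^sup>2 / 2 + \<mu> t\<close> or \<open>d t\<^sup>2 / 2\<close> with \<open>d \<noteq> 0\<close>, perhaps on a one-sided interval and up to a
  constant. By the continuation argument the exponential of this quadratic in \<open>exp s - 1\<close> would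
  be a multiple of a moment generating function on the whole line, but it is not log-convex
  (\<open>quadratic_fcgf_limit\<close>). So no sequence satisfies the hypotheses in this case.
\<close>

section \<open>Moment generating functions and their complex continuation\<close>

definition mgf_dom :: "real measure \<Rightarrow> real set" where
  "mgf_dom L = {s. integrable L (\<lambda>x. exp (s * x))}"

definition mgf :: "real measure \<Rightarrow> real \<Rightarrow> real" where
  "mgf L s = (\<integral>x. exp (s * x) \<partial>L)"

text \<open>The Laplace transform with complex argument; it is the analytic continuation of \<open>mgf L\<close> to a
  strip, and on the imaginary axis it is the characteristic function.\<close>

definition cmgf :: "real measure \<Rightarrow> complex \<Rightarrow> complex" where
  "cmgf L z = (\<integral>x. exp (z * of_real x) \<partial>L)"

lemma exp_between_le:
  fixes s a b x :: real
  assumes "a \<le> s" "s \<le> b"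
  shows "exp (s * x) \<le> exp (a * x) + exp (b * x)"
proof (cases "x \<ge> 0")
  case True
  then have "s * x \<le> b * x" using assms by (intro mult_right_mono) auto
  then have "exp (s * x) \<le> exp (b * x)" by simp
  then show ?thesis using exp_ge_zero[of "a * x"] by linarith
next
  case False
  then have "s * x \<le> a * x" using assms by (intro mult_right_mono_neg) auto
  then have "exp (s * x) \<le> exp (a * x)" by simp
  then show ?thesis using exp_ge_zero[of "b * x"] by linarith
qed

lemma exp_abs_le:
  fixes s r x :: real
  shows "exp (s * x) * exp (r * \<bar>x\<bar>) \<le> exp ((s - r) * x) + exp ((s + r) * x)"
  by (cases "x \<ge> 0") (auto simp: exp_add[symmetric] algebra_simps add_increasing add_increasing2)

context real_distribution
begin

lemma mgf_dom_between:
  assumes "a \<in> mgf_dom M" "b \<in> mgf_dom M" "a \<le> s" "s \<le> b"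
  shows "s \<in> mgf_dom M"
  unfolding mgf_dom_def mem_Collect_eq
proof (rule Bochner_Integration.integrable_bound)
  show "integrable M (\<lambda>x. exp (a * x) + exp (b * x))"
    using assms by (auto simp: mgf_dom_def)
  show "AE x in M. norm (exp (s * x)) \<le> norm (exp (a * x) + exp (b * x))"
  proof (intro always_eventually allI)
    fix x :: real
    have "exp (a * x) + exp (b * x) > 0" by (simp add: add_pos_pos)
    then show "norm (exp (s * x)) \<le> norm (exp (a * x) + exp (b * x))"
      using exp_between_le[OF assms(3,4), of x] by simp
  qed
qed auto

lemma mgf_0 [simp]: "mgf M 0 = 1"
  using prob_space by (simp add: mgf_def)

lemma mgf_pos:
  assumes "s \<in> mgf_dom M"
  shows "mgf M s > 0"
proof -
  have "mgf M s \<ge> 0" unfolding mgf_def by (intro integral_nonneg_AE) auto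
  moreover have "mgf M s \<noteq> 0"
  proof
    assume "mgf M s = 0"
    then have "AE x in M. exp (s * x) = 0"
      using assms integral_nonneg_eq_0_iff_AE[of M "\<lambda>x. exp (s * x)"]
      by (auto simp: mgf_def mgf_dom_def)
    then have "AE x in M. False" by simp
    then show False by (simp add: AE_False)
  qed
  ultimately show ?thesis by simp
qed

lemma integrable_exp_abs:
  assumes "s - r \<in> mgf_dom M" "s + r \<in> mgf_dom M"
  shows "integrable M (\<lambda>x. exp (s * x) * exp (r * \<bar>x\<bar>))"
proof (rule Bochner_Integration.integrable_bound)
  show "integrable M (\<lambda>x. exp ((s - r) * x) + exp ((s + r) * x))"
    using assms by (auto simp: mgf_dom_def)
  show "AE x in M. norm (exp (s * x) * exp (r * \<bar>x\<bar>)) \<le> norm (exp ((s - r) * x) + exp ((s + r) * x))"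
  proof (intro always_eventually allI)
    fix x :: real
    have "exp ((s - r) * x) + exp ((s + r) * x) > 0" by (simp add: add_pos_pos)
    then show "norm (exp (s * x) * exp (r * \<bar>x\<bar>)) \<le> norm (exp ((s - r) * x) + exp ((s + r) * x))"
      using exp_abs_le[of s x r] by simp
  qed
qed auto

lemma integrable_moment_exp:
  fixes z :: complex
  assumes "0 < r" "Re z - r \<in> mgf_dom M" "Re z + r \<in> mgf_dom M"
  shows "integrable M (\<lambda>x. complex_of_real x ^ k * exp (z * of_real x))"
proof (rule Bochner_Integration.integrable_bound)
  show "integrable M (\<lambda>x. fact k / r ^ k * (exp (Re z * x) * exp (r * \<bar>x\<bar>)))"
    using integrable_exp_abs[OF assms(2,3)] by (intro integrable_mult_right) auto
  show "AE x in M. norm (complex_of_real x ^ k * exp (z * of_real x))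
          \<le> norm (fact k / r ^ k * (exp (Re z * x) * exp (r * \<bar>x\<bar>)))"
  proof (intro always_eventually allI)
    fix x :: real
    have "(\<Sum>n\<in>{k}. inverse (fact n) * (r * \<bar>x\<bar>) ^ n) \<le> exp (r * \<bar>x\<bar>)"
      unfolding exp_def
      using summable_exp[of "r * \<bar>x\<bar>"] assms(1)
      by (subst suminf_cong[of _ "\<lambda>n. inverse (fact n) * (r * \<bar>x\<bar>) ^ n"])
         (auto intro!: sum_le_suminf[of _ "{k}", simplified] simp: scaleR_conv_of_real)
    then have "r ^ k * \<bar>x\<bar> ^ k \<le> fact k * exp (r * \<bar>x\<bar>)"
      by (simp add: field_simps power_mult_distrib)
    then have "\<bar>x\<bar> ^ k \<le> fact k / r ^ k * exp (r * \<bar>x\<bar>)"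
      using assms(1) by (simp add: field_simps)
    then have "\<bar>x\<bar> ^ k * exp (Re z * x) \<le> fact k / r ^ k * exp (r * \<bar>x\<bar>) * exp (Re z * x)"
      by (intro mult_right_mono) auto
    then show "norm (complex_of_real x ^ k * exp (z * of_real x))
          \<le> norm (fact k / r ^ k * (exp (Re z * x) * exp (r * \<bar>x\<bar>)))"
      using assms(1) by (simp add: norm_mult norm_power abs_mult mult_ac)
  qed
qed auto

text \<open>The exponential series may be integrated term by term, because its partial sums are dominated by
  \<open>exp (Re z * x) * exp (r * \<bar>x\<bar>)\<close>. The coefficients are exponentially weighted moments; that they
  are moments of a positive measure is what makes the continuation argument below work.\<close>

lemma cmgf_power_series:
  fixes z h :: complex
  assumes "0 < r" "Re z - r \<in> mgf_dom M" "Re z + r \<in> mgf_dom M" and h: "norm h \<le> r"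
  shows "(\<lambda>k. (\<integral>x. complex_of_real x ^ k * exp (z * of_real x) \<partial>M) / fact k * h ^ k)
           sums cmgf M (z + h)"
proof -
  define s where "s n x = (\<Sum>k<n. (h * complex_of_real x) ^ k / fact k) * exp (z * of_real x)" for n x
  have "(\<lambda>n. \<integral>x. s n x \<partial>M) \<longlonglongrightarrow> (\<integral>x. exp ((z + h) * of_real x) \<partial>M)"
  proof (rule integral_dominated_convergence)
    show "integrable M (\<lambda>x. exp (Re z * x) * exp (r * \<bar>x\<bar>))"
      by (rule integrable_exp_abs[OF assms(2,3)])
    show "AE x in M. (\<lambda>n. s n x) \<longlonglongrightarrow> exp ((z + h) * complex_of_real x)"
    proof (intro always_eventually allI)
      fix x :: real
      have "(\<lambda>n. \<Sum>k<n. (h * complex_of_real x) ^ k / fact k) \<longlonglongrightarrow> exp (h * of_real x)"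
        using exp_converges[of "h * of_real x"]
        by (simp add: sums_def scaleR_conv_of_real field_simps)
      then show "(\<lambda>n. s n x) \<longlonglongrightarrow> exp ((z + h) * complex_of_real x)"
        unfolding s_def distrib_right add.commute[of "z * _"] exp_add by (intro tendsto_mult) auto
    qed
    show "AE x in M. norm (s n x) \<le> exp (Re z * x) * exp (r * \<bar>x\<bar>)" for n
    proof (intro always_eventually allI)
      fix x :: real
      have "norm (\<Sum>k<n. (h * complex_of_real x) ^ k / fact k) \<le> (\<Sum>k<n. (r * \<bar>x\<bar>) ^ k / fact k)"
      proof (rule order_trans[OF norm_sum], rule sum_mono)
        fix k
        have "(norm h * \<bar>x\<bar>) ^ k \<le> (r * \<bar>x\<bar>) ^ k"
          using h by (intro power_mono mult_right_mono) auto
        then show "norm ((h * complex_of_real x) ^ k / fact k) \<le> (r * \<bar>x\<bar>) ^ k / fact k"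
          by (simp add: norm_divide norm_power norm_mult divide_right_mono)
      qed
      also have "\<dots> \<le> exp (r * \<bar>x\<bar>)"
      proof -
        have "(\<Sum>k<n. (r * \<bar>x\<bar>) ^ k /\<^sub>R fact k) \<le> exp (r * \<bar>x\<bar>)"
          unfolding exp_def using assms(1) by (intro sum_le_suminf summable_exp_generic) auto
        then show ?thesis by (simp add: field_simps)
      qed
      finally show "norm (s n x) \<le> exp (Re z * x) * exp (r * \<bar>x\<bar>)"
        unfolding s_def norm_mult by (simp add: mult.commute[of "exp (Re z * x)"] mult_right_mono)
    qed
  qed (auto simp: s_def)
  moreover have "(\<integral>x. s n x \<partial>M) = (\<Sum>k<n. (\<integral>x. complex_of_real x ^ k * exp (z * of_real x) \<partial>M) / fact k * h ^ k)" for n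
  proof -
    have "(\<integral>x. s n x \<partial>M) = (\<integral>x. (\<Sum>k<n. (h ^ k / fact k) * (complex_of_real x ^ k * exp (z * of_real x))) \<partial>M)"
      unfolding s_def
      by (intro Bochner_Integration.integral_cong refl)
         (simp add: sum_distrib_right sum_distrib_left power_mult_distrib mult_ac)
    also have "\<dots> = (\<Sum>k<n. \<integral>x. (h ^ k / fact k) * (complex_of_real x ^ k * exp (z * of_real x)) \<partial>M)"
      using integrable_moment_exp[OF assms(1-3)]
      by (intro Bochner_Integration.integral_sum integrable_mult_right) auto
    also have "\<dots> = (\<Sum>k<n. (\<integral>x. complex_of_real x ^ k * exp (z * of_real x) \<partial>M) / fact k * h ^ k)"
    proof (rule sum.cong)
      fix k
      show "(\<integral>x. (h ^ k / fact k) * (complex_of_real x ^ k * exp (z * of_real x)) \<partial>M)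
          = (\<integral>x. complex_of_real x ^ k * exp (z * of_real x) \<partial>M) / fact k * h ^ k"
        by (subst Bochner_Integration.integral_mult_right_zero) simp
    qed simp
    finally show ?thesis .
  qed
  ultimately show ?thesis
    unfolding sums_def cmgf_def by simp
qed

lemma cmgf_of_real: "cmgf M (of_real s) = of_real (mgf M s)"
proof -
  have "cmgf M (of_real s) = (\<integral>x. complex_of_real (exp (s * x)) \<partial>M)"
    unfolding cmgf_def by (intro Bochner_Integration.integral_cong refl) (simp add: exp_of_real[symmetric])
  then show ?thesis by (simp add: mgf_def)
qed

lemma interior_mgf_dom_obtain:
  assumes "s \<in> interior (mgf_dom M)"
  obtains r where "0 < r" "s - r \<in> mgf_dom M" "s + r \<in> mgf_dom M"
proof -
  obtain e where "0 < e" "ball s e \<subseteq> mgf_dom M"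
    using assms by (auto simp: mem_interior)
  then show ?thesis
    by (intro that[of "e/2"]) (auto simp: subset_iff dist_real_def)
qed

lemma cmgf_analytic:
  assumes "Re z \<in> interior (mgf_dom M)"
  shows "cmgf M analytic_on {z}"
proof -
  obtain r where r: "0 < r" "Re z - r \<in> mgf_dom M" "Re z + r \<in> mgf_dom M"
    using interior_mgf_dom_obtain[OF assms] .
  have "cmgf M holomorphic_on ball z r"
  proof (rule power_series_holomorphic)
    fix w assume "w \<in> ball z r"
    then show "(\<lambda>k. ((\<integral>x. complex_of_real x ^ k * exp (z * of_real x) \<partial>M) / fact k) * (w - z) ^ k) sums cmgf M w"
      using cmgf_power_series[OF r, of "w - z"] by (simp add: dist_norm norm_minus_commute)
  qed
  then show ?thesis using r(1) unfolding analytic_on_def by auto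
qed

end

text \<open>Real analyticity is expressed through a complex continuation, so that its closure properties are
  inherited from complex analysis.\<close>

definition real_analytic_at :: "(real \<Rightarrow> real) \<Rightarrow> real \<Rightarrow> bool" where
  "real_analytic_at g s \<longleftrightarrow>
     (\<exists>G. G analytic_on {complex_of_real s} \<and> (\<forall>\<^sub>F x in nhds s. G (of_real x) = of_real (g x)))"

lemma real_analytic_at_isCont:
  assumes "real_analytic_at g s"
  shows "isCont g s"
proof -
  obtain G where G: "G analytic_on {complex_of_real s}" "\<forall>\<^sub>F x in nhds s. G (of_real x) = of_real (g x)"
    using assms by (auto simp: real_analytic_at_def)
  have "isCont G (of_real s)" using G(1) by (rule analytic_at_imp_isCont)
  then have "isCont (\<lambda>x. Re (G (of_real x))) s"
    by (intro continuous_Re isCont_o2[OF isCont_of_real]) auto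
  moreover have "\<forall>\<^sub>F x in nhds s. Re (G (of_real x)) = g x"
    using G(2) by eventually_elim simp
  ultimately show ?thesis by (simp cong: isCont_cong)
qed

lemma real_analytic_at_compose:
  assumes "real_analytic_at f (g s)" "real_analytic_at g s"
  shows "real_analytic_at (\<lambda>x. f (g x)) s"
proof -
  obtain G where G: "G analytic_on {complex_of_real s}" "\<forall>\<^sub>F x in nhds s. G (of_real x) = of_real (g x)"
    using assms(2) by (auto simp: real_analytic_at_def)
  obtain H where H: "H analytic_on {complex_of_real (g s)}" "\<forall>\<^sub>F x in nhds (g s). H (of_real x) = of_real (f x)"
    using assms(1) by (auto simp: real_analytic_at_def)
  have Gs: "G (of_real s) = of_real (g s)" using G(2) by (rule eventually_nhds_x_imp_x)
  have "(H \<circ> G) analytic_on {of_real s}"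
    by (rule analytic_on_compose[OF G(1)]) (simp add: Gs H(1))
  moreover have "filterlim g (nhds (g s)) (nhds s)"
    using real_analytic_at_isCont[OF assms(2)] by (simp add: isCont_def tendsto_nhds_iff)
  then have "\<forall>\<^sub>F x in nhds s. H (of_real (g x)) = of_real (f (g x))"
    using H(2) by (auto simp: filterlim_iff)
  then have "\<forall>\<^sub>F x in nhds s. (H \<circ> G) (of_real x) = of_real (f (g x))"
    using G(2) by eventually_elim simp
  ultimately show ?thesis unfolding real_analytic_at_def by blast
qed

lemma real_analytic_at_exp: "real_analytic_at exp s"
  unfolding real_analytic_at_def
  by (intro exI[of _ exp]) (auto intro!: analytic_intros simp: exp_of_real)

lemma real_analytic_at_ln: "0 < s \<Longrightarrow> real_analytic_at ln s"
  unfolding real_analytic_at_def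
proof (intro exI[of _ Ln] conjI)
  assume "0 < s"
  then show "Ln analytic_on {complex_of_real s}"
    by (intro analytic_intros) (auto simp: complex_nonpos_Reals_iff)
  have "\<forall>\<^sub>F x in nhds s. 0 < x" using \<open>0 < s\<close> by (rule order_tendstoD[OF filterlim_ident])
  then show "\<forall>\<^sub>F x in nhds s. Ln (complex_of_real x) = of_real (ln x)"
    by eventually_elim (simp add: Ln_of_real)
qed

lemma real_analytic_at_affine: "real_analytic_at (\<lambda>x. a + b * x) s"
  unfolding real_analytic_at_def
  by (intro exI[of _ "\<lambda>z. of_real a + of_real b * z"]) (auto intro!: analytic_intros)

lemma (in real_distribution) real_analytic_at_mgf:
  assumes "s \<in> interior (mgf_dom M)"
  shows "real_analytic_at (mgf M) s"
  unfolding real_analytic_at_def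
  using assms by (intro exI[of _ "cmgf M"]) (auto intro: cmgf_analytic simp: cmgf_of_real)

section \<open>Analytic continuation and uniqueness of moment generating functions\<close>

lemma powser_coeffs_unique:
  fixes a b :: "nat \<Rightarrow> complex"
  assumes R: "0 < R"
    and a: "\<And>w. norm w < R \<Longrightarrow> (\<lambda>n. a n * w ^ n) sums f w"
    and b: "\<And>w. norm w < R \<Longrightarrow> (\<lambda>n. b n * w ^ n) sums g w"
    and eq: "\<forall>\<^sub>F x in nhds (0::real). f (of_real x) = g (of_real x)"
  shows "a = b"
proof -
  have d: "(\<lambda>n. (a n - b n) * (w - 0) ^ n) sums (f w - g w)" if "norm (w - 0) < R" for w
    using sums_diff[OF a b, of w] that by (simp add: algebra_simps)
  have fg0: "f 0 - g 0 = 0" using eventually_nhds_x_imp_x[OF eq] by simp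
  have pos: "a m - b m = 0" if "m > 0" for m
  proof (rule ccontr)
    assume "a m - b m \<noteq> 0"
    then obtain s where s: "0 < s" "\<And>z. z \<in> cball 0 s - {0} \<Longrightarrow> f z - g z \<noteq> 0"
      using powser_0_nonzero[where a = "\<lambda>n. a n - b n" and f = "\<lambda>w. f w - g w" and \<xi> = 0, OF R d fg0 _ \<open>m > 0\<close>]
      by metis
    obtain e where e: "0 < e" "\<And>x. \<bar>x\<bar> < e \<Longrightarrow> f (of_real x) = g (of_real x)"
      using eq by (auto simp: eventually_nhds_metric dist_real_def)
    define x where "x = min (s/2) (e/2)"
    have "0 < x" "x < e" "x \<le> s" using s e by (auto simp: x_def)
    then show False using s(2)[of "of_real x"] e(2)[of x] by auto
  qed
  have "a 0 = f 0" using sums_unique2[OF a[of 0] powser_sums_zero[of a]] R by simp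
  moreover have "b 0 = g 0" using sums_unique2[OF b[of 0] powser_sums_zero[of b]] R by simp
  ultimately have "a 0 = b 0" using fg0 by simp
  with pos show ?thesis by (metis eq_iff_diff_eq_0 ext gr0I)
qed

context real_distribution
begin

text \<open>Landau's lemma on Laplace transforms of positive measures: an analytic continuation to a disc
  forces the integral itself to converge there. The continuation has a power series
  \<open>\<Sum>a\<^sub>k h\<^sup>k\<close> that converges absolutely for \<open>\<bar>h\<bar> < R\<close>, and its coefficients are weighted moments divided by
  \<open>k!\<close>. The even ones are integrals of nonnegative functions, so that integrating the series of \<open>cosh (h x)\<close> term
  by term shows \<open>cosh (h x) exp (s x)\<close> to be integrable; this function dominates
  \<open>exp ((s + h) x)\<close> and \<open>exp ((s - h) x)\<close>.\<close>

lemma mgf_extends_to_disc: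
  assumes s: "s \<in> interior (mgf_dom M)"
    and G: "G holomorphic_on ball (of_real s) R"
    and eq: "\<forall>\<^sub>F x in nhds s. of_real (mgf M x) = G (of_real x)"
    and x: "\<bar>x - s\<bar> < R"
  shows "x \<in> interior (mgf_dom M)" "of_real (mgf M x) = G (of_real x)"
proof -
  obtain r0 where r0: "0 < r0" "s - r0 \<in> mgf_dom M" "s + r0 \<in> mgf_dom M"
    using interior_mgf_dom_obtain[OF s] .
  have R: "0 < R" using x by linarith
  define a where "a k = (\<integral>x. x ^ k * exp (s * x) \<partial>M) / fact k" for k
  have ca: "(\<integral>x. complex_of_real x ^ k * exp (of_real s * of_real x) \<partial>M) / fact k = of_real (a k)" for k
  proof -
    have "(\<integral>x. complex_of_real x ^ k * exp (of_real s * of_real x) \<partial>M)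
        = (\<integral>x. complex_of_real (x ^ k * exp (s * x)) \<partial>M)"
      by (intro Bochner_Integration.integral_cong refl) (simp add: exp_of_real[symmetric])
    also have "\<dots> = of_real (\<integral>x. x ^ k * exp (s * x) \<partial>M)"
      by (rule integral_complex_of_real)
    finally show ?thesis by (simp add: a_def)
  qed
  have ser: "(\<lambda>k. of_real (a k) * h ^ k) sums cmgf M (of_real s + h)"
    if "0 < r" "s - r \<in> mgf_dom M" "s + r \<in> mgf_dom M" "norm h \<le> r" for r h
    using cmgf_power_series[of r "of_real s" h] that by (simp add: ca)
  define g where "g k = (deriv ^^ k) G (of_real s) / fact k" for k
  have Gser: "(\<lambda>k. g k * h ^ k) sums G (of_real s + h)" if "norm h < R" for h
    using holomorphic_power_series[OF G, of "of_real s + h"] that by (simp add: g_def dist_norm)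
  have "(\<lambda>k. of_real (a k)) = g"
  proof (rule powser_coeffs_unique[of "min R r0"])
    show "(\<lambda>n. of_real (a n) * w ^ n) sums cmgf M (of_real s + w)" if "norm w < min R r0" for w
      using ser[OF r0] that by simp
    show "(\<lambda>n. g n * w ^ n) sums G (of_real s + w)" if "norm w < min R r0" for w
      using Gser that by simp
    have "filterlim (\<lambda>x. s + x) (nhds s) (nhds 0)"
      by (auto intro!: tendsto_eq_intros filterlim_ident)
    then have "\<forall>\<^sub>F x in nhds 0. of_real (mgf M (s + x)) = G (of_real (s + x))"
      using eq by (auto simp: filterlim_iff)
    then show "\<forall>\<^sub>F x in nhds 0. cmgf M (of_real s + of_real x) = G (of_real s + of_real x)"
      by eventually_elim (simp add: cmgf_of_real[symmetric])
  qed (use R r0 in auto)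
  then have ga: "g k = of_real (a k)" for k by (metis)
  have dom: "s - h \<in> mgf_dom M \<and> s + h \<in> mgf_dom M" if h: "0 < h" "h < R" for h
  proof -
    define f where "f k x = (if even k then (h * x) ^ k /\<^sub>R fact k else 0) * exp (s * x)" for k and x :: real
    have int: "integrable M (\<lambda>x. x ^ k * exp (s * x))" for k
    proof -
      have "integrable M (\<lambda>x. Re (complex_of_real x ^ k * exp (of_real s * of_real x)))"
        using integrable_moment_exp[of r0 "of_real s" k] r0 by (intro integrable_Re) auto
      also have "(\<lambda>x. Re (complex_of_real x ^ k * exp (of_real s * of_real x))) = (\<lambda>x. x ^ k * exp (s * x))"
        by (metis (no_types) Re_complex_of_real exp_of_real of_real_mult of_real_power)
      finally show ?thesis .
    qed
    have f_int: "integrable M (f k)" for k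
    proof -
      have "f k = (\<lambda>x. (if even k then h ^ k / fact k else 0) * (x ^ k * exp (s * x)))"
        by (auto simp: f_def power_mult_distrib field_simps)
      then show ?thesis using int[of k] by simp
    qed
    have f_nonneg: "0 \<le> f k x" for k x
      by (auto simp: f_def zero_le_even_power)
    have f_sums: "(\<lambda>k. f k x) sums (cosh (h * x) * exp (s * x))" for x
      unfolding f_def by (intro sums_mult2 cosh_converges)
    have f_integral: "(\<integral>x. f k x \<partial>M) = (if even k then a k * h ^ k else 0)" for k
    proof (cases "even k")
      case True
      have "(\<integral>x. f k x \<partial>M) = (\<integral>x. (h ^ k / fact k) * (x ^ k * exp (s * x)) \<partial>M)"
        using True by (intro Bochner_Integration.integral_cong refl) (simp add: f_def power_mult_distrib field_simps)
      then show ?thesis using True by (simp add: a_def)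
    qed (simp add: f_def)
    have "integrable M (\<lambda>x. \<Sum>k. f k x)"
    proof (rule integrable_suminf[OF f_int])
      show "AE x in M. summable (\<lambda>k. norm (f k x))"
        using f_nonneg sums_summable[OF f_sums] by simp
      \<comment> \<open>absolute convergence at h follows from convergence at a larger radius\<close>
      define h' where "h' = (h + R) / 2"
      have h': "h < h'" "h' < R" "0 < h'" using h by (auto simp: h'_def)
      have "summable (\<lambda>k. g k * complex_of_real h' ^ k)"
        using Gser[of "of_real h'"] h' by (auto intro: sums_summable)
      then have "summable (\<lambda>k. norm (g k * complex_of_real h ^ k))"
        by (rule powser_insidea) (use h' h in auto)
      then show "summable (\<lambda>k. \<integral>x. norm (f k x) \<partial>M)"
      proof (rule summable_comparison_test'[of _ 0])
        fix k show "norm (\<integral>x. norm (f k x) \<partial>M) \<le> norm (g k * complex_of_real h ^ k)"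
          using f_integral[of k] f_nonneg[of k]
          by (simp add: ga norm_mult norm_power abs_mult power_abs)
      qed
    qed
    then have I: "integrable M (\<lambda>x. cosh (h * x) * exp (s * x))"
      using f_sums by (simp add: sums_iff)
    have le: "exp (h * x) \<le> 2 * cosh (h * x)" "exp (- h * x) \<le> 2 * cosh (h * x)" for x
      by (auto simp: cosh_def)
    have I2: "integrable M (\<lambda>x. 2 * (cosh (h * x) * exp (s * x)))" using I by simp
    show ?thesis unfolding mgf_dom_def mem_Collect_eq
    proof (intro conjI)
      have b: "exp ((s + h) * x) \<le> 2 * (cosh (h * x) * exp (s * x))"
              "exp ((s - h) * x) \<le> 2 * (cosh (h * x) * exp (s * x))" for x
        using mult_right_mono[OF le(1)[of x], of "exp (s * x)"] mult_right_mono[OF le(2)[of x], of "exp (s * x)"]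
        by (simp_all add: exp_add[symmetric] algebra_simps)
      have nb: "norm (exp ((s + h) * x)) \<le> norm (2 * (cosh (h * x) * exp (s * x)))"
               "norm (exp ((s - h) * x)) \<le> norm (2 * (cosh (h * x) * exp (s * x)))" for x
        using b[of x] by (simp_all add: abs_mult cosh_real_nonneg)
      show "integrable M (\<lambda>x. exp ((s - h) * x))"
        by (rule Bochner_Integration.integrable_bound[OF I2]) (measurable, intro always_eventually allI nb)
      show "integrable M (\<lambda>x. exp ((s + h) * x))"
        by (rule Bochner_Integration.integrable_bound[OF I2]) (measurable, intro always_eventually allI nb)
    qed
  qed
  have sub: "{s - R<..<s + R} \<subseteq> mgf_dom M"
  proof
    fix y assume y: "y \<in> {s - R<..<s + R}"
    define h where "h = (\<bar>y - s\<bar> + R) / 2"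
    have h: "0 < h" "h < R" "s - h \<le> y" "y \<le> s + h" using y by (auto simp: h_def field_simps)
    show "y \<in> mgf_dom M" using dom[OF h(1,2)] h(3,4) mgf_dom_between by blast
  qed
  then show "x \<in> interior (mgf_dom M)"
    by (intro interiorI[of "{s - R<..<s + R}"]) (use x in auto)
  define h where "h = (\<bar>x - s\<bar> + R) / 2"
  have h: "0 < h" "h < R" "\<bar>x - s\<bar> \<le> h" using x by (auto simp: h_def field_simps)
  have "(\<lambda>k. of_real (a k) * of_real (x - s) ^ k) sums cmgf M (of_real s + of_real (x - s))"
    using dom[OF h(1,2)] h by (intro ser[of h]) (auto simp del: of_real_diff)
  then have "(\<lambda>k. of_real (a k) * of_real (x - s) ^ k) sums cmgf M (of_real x)"
    by simp
  moreover have "(\<lambda>k. g k * of_real (x - s) ^ k) sums G (of_real s + of_real (x - s))"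
    using x by (intro Gser) (auto simp del: of_real_diff)
  ultimately show "of_real (mgf M x) = G (of_real x)"
    unfolding ga cmgf_of_real by (simp add: sums_unique2)
qed

text \<open>Discs around nearby points of the interval overlap, so the equality spreads from one point of the
  interval to all of it by connectedness.\<close>

theorem mgf_extends_along_interval:
  assumes g: "\<And>s. s \<in> {a<..<b} \<Longrightarrow> real_analytic_at g s"
    and s0: "s0 \<in> {a<..<b}" "s0 \<in> interior (mgf_dom M)" "\<forall>\<^sub>F x in nhds s0. mgf M x = g x"
    and s: "s \<in> {a<..<b}"
  shows "s \<in> interior (mgf_dom M) \<and> mgf M s = g s"
proof -
  let ?P = "\<lambda>s. s \<in> interior (mgf_dom M) \<and> (\<forall>\<^sub>F x in nhds s. mgf M x = g x)"
  have "?P s"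
  proof (rule connected_induction_simple[of "{a<..<b}" s0 s ?P])
    fix c assume c: "c \<in> {a<..<b}"
    obtain G where G: "G analytic_on {complex_of_real c}" "\<forall>\<^sub>F x in nhds c. G (of_real x) = of_real (g x)"
      using g[OF c] by (auto simp: real_analytic_at_def)
    obtain R1 where R1: "R1 > 0" "G holomorphic_on ball (of_real c) R1"
      using G(1) by (auto simp: analytic_on_def)
    obtain R2 where R2: "R2 > 0" "\<And>x. \<bar>x - c\<bar> < R2 \<Longrightarrow> G (of_real x) = of_real (g x)"
      using G(2) by (auto simp: eventually_nhds_metric dist_real_def)
    define R where "R = min R1 R2"
    have R: "R > 0" "R \<le> R1" "R \<le> R2" using R1 R2 by (auto simp: R_def)
    let ?T = "{a<..<b} \<inter> ball c (R/3)"
    have "?P y" if "x \<in> ?T" "y \<in> ?T" "?P x" for x y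
    proof -
      have xy: "\<bar>x - c\<bar> < R/3" "\<bar>y - c\<bar> < R/3" "\<bar>y - x\<bar> < 2*R/3"
        using that by (auto simp: dist_real_def abs_if split: if_splits)
      have hol: "G holomorphic_on ball (of_real x) (2*R/3)"
      proof (rule holomorphic_on_subset[OF R1(2)], rule subsetI)
        fix w assume w: "w \<in> ball (complex_of_real x) (2*R/3)"
        have "dist (complex_of_real c) w \<le> dist (complex_of_real c) (of_real x) + dist (of_real x) w"
          by (rule dist_triangle)
        also have "dist (complex_of_real c) (of_real x) = \<bar>x - c\<bar>"
          by (metis dist_norm norm_minus_commute norm_of_real of_real_diff)
        finally show "w \<in> ball (complex_of_real c) R1" using w xy R by simp
      qed
      have "\<forall>\<^sub>F u in nhds x. \<bar>u - c\<bar> < R"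
        using order_tendstoD(2)[OF tendsto_rabs[OF tendsto_diff[OF filterlim_ident tendsto_const[of c]]], of x R] xy R
        by auto
      then have eq: "\<forall>\<^sub>F u in nhds x. of_real (mgf M u) = G (of_real u)"
        using that(3)[THEN conjunct2] by eventually_elim (use R R2 in auto)
      have ext: "u \<in> interior (mgf_dom M) \<and> mgf M u = g u" if "\<bar>u - x\<bar> < 2*R/3" for u
        using mgf_extends_to_disc[OF _ hol eq that] R2(2)[of u] that xy R \<open>?P x\<close>
        by auto
      have "\<forall>\<^sub>F u in nhds y. \<bar>u - x\<bar> < 2*R/3"
        using order_tendstoD(2)[OF tendsto_rabs[OF tendsto_diff[OF filterlim_ident tendsto_const[of x]]], of y "2*R/3"] xy
        by auto
      then have "\<forall>\<^sub>F u in nhds y. mgf M u = g u"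
        by eventually_elim (use ext in auto)
      with ext[OF xy(3)] show "?P y" by auto
    qed
    moreover have "openin (top_of_set {a<..<b}) ?T" by (simp add: openin_open_Int)
    moreover have "c \<in> ?T" using c R by auto
    ultimately show "\<exists>T. openin (top_of_set {a<..<b}) T \<and> c \<in> T \<and> (\<forall>x\<in>T. \<forall>y\<in>T. ?P x \<longrightarrow> ?P y)"
      by blast
  qed (use s0 s in auto)
  then show ?thesis by (auto dest: eventually_nhds_x_imp_x)
qed

end

text \<open>Two transforms that agree on a real interval around \<open>0\<close> agree on the vertical strip above it by the
  identity theorem, in particular on the imaginary axis, where they are the characteristic
  functions.\<close>

theorem mgf_unique:
  assumes M: "real_distribution M" and N: "real_distribution N" and d: "0 < d"
    and dom: "\<And>s. \<bar>s\<bar> < d \<Longrightarrow> s \<in> mgf_dom M \<and> s \<in> mgf_dom N \<and> mgf M s = mgf N s"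
  shows "M = N"
proof (rule Levy_uniqueness[OF M N])
  let ?S = "{z. - d < Re z} \<inter> {z. Re z < d}"
  have an: "cmgf L holomorphic_on ?S"
    if L: "real_distribution L" "\<And>s. \<bar>s\<bar> < d \<Longrightarrow> s \<in> mgf_dom L" for L
  proof -
    have "{-d<..<d} \<subseteq> interior (mgf_dom L)"
      using L(2) by (intro interior_maximal) (auto simp: abs_less_iff)
    then have "cmgf L analytic_on {z}" if "z \<in> ?S" for z
      using that by (intro real_distribution.cmgf_analytic[OF L(1)]) auto
    then show ?thesis
      by (meson analytic_imp_holomorphic analytic_on_analytic_at)
  qed
  have "char M t = char N t" for t
  proof -
    have "cmgf M (\<i> * of_real t) - cmgf N (\<i> * of_real t) = 0"
    proof (rule analytic_continuation[where f = "\<lambda>z. cmgf M z - cmgf N z" and S = ?S and \<xi> = 0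
          and U = "complex_of_real ` {-d<..<d}"])
      show "(\<lambda>z. cmgf M z - cmgf N z) holomorphic_on ?S"
        using an[OF M] an[OF N] dom by (intro holomorphic_intros) auto
      show "open ?S" by (intro open_Int open_halfspace_Re_gt open_halfspace_Re_lt)
      show "connected ?S"
        by (intro convex_connected convex_Int convex_halfspace_Re_gt convex_halfspace_Re_lt)
      show "complex_of_real ` {-d<..<d} \<subseteq> ?S" by auto
      show "(0::complex) islimpt complex_of_real ` {-d<..<d}"
        unfolding islimpt_approachable
      proof (intro allI impI)
        fix e :: real assume "0 < e"
        then show "\<exists>x'\<in>complex_of_real ` {-d<..<d}. x' \<noteq> 0 \<and> dist x' 0 < e"
          using d by (intro bexI[of _ "of_real (min (e/2) (d/2))"] image_eqI[OF refl]) auto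
      qed
      show "cmgf M z - cmgf N z = 0" if "z \<in> complex_of_real ` {-d<..<d}" for z
        using that dom real_distribution.cmgf_of_real[OF M] real_distribution.cmgf_of_real[OF N]
        by (auto simp: abs_less_iff)
    qed (use d in auto)
    then show ?thesis
      by (simp add: char_def cmgf_def mult_ac)
  qed
  then show "char M = char N" by auto
qed

section \<open>Weak convergence, tilting and log-convexity\<close>

text \<open>Replacing \<open>x\<close> by its truncation to \<open>[-K, K]\<close> makes \<open>exp (s x)\<close> bounded, at a cost that is small
  uniformly over all measures with a common bound on \<open>exp (r x) + exp (- r x)\<close>.\<close>

lemma exp_clamp_error:
  fixes s r K x :: real
  assumes "\<bar>s\<bar> < r" "0 \<le> K"
  shows "\<bar>exp (s * x) - exp (s * max (- K) (min K x))\<bar>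
           \<le> exp (- (r - \<bar>s\<bar>) * K) * (exp (r * x) + exp (- r * x))"
proof (cases "\<bar>x\<bar> \<le> K")
  case True
  then have "max (- K) (min K x) = x" by auto
  then show ?thesis by (simp add: add_nonneg_nonneg)
next
  case False
  let ?c = "max (- K) (min K x)"
  have c: "\<bar>?c\<bar> \<le> \<bar>x\<bar>" using False assms by auto
  have b: "exp (s * y) \<le> exp (\<bar>s\<bar> * \<bar>x\<bar>)" if "\<bar>y\<bar> \<le> \<bar>x\<bar>" for y
  proof -
    have "s * y \<le> \<bar>s\<bar> * \<bar>y\<bar>" by (metis abs_ge_self abs_mult)
    also have "\<dots> \<le> \<bar>s\<bar> * \<bar>x\<bar>" using that by (intro mult_left_mono) auto
    finally show ?thesis by simp
  qed
  have "\<bar>exp (s * x) - exp (s * ?c)\<bar> \<le> exp (\<bar>s\<bar> * \<bar>x\<bar>)"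
    using b[of x] b[OF c] exp_ge_zero[of "s * x"] exp_ge_zero[of "s * ?c"] by linarith
  also have "\<dots> = exp (- (r - \<bar>s\<bar>) * \<bar>x\<bar>) * exp (r * \<bar>x\<bar>)"
    by (simp add: exp_add[symmetric] algebra_simps)
  also have "\<dots> \<le> exp (- (r - \<bar>s\<bar>) * K) * (exp (r * x) + exp (- r * x))"
  proof (intro mult_mono)
    show "exp (- (r - \<bar>s\<bar>) * \<bar>x\<bar>) \<le> exp (- (r - \<bar>s\<bar>) * K)"
      using False assms by (simp add: mult_left_mono)
    show "exp (r * \<bar>x\<bar>) \<le> exp (r * x) + exp (- r * x)"
      by (cases "x \<ge> 0") auto
  qed auto
  finally show ?thesis .
qed

context
  fixes L :: "nat \<Rightarrow> real measure" and d :: real and \<psi> :: "real \<Rightarrow> real"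
  assumes L: "\<And>n. real_distribution (L n)"
    and d: "0 < d"
    and dom: "\<And>n s. \<bar>s\<bar> < d \<Longrightarrow> s \<in> mgf_dom (L n)"
    and conv: "\<And>s. \<bar>s\<bar> < d \<Longrightarrow> (\<lambda>n. mgf (L n) s) \<longlonglongrightarrow> \<psi> s"
begin

lemma two_sided_exp_bound:
  assumes "\<bar>r\<bar> < d"
  obtains B where "0 < B" "\<And>n. integrable (L n) (\<lambda>x. exp (r * x) + exp (- r * x))"
    "\<And>n. (\<integral>x. exp (r * x) + exp (- r * x) \<partial>L n) \<le> B"
proof -
  have "(\<lambda>n. mgf (L n) r + mgf (L n) (- r)) \<longlonglongrightarrow> \<psi> r + \<psi> (- r)"
    using assms by (intro tendsto_add conv) auto
  then obtain B where B: "0 < B" "\<And>n. norm (mgf (L n) r + mgf (L n) (- r)) \<le> B"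
    by (meson BseqE convergentI convergent_imp_Bseq)
  have i: "integrable (L n) (\<lambda>x. exp (r * x))" "integrable (L n) (\<lambda>x. exp (- r * x))" for n
    using dom[of r n] dom[of "- r" n] assms by (auto simp: mgf_dom_def)
  show ?thesis
  proof (rule that[OF B(1)])
    show "integrable (L n) (\<lambda>x. exp (r * x) + exp (- r * x))" for n using i by auto
    show "(\<integral>x. exp (r * x) + exp (- r * x) \<partial>L n) \<le> B" for n
      using B(2)[of n] i[of n] by (simp add: mgf_def abs_le_iff)
  qed
qed

text \<open>The common bound passes to the weak limit by truncation and monotone convergence, and uniform
  integrability then gives the convergence of the integrals of \<open>exp (s x)\<close>.\<close>

lemma mgf_of_weak_limit:
  assumes N: "real_distribution N" and w: "weak_conv_m L N" and s: "\<bar>s\<bar> < d"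
  shows "s \<in> mgf_dom N" "mgf N s = \<psi> s"
proof -
  interpret N: real_distribution N by fact
  interpret L: real_distribution "L n" for n by (rule L)
  define r where "r = (\<bar>s\<bar> + d) / 2"
  have r: "\<bar>s\<bar> < r" "r < d" "\<bar>r\<bar> < d" using s by (auto simp: r_def)
  let ?w = "\<lambda>x::real. exp (r * x) + exp (- r * x)"
  obtain B where B: "0 < B" "\<And>n. integrable (L n) ?w" "\<And>n. (\<integral>x. ?w x \<partial>L n) \<le> B"
    using two_sided_exp_bound[OF r(3)] by blast
  have w_pos: "0 < ?w x" for x by (simp add: add_pos_pos)
  note bdd_conv = weak_conv_imp_integral_bdd_continuous_conv[OF L N w]
  let ?f = "\<lambda>k x. min (?w x) (real k)"
  have f_bd: "\<bar>?f k x\<bar> \<le> real k" for k x using w_pos[of x] by auto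
  have f_intL: "integrable (L n) (?f k)" for n k
    using f_bd by (intro L.integrable_const_bound[of _ "real k"]) auto
  have f_int: "integrable N (?f k)" for k
    using f_bd by (intro N.integrable_const_bound[of _ "real k"]) auto
  have f_le: "(\<integral>x. ?f k x \<partial>N) \<le> B" for k
  proof (rule LIMSEQ_le_const2)
    show "(\<lambda>n. \<integral>x. ?f k x \<partial>L n) \<longlonglongrightarrow> (\<integral>x. ?f k x \<partial>N)"
      using f_bd by (intro bdd_conv[of _ "real k"] continuous_intros) auto
    have "(\<integral>x. ?f k x \<partial>L n) \<le> (\<integral>x. ?w x \<partial>L n)" for n
      by (intro integral_mono f_intL B(2)) auto
    then show "\<exists>N. \<forall>n\<ge>N. (\<integral>x. ?f k x \<partial>L n) \<le> B" using B(3) order_trans by blast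
  qed
  have "incseq (\<lambda>k. \<integral>x. ?f k x \<partial>N)"
    by (intro incseq_SucI integral_mono f_int) auto
  then obtain I where I: "(\<lambda>k. \<integral>x. ?f k x \<partial>N) \<longlonglongrightarrow> I"
    using incseq_convergent[of "\<lambda>k. \<integral>x. ?f k x \<partial>N" B] f_le by blast
  then have "I \<le> B" using f_le by (intro LIMSEQ_le_const2) auto
  have lim: "AE x in N. (\<lambda>k. ?f k x) \<longlonglongrightarrow> ?w x"
  proof (rule always_eventually, rule allI, rule tendsto_eventually)
    fix x
    obtain k0 where "?w x \<le> real k0" using real_arch_simple by blast
    then show "\<forall>\<^sub>F k in sequentially. ?f k x = ?w x"
      by (intro eventually_sequentiallyI[of k0]) auto
  qed
  have mono: "AE x in N. mono (\<lambda>k. ?f k x)"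
    by (auto simp: mono_def)
  have w_int: "integrable N ?w"
    by (rule integrable_monotone_convergence[OF f_int mono lim I]) auto
  have "(\<integral>x. ?w x \<partial>N) = I"
    by (rule integral_monotone_convergence[OF f_int mono lim I]) auto
  with \<open>I \<le> B\<close> have w_le: "(\<integral>x. ?w x \<partial>N) \<le> B" by simp
  have "norm (exp (r * x)) \<le> norm (?w x)" "norm (exp (- r * x)) \<le> norm (?w x)" for x
    using w_pos[of x] by auto
  then have "r \<in> mgf_dom N" "- r \<in> mgf_dom N" unfolding mgf_dom_def mem_Collect_eq
    by (auto intro!: Bochner_Integration.integrable_bound[OF w_int] simp del: real_norm_def)
  then show sN: "s \<in> mgf_dom N"
    using r by (intro N.mgf_dom_between[of "- r" r s]) auto
  let ?g = "\<lambda>K x. exp (s * max (- K) (min K x))"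
  have g_bd: "\<bar>?g K x\<bar> \<le> exp (\<bar>s\<bar> * K)" if "0 \<le> K" for K x
  proof -
    have "s * max (- K) (min K x) \<le> \<bar>s\<bar> * \<bar>max (- K) (min K x)\<bar>" by (metis abs_ge_self abs_mult)
    also have "\<dots> \<le> \<bar>s\<bar> * K" using that by (intro mult_left_mono) auto
    finally show ?thesis by simp
  qed
  have err: "\<bar>mgf Q s - (\<integral>x. ?g K x \<partial>Q)\<bar> \<le> exp (- (r - \<bar>s\<bar>) * K) * B"
    if "real_distribution Q" "s \<in> mgf_dom Q" "integrable Q ?w" "(\<integral>x. ?w x \<partial>Q) \<le> B" "0 \<le> K" for Q K
  proof -
    interpret Q: real_distribution Q by fact
    have gi: "integrable Q (?g K)"
      using g_bd[OF that(5)] by (intro Q.integrable_const_bound[of _ "exp (\<bar>s\<bar> * K)"]) auto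
    have ei: "integrable Q (\<lambda>x. exp (s * x))" using that by (simp add: mgf_dom_def)
    have "\<bar>mgf Q s - (\<integral>x. ?g K x \<partial>Q)\<bar> = \<bar>\<integral>x. exp (s * x) - ?g K x \<partial>Q\<bar>"
      unfolding mgf_def using gi ei by simp
    also have "\<dots> \<le> (\<integral>x. \<bar>exp (s * x) - ?g K x\<bar> \<partial>Q)"
      by (rule integral_abs_bound)
    also have "\<dots> \<le> (\<integral>x. exp (- (r - \<bar>s\<bar>) * K) * ?w x \<partial>Q)"
      using gi ei that exp_clamp_error[OF r(1) that(5)]
      by (intro integral_mono integrable_abs integrable_mult_right Bochner_Integration.integrable_diff) auto
    also have "\<dots> \<le> exp (- (r - \<bar>s\<bar>) * K) * B"
      using that(4) by (simp add: mult_left_mono del: minus_diff_eq)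
    finally show ?thesis .
  qed
  have "(\<lambda>n. mgf (L n) s) \<longlonglongrightarrow> mgf N s"
  proof (rule LIMSEQ_I)
    fix e :: real assume e: "0 < e"
    have "((\<lambda>K. exp (- (r - \<bar>s\<bar>) * K) * B) \<longlongrightarrow> 0 * B) at_top"
      using r(1)
      by (intro tendsto_mult tendsto_const filterlim_compose[OF exp_at_bot]
          filterlim_tendsto_neg_mult_at_bot[OF tendsto_const]) (auto intro: filterlim_ident)
    then have "\<forall>\<^sub>F K in at_top. exp (- (r - \<bar>s\<bar>) * K) * B < e / 3"
      using e by (intro order_tendstoD(2)[of _ "0 * B"]) auto
    then have "\<forall>\<^sub>F K in at_top. exp (- (r - \<bar>s\<bar>) * K) * B < e / 3 \<and> 0 \<le> K"
      using eventually_ge_at_top[of 0] by eventually_elim auto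
    then obtain K where K: "exp (- (r - \<bar>s\<bar>) * K) * B < e / 3" "0 \<le> K"
      using eventually_happens'[OF trivial_limit_at_top_linorder] by force
    have "(\<lambda>n. \<integral>x. ?g K x \<partial>L n) \<longlonglongrightarrow> (\<integral>x. ?g K x \<partial>N)"
      using g_bd[OF K(2)] by (intro bdd_conv[of _ "exp (\<bar>s\<bar> * K)"] continuous_intros) auto
    then obtain n0 where n0: "\<And>n. n \<ge> n0 \<Longrightarrow> norm ((\<integral>x. ?g K x \<partial>L n) - (\<integral>x. ?g K x \<partial>N)) < e / 3"
      using LIMSEQ_D[of _ _ "e/3"] e by fastforce
    have "norm (mgf (L n) s - mgf N s) < e" if "n \<ge> n0" for n
      using n0[OF that] err[OF L dom[OF s] B(2,3) K(2), of n] err[OF N sN w_int w_le K(2)] K(1)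
      unfolding real_norm_def by linarith
    then show "\<exists>no. \<forall>n\<ge>no. norm (mgf (L n) s - mgf N s) < e" by blast
  qed
  then show "mgf N s = \<psi> s" using conv[OF s] LIMSEQ_unique by blast
qed

text \<open>Markov's inequality for \<open>exp (r x) + exp (- r x)\<close>.\<close>

lemma tight_of_mgf: "tight L"
  unfolding tight_def
proof (intro conjI allI impI L)
  interpret L: real_distribution "L n" for n by (rule L)
  fix e :: real assume e: "0 < e"
  define r where "r = d / 2"
  have r: "0 < r" "\<bar>r\<bar> < d" using d by (auto simp: r_def)
  let ?w = "\<lambda>x::real. exp (r * x) + exp (- r * x)"
  obtain B where B: "0 < B" "\<And>n. integrable (L n) ?w" "\<And>n. (\<integral>x. ?w x \<partial>L n) \<le> B"
    using two_sided_exp_bound[OF r(2)] by blast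
  have "((\<lambda>K. exp (- r * K) * B) \<longlongrightarrow> 0 * B) at_top"
    using r(1)
    by (intro tendsto_mult tendsto_const filterlim_compose[OF exp_at_bot]
        filterlim_tendsto_neg_mult_at_bot[OF tendsto_const]) (auto intro: filterlim_ident)
  then have "\<forall>\<^sub>F K in at_top. exp (- r * K) * B < e"
    using e by (intro order_tendstoD(2)[of _ "0 * B"]) auto
  then have "\<forall>\<^sub>F K in at_top. exp (- r * K) * B < e \<and> 0 < K"
    using eventually_gt_at_top[of 0] by eventually_elim auto
  then obtain K where K: "exp (- r * K) * B < e" "0 < K"
    using eventually_happens'[OF trivial_limit_at_top_linorder] by force
  show "\<exists>a b. a < b \<and> (\<forall>n. measure (L n) {a<..b} > 1 - e)"
  proof (rule exI[of _ "- K"], rule exI[of _ K], intro conjI allI)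
    show "- K < K" using K by simp
    fix n
    have "1 - measure (L n) {-K<..K} = measure (L n) (- {-K<..K})"
      using L.prob_compl[of "{-K<..K}" n] by (simp add: Compl_eq_Diff_UNIV)
    also have "\<dots> = (\<integral>x. indicator (- {-K<..K}) x \<partial>L n)"
      by simp
    also have "\<dots> \<le> (\<integral>x. exp (- r * K) * ?w x \<partial>L n)"
    proof (rule integral_mono)
      show "indicator (- {-K<..K}) x \<le> exp (- r * K) * ?w x" for x
      proof (cases "x \<in> {-K<..K}")
        case False
        then have "r * K \<le> r * \<bar>x\<bar>" using r(1) by (intro mult_left_mono) auto
        then have "exp (r * K) \<le> exp (r * \<bar>x\<bar>)" by simp
        also have "\<dots> \<le> ?w x" by (cases "x \<ge> 0") auto
        finally have "exp (- r * K) * exp (r * K) \<le> exp (- r * K) * ?w x"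
          by (intro mult_left_mono) auto
        then show ?thesis using False by (simp add: exp_add[symmetric])
      qed (simp add: add_nonneg_nonneg)
      show "integrable (L n) (indicator (- {-K<..K}) :: real \<Rightarrow> real)"
        by (intro L.integrable_const_bound[of _ 1]) auto
    qed (use B(2) in auto)
    also have "\<dots> \<le> exp (- r * K) * B" using B(3) by (simp add: mult_left_mono)
    also have "\<dots> < e" by (rule K(1))
    finally show "measure (L n) {-K<..K} > 1 - e" by simp
  qed
qed

end

text \<open>Curtiss' continuity theorem. By tightness every subsequence has a weakly convergent subsequence; all
  limits have the moment generating function \<open>\<psi>\<close> near \<open>0\<close> and hence coincide.\<close>

theorem mgf_continuity:
  assumes L: "\<And>n. real_distribution (L n)" and d: "0 < d"
    and dom: "\<And>n s. \<bar>s\<bar> < d \<Longrightarrow> s \<in> mgf_dom (L n)"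
    and conv: "\<And>s. \<bar>s\<bar> < d \<Longrightarrow> (\<lambda>n. mgf (L n) s) \<longlonglongrightarrow> \<psi> s"
  obtains P where "real_distribution P" "weak_conv_m L P"
    "\<And>s. \<bar>s\<bar> < d \<Longrightarrow> s \<in> mgf_dom P \<and> mgf P s = \<psi> s"
proof -
  have tight: "tight L" by (rule tight_of_mgf[OF L d dom conv])
  have sub: "s \<in> mgf_dom N \<and> mgf N s = \<psi> s"
    if "strict_mono r" "real_distribution N" "weak_conv_m (L \<circ> r) N" "\<bar>s\<bar> < d" for r N s
    using mgf_of_weak_limit[where L = "L \<circ> r" and d = d and \<psi> = \<psi>, OF _ d _ _ that(2,3,4)] L dom
      LIMSEQ_subseq_LIMSEQ[OF conv that(1)]
    by (simp add: comp_def)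
  obtain r P where r: "strict_mono r" "real_distribution P" "weak_conv_m (L \<circ> id \<circ> r) P"
    using tight_imp_convergent_subsubsequence[OF tight, of id] by (auto simp: strict_mono_def)
  have P: "s \<in> mgf_dom P \<and> mgf P s = \<psi> s" if "\<bar>s\<bar> < d" for s
    using sub[OF r(1,2) _ that] r(3) by simp
  have "weak_conv_m L P"
  proof (rule tight_subseq_weak_converge[OF L r(2) tight])
    fix q N assume q: "strict_mono q" "real_distribution N" "weak_conv_m (L \<circ> q) N"
    have "N = P" by (rule mgf_unique[OF q(2) r(2) d]) (use P sub[OF q] in auto)
    with q(3) show "weak_conv_m (L \<circ> q) P" by simp
  qed
  from that[OF r(2) this P] show ?thesis .
qed

definition tilted :: "real measure \<Rightarrow> real \<Rightarrow> real measure" where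
  "tilted L a = density L (\<lambda>x. ennreal (exp (a * x) / mgf L a))"

context real_distribution
begin

lemma tilted:
  assumes a: "a \<in> mgf_dom M"
  shows real_distribution_tilted: "real_distribution (tilted M a)"
    and mgf_dom_tilted: "s \<in> mgf_dom (tilted M a) \<longleftrightarrow> a + s \<in> mgf_dom M"
    and mgf_tilted: "mgf (tilted M a) s = mgf M (a + s) / mgf M a"
proof -
  have pos: "mgf M a > 0" using a by (rule mgf_pos)
  have e: "(exp (a * x) / mgf M a) *\<^sub>R exp (s * x) = exp ((a + s) * x) / mgf M a" for x s
    by (simp add: exp_add algebra_simps)
  have int: "integrable M (\<lambda>x. exp (a * x) / mgf M a)"
    using a by (simp add: mgf_dom_def)
  have "emeasure (tilted M a) (space M) = (\<integral>\<^sup>+x. ennreal (exp (a * x) / mgf M a) \<partial>M)"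
    unfolding tilted_def using pos
    by (subst emeasure_density) (auto intro!: nn_integral_cong simp: indicator_def)
  also have "\<dots> = ennreal (\<integral>x. exp (a * x) / mgf M a \<partial>M)"
    using pos by (intro nn_integral_eq_integral[OF int]) auto
  also have "\<dots> = 1" using pos a by (simp add: mgf_def[symmetric])
  finally have "prob_space (tilted M a)"
    by (intro prob_spaceI) (simp add: tilted_def)
  then show "real_distribution (tilted M a)"
    by (simp add: real_distribution_def real_distribution_axioms_def tilted_def)
  have "integrable (tilted M a) (\<lambda>x. exp (s * x)) \<longleftrightarrow> integrable M (\<lambda>x. exp ((a + s) * x) / mgf M a)"
    unfolding tilted_def using pos by (subst integrable_density) (auto simp: e simp del: real_scaleR_def)
  also have "\<dots> \<longleftrightarrow> integrable M (\<lambda>x. exp ((a + s) * x))"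
    using pos by (simp add: divide_inverse)
  finally show "s \<in> mgf_dom (tilted M a) \<longleftrightarrow> a + s \<in> mgf_dom M"
    by (simp add: mgf_dom_def)
  show "mgf (tilted M a) s = mgf M (a + s) / mgf M a"
    using pos
    by (subst mgf_def, subst tilted_def, subst integral_density) (simp_all add: e mgf_def[of M "a + s"] del: real_scaleR_def)
qed

text \<open>The integral of \<open>(exp ((s + h) x / 2) - l exp ((s - h) x / 2))\<^sup>2\<close> is a nonnegative quadratic in \<open>l\<close>,
  minimised at \<open>l = mgf M s / mgf M (s - h)\<close>.\<close>

lemma mgf_log_convex:
  assumes "s - h \<in> mgf_dom M" "s \<in> mgf_dom M" "s + h \<in> mgf_dom M"
  shows "(mgf M s)\<^sup>2 \<le> mgf M (s - h) * mgf M (s + h)"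
proof -
  define l where "l = mgf M s / mgf M (s - h)"
  have p: "mgf M (s - h) > 0" using assms by (intro mgf_pos)
  have "0 \<le> (\<integral>x. (exp ((s + h) / 2 * x) - l * exp ((s - h) / 2 * x))\<^sup>2 \<partial>M)"
    by (intro integral_nonneg_AE) auto
  also have "(\<lambda>x. (exp ((s + h) / 2 * x) - l * exp ((s - h) / 2 * x))\<^sup>2) =
      (\<lambda>x. exp ((s + h) * x) - 2 * l * exp (s * x) + l\<^sup>2 * exp ((s - h) * x))"
  proof
    fix x
    have "(exp ((s + h) / 2 * x))\<^sup>2 = exp ((s + h) * x)" "(exp ((s - h) / 2 * x))\<^sup>2 = exp ((s - h) * x)"
      "exp ((s + h) / 2 * x) * exp ((s - h) / 2 * x) = exp (s * x)"
      by (simp_all add: power2_eq_square exp_add[symmetric] field_simps)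
    then show "(exp ((s + h) / 2 * x) - l * exp ((s - h) / 2 * x))\<^sup>2
        = exp ((s + h) * x) - 2 * l * exp (s * x) + l\<^sup>2 * exp ((s - h) * x)"
      by (simp add: power2_diff power_mult_distrib)
  qed
  also have "(\<integral>x. exp ((s + h) * x) - 2 * l * exp (s * x) + l\<^sup>2 * exp ((s - h) * x) \<partial>M)
      = mgf M (s + h) - 2 * l * mgf M s + l\<^sup>2 * mgf M (s - h)"
    using assms by (simp add: mgf_def mgf_dom_def)
  also have "\<dots> = mgf M (s + h) - (mgf M s)\<^sup>2 / mgf M (s - h)"
    using p by (simp add: l_def power2_eq_square field_simps)
  finally show ?thesis using p by (simp add: field_simps)
qed

text \<open>The function on the right is entire, so the equality holds on the whole real line. Its logarithm
  \<open>A e\<^sup>2\<^sup>s + B e\<^sup>s + C\<close> must be convex there, and looking at \<open>s \<rightarrow> \<infinity>\<close> and \<open>s \<rightarrow> -\<infinity>\<close> gives the sign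
  of \<open>A\<close> and of \<open>B\<close>.\<close>

lemma mgf_exp_quadratic_nonneg:
  assumes ab: "a < b"
    and eq: "\<And>s. s \<in> {a<..<b} \<Longrightarrow> s \<in> mgf_dom M \<and> mgf M s = exp (A * (exp s)\<^sup>2 + B * exp s + C)"
  shows "0 \<le> A" "0 \<le> B"
proof -
  let ?g = "\<lambda>s. exp (A * (exp s)\<^sup>2 + B * exp s + C)"
  have an: "real_analytic_at ?g s" for s
    unfolding real_analytic_at_def
    by (intro exI[of _ "\<lambda>z. exp (of_real A * (exp z)\<^sup>2 + of_real B * exp z + of_real C)"])
       (auto intro!: analytic_intros simp: exp_of_real[symmetric])
  have all: "s \<in> mgf_dom M \<and> mgf M s = ?g s" for s
  proof -
    have "s \<in> interior (mgf_dom M) \<and> mgf M s = ?g s"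
    proof (rule mgf_extends_along_interval[OF an])
      show "(a + b) / 2 \<in> {min a s - 1<..<max b s + 1}" using ab by (auto simp: field_simps)
      have m: "(a + b) / 2 \<in> {a<..<b}" using ab by auto
      then show "(a + b) / 2 \<in> interior (mgf_dom M)"
        using eq by (intro interiorI[of "{a<..<b}"]) auto
      show "\<forall>\<^sub>F x in nhds ((a + b) / 2). mgf M x = ?g x"
        using eq m by (intro eventually_nhds_in_open[THEN eventually_mono, of "{a<..<b}"]) auto
      show "s \<in> {min a s - 1<..<max b s + 1}" by auto
    qed
    then show ?thesis using interior_subset by blast
  qed
  define k1 k2 :: real where "k1 = exp 1 + exp (-1) - 2" and "k2 = (exp 1)\<^sup>2 + (exp (-1))\<^sup>2 - 2"
  have e1: "exp 1 * exp (-1) = (1::real)" by (simp add: exp_add[symmetric])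
  have e2: "(exp 1 - 1 :: real) > 0" by simp
  have k1: "k1 > 0"
  proof -
    have "k1 = exp (-1) * (exp 1 - 1)\<^sup>2"
      using e1 by (simp add: k1_def power2_eq_square algebra_simps)
    then show ?thesis using e2 by simp
  qed
  have k2: "k2 > 0"
  proof -
    have "k2 = (exp 1 - exp (-1))\<^sup>2" using e1 by (simp add: k2_def power2_diff)
    moreover have "exp 1 - exp (-1) \<noteq> (0::real)" by simp
    ultimately show ?thesis by (metis zero_less_power2)
  qed
  \<comment> \<open>log-convexity at the points s - 1, s, s + 1 with y = exp s, divided by y\<close>
  have key: "0 \<le> A * k2 * y + B * k1" if "0 < y" for y
  proof -
    define s where "s = ln y"
    have es: "exp s = y" "exp (s - 1) = y * exp (-1)" "exp (s + 1) = y * exp 1"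
      using that by (simp_all add: s_def exp_diff exp_add exp_minus field_simps)
    have "(?g s)\<^sup>2 \<le> ?g (s - 1) * ?g (s + 1)"
      using mgf_log_convex[of s 1] all by simp
    then have "2 * (A * (exp s)\<^sup>2 + B * exp s + C)
        \<le> (A * (exp (s - 1))\<^sup>2 + B * exp (s - 1) + C) + (A * (exp (s + 1))\<^sup>2 + B * exp (s + 1) + C)"
      unfolding exp_double[symmetric] exp_add[symmetric] exp_le_cancel_iff .
    then have "0 \<le> y * (A * k2 * y + B * k1)"
      unfolding es k1_def k2_def by (simp add: power2_eq_square algebra_simps)
    then show ?thesis using that by (simp add: zero_le_mult_iff)
  qed
  show "0 \<le> A"
  proof (rule ccontr)
    assume "\<not> 0 \<le> A"
    then have "A * k2 < 0" using k2 by (simp add: mult_less_0_iff)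
    then have "0 \<le> A * k2 * ((\<bar>B\<bar> * k1 + 1) / (- (A * k2))) + B * k1"
      using k1 by (intro key divide_pos_pos add_nonneg_pos) auto
    also have "A * k2 * ((\<bar>B\<bar> * k1 + 1) / (- (A * k2))) = - (\<bar>B\<bar> * k1 + 1)"
      using less_imp_neq[OF \<open>A * k2 < 0\<close>] by (simp only: divide_minus_right mult_minus_right nonzero_mult_div_cancel_left times_divide_eq_right minus_divide_right[symmetric]) simp
    finally have "\<bar>B\<bar> * k1 + 1 \<le> B * k1" by simp
    moreover have "B * k1 \<le> \<bar>B\<bar> * k1" using k1 by (intro mult_right_mono) auto
    ultimately show False by simp
  qed
  show "0 \<le> B"
  proof (rule ccontr)
    assume "\<not> 0 \<le> B"
    then have Bk: "B * k1 < 0" using k1 by (simp add: mult_less_0_iff)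
    have pos: "0 < A * k2 + 1" using \<open>0 \<le> A\<close> k2 by (simp add: add_nonneg_pos)
    have "0 \<le> A * k2 * (- (B * k1) / (2 * (A * k2 + 1))) + B * k1"
      using Bk pos by (intro key divide_pos_pos) auto
    moreover have "A * k2 * (- (B * k1) / (2 * (A * k2 + 1))) \<le> (A * k2 + 1) * (- (B * k1) / (2 * (A * k2 + 1)))"
      using Bk pos by (intro mult_right_mono divide_nonneg_nonneg) auto
    moreover have "(A * k2 + 1) * (- (B * k1) / (2 * (A * k2 + 1))) = - (B * k1) / 2"
      using less_imp_neq[OF pos] by (simp only: times_divide_eq_right mult_divide_mult_cancel_left mult.commute[of 2])
    ultimately show False using Bk by linarith
  qed
qed

end

section \<open>Factorial cumulant generating functions\<close>

abbreviation rfcgf :: "real measure \<Rightarrow> real \<Rightarrow> real" where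
  "rfcgf M t \<equiv> real_of_ereal (fcgf M t)"

lemma fcgf_eq_mgf:
  assumes "-1 < t"
  shows "fcgf M t = (if ln (1 + t) \<in> mgf_dom M then ereal (ln (mgf M (ln (1 + t)))) else \<infinity>)"
proof -
  have "(1 + t) powr x = exp (ln (1 + t) * x)" for x
    using assms by (simp add: powr_def mult.commute)
  then have "(\<lambda>x. (1 + t) powr x) = (\<lambda>x. exp (ln (1 + t) * x))" by (rule ext)
  then show ?thesis by (simp add: fcgf_def mgf_dom_def mgf_def)
qed

lemma fcgf_dom_iff: "t \<in> fcgf_dom M \<longleftrightarrow> -1 < t \<and> ln (1 + t) \<in> mgf_dom M"
  by (auto simp: fcgf_dom_def fcgf_eq_mgf split: if_splits)

lemma rfcgf_eq: "t \<in> fcgf_dom M \<Longrightarrow> rfcgf M t = ln (mgf M (ln (1 + t)))"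
  by (simp add: fcgf_dom_iff fcgf_eq_mgf)

lemma fcgf_eq_ereal: "t \<in> fcgf_dom M \<Longrightarrow> fcgf M t = ereal (rfcgf M t)"
  by (simp add: fcgf_dom_iff fcgf_eq_mgf)

text \<open>The substitution \<open>s = ln (1 + t)\<close> is a homeomorphism of \<open>(-1, \<infinity>)\<close> onto the real line.\<close>

lemma interior_fcgf_dom_iff:
  assumes "-1 < t"
  shows "t \<in> interior (fcgf_dom M) \<longleftrightarrow> ln (1 + t) \<in> interior (mgf_dom M)"
proof
  assume "t \<in> interior (fcgf_dom M)"
  then obtain U where U: "open U" "t \<in> U" "U \<subseteq> fcgf_dom M" by (auto simp: interior_def)
  show "ln (1 + t) \<in> interior (mgf_dom M)"
  proof (rule interiorI)
    show "open ((\<lambda>s. exp s - 1) -` U)" using U(1)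
      by (intro open_vimage continuous_intros)
    show "ln (1 + t) \<in> (\<lambda>s. exp s - 1) -` U" using U assms by simp
    show "(\<lambda>s. exp s - 1) -` U \<subseteq> mgf_dom M"
    proof
      fix s assume "s \<in> (\<lambda>s. exp s - 1) -` U"
      then have "exp s - 1 \<in> fcgf_dom M" using U by auto
      then show "s \<in> mgf_dom M" by (simp add: fcgf_dom_iff)
    qed
  qed
next
  assume "ln (1 + t) \<in> interior (mgf_dom M)"
  then obtain U where U: "open U" "ln (1 + t) \<in> U" "U \<subseteq> mgf_dom M" by (auto simp: interior_def)
  have op: "open ((\<lambda>t. ln (1 + t)) -` U \<inter> {-1<..})"
    by (rule continuous_open_preimage[of "{-1<..}" "\<lambda>t::real. ln (1 + t)" U, unfolded Int_commute[of "{-1<..}"]])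
       (auto intro!: continuous_intros U)
  show "t \<in> interior (fcgf_dom M)"
    by (rule interiorI[OF op]) (use U assms in \<open>auto simp: fcgf_dom_iff\<close>)
qed

lemma fcgf_dom_gt: "t \<in> fcgf_dom M \<Longrightarrow> -1 < t"
  by (simp add: fcgf_dom_def)

lemma real_analytic_at_cong:
  assumes "\<forall>\<^sub>F x in nhds s. f x = g x" "real_analytic_at f s"
  shows "real_analytic_at g s"
proof -
  obtain G where G: "G analytic_on {complex_of_real s}" "\<forall>\<^sub>F x in nhds s. G (of_real x) = of_real (f x)"
    using assms(2) by (auto simp: real_analytic_at_def)
  from assms(1) G(2) have "\<forall>\<^sub>F x in nhds s. G (of_real x) = of_real (g x)"
    by eventually_elim simp
  with G(1) show ?thesis by (auto simp: real_analytic_at_def)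
qed

lemma (in real_distribution) rfcgf_analytic:
  assumes "t \<in> interior (fcgf_dom M)"
  shows "real_analytic_at (rfcgf M) t"
proof (rule real_analytic_at_cong)
  have t: "-1 < t" using assms interior_subset fcgf_dom_gt by blast
  have i: "ln (1 + 1 * t) \<in> interior (mgf_dom M)" using assms t by (simp add: interior_fcgf_dom_iff)
  show "real_analytic_at (\<lambda>t. ln (mgf M (ln (1 + 1 * t)))) t"
    using t i interior_subset
    by (intro real_analytic_at_compose[of ln "\<lambda>t. mgf M (ln (1 + 1 * t))"]
        real_analytic_at_compose[of "mgf M" "\<lambda>t. ln (1 + 1 * t)"]
        real_analytic_at_compose[of ln "\<lambda>t. 1 + 1 * t"] real_analytic_at_mgf
        real_analytic_at_affine real_analytic_at_ln mgf_pos) auto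
  have "\<forall>\<^sub>F x in nhds t. x \<in> interior (fcgf_dom M)"
    using assms by (intro eventually_nhds_in_open) auto
  then show "\<forall>\<^sub>F x in nhds t. ln (mgf M (ln (1 + 1 * x))) = rfcgf M x"
    by eventually_elim (use interior_subset rfcgf_eq in force)
qed

text \<open>Equality of factorial cumulant generating functions is postulated near \<open>0\<close>. Since the right-hand
  side is analytic as long as its argument stays in the interior of the domain of \<open>fcgf M\<close>, the
  equality extends to every such interval that has \<open>0\<close> in its closure. An end point \<open>0\<close> is needed when
  \<open>\<theta>\<close> is an end point of the domain of \<open>fcgf M\<close>.\<close>

lemma fcgf_extends:
  assumes M: "real_distribution M" and L: "real_distribution L"
    and ab: "-1 \<le> a" "a \<le> 0" "0 \<le> b" "a < b" and \<kappa>: "0 < \<kappa>" and \<theta>: "\<theta> \<in> fcgf_dom M"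
    and dom: "\<And>t. t \<in> {a<..<b} \<Longrightarrow> \<theta> + \<kappa> * t \<in> interior (fcgf_dom M)"
    and near: "\<forall>\<^sub>F t in nhds 0. fcgf L t = ereal (1 / g) * (fcgf M (\<theta> + \<kappa> * t) - fcgf M \<theta>)"
    and t: "t \<in> {a<..<b}"
  shows "t \<in> fcgf_dom L \<and> rfcgf L t = (rfcgf M (\<theta> + \<kappa> * t) - rfcgf M \<theta>) / g"
proof -
  interpret M: real_distribution M by fact
  interpret L: real_distribution L by fact
  obtain e where e: "0 < e" "\<And>u. \<bar>u\<bar> < e \<Longrightarrow> fcgf L u = ereal (1 / g) * (fcgf M (\<theta> + \<kappa> * u) - fcgf M \<theta>)"
    using near unfolding eventually_nhds_metric dist_real_def diff_0_right by blast
  \<comment> \<open>a point of the interval, close enough to 0 for the postulated equality; the continuation starts here\<close>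
  define t0 where "t0 = (if 0 < b then min (b/2) (e/2) else max (a/2) (-e/2))"
  have t0: "t0 \<in> {a<..<b}" "\<bar>t0\<bar> < e" using ab e by (auto simp: t0_def min_def max_def)
  have local: "u \<in> fcgf_dom L \<and> rfcgf L u = (rfcgf M (\<theta> + \<kappa> * u) - rfcgf M \<theta>) / g"
    if "u \<in> {a<..<b}" "\<bar>u\<bar> < e" for u
  proof -
    have "\<theta> + \<kappa> * u \<in> fcgf_dom M" using dom[OF that(1)] interior_subset by blast
    then obtain x y where "fcgf M \<theta> = ereal x" "fcgf M (\<theta> + \<kappa> * u) = ereal y"
      using fcgf_eq_ereal \<theta> by blast
    then have "fcgf L u = ereal ((rfcgf M (\<theta> + \<kappa> * u) - rfcgf M \<theta>) / g)"
      using e(2)[OF that(2)] by simp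
    then show ?thesis using that ab by (simp add: fcgf_dom_def)
  qed
  \<comment> \<open>a smaller interval with lower end above -1, so that the logarithms of its ends exist\<close>
  define lo hi where "lo = (a + min t t0) / 2" and "hi = (b + max t t0) / 2"
  have lh: "a < lo" "lo < t" "lo < t0" "t < hi" "t0 < hi" "hi < b"
    using t t0 by (auto simp: lo_def hi_def min_def max_def)
  let ?h = "\<lambda>s. exp (- rfcgf M \<theta> / g + 1 / g * rfcgf M ((\<theta> - \<kappa>) + \<kappa> * exp s))"
  have hs: "?h s = exp ((rfcgf M (\<theta> + \<kappa> * (exp s - 1)) - rfcgf M \<theta>) / g)" for s
    by (simp add: algebra_simps diff_divide_distrib)
  have inI: "exp s - 1 \<in> {a<..<b}" if "s \<in> {ln (1 + lo)<..<ln (1 + hi)}" for s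
  proof -
    have "exp (ln (1 + lo)) < exp s" "exp s < exp (ln (1 + hi))" using that by auto
    moreover have "exp (ln (1 + lo)) = 1 + lo" "exp (ln (1 + hi)) = 1 + hi" using lh ab by auto
    ultimately show ?thesis using lh by simp
  qed
  have "ln (1 + t) \<in> interior (mgf_dom L) \<and> mgf L (ln (1 + t)) = ?h (ln (1 + t))"
  proof (rule L.mgf_extends_along_interval)
    fix s assume "s \<in> {ln (1 + lo)<..<ln (1 + hi)}"
    then have "(\<theta> - \<kappa>) + \<kappa> * exp s \<in> interior (fcgf_dom M)"
      using dom[OF inI] by (simp add: algebra_simps)
    then show "real_analytic_at ?h s"
      by (intro real_analytic_at_compose[of exp "\<lambda>s. - rfcgf M \<theta> / g + 1 / g * rfcgf M ((\<theta> - \<kappa>) + \<kappa> * exp s)"]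
          real_analytic_at_compose[of "\<lambda>u. - rfcgf M \<theta> / g + 1 / g * u" "\<lambda>s. rfcgf M ((\<theta> - \<kappa>) + \<kappa> * exp s)"]
          real_analytic_at_compose[of "rfcgf M" "\<lambda>s. (\<theta> - \<kappa>) + \<kappa> * exp s"]
          real_analytic_at_compose[of "\<lambda>u. (\<theta> - \<kappa>) + \<kappa> * u" exp]
          real_analytic_at_exp real_analytic_at_affine M.rfcgf_analytic)
  next
    show "ln (1 + t0) \<in> {ln (1 + lo)<..<ln (1 + hi)}" "ln (1 + t) \<in> {ln (1 + lo)<..<ln (1 + hi)}"
      using lh ab by auto
    have "t0 \<in> interior (fcgf_dom L)"
    proof (rule interiorI[of "{a<..<b} \<inter> {-e<..<e}"])
      show "{a<..<b} \<inter> {-e<..<e} \<subseteq> fcgf_dom L" using local by auto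
    qed (use t0 in auto)
    then show "ln (1 + t0) \<in> interior (mgf_dom L)" using t0 ab by (simp add: interior_fcgf_dom_iff)
    have c: "isCont (\<lambda>s. exp s - 1 :: real) (ln (1 + t0))" by (intro continuous_intros)
    have "exp (ln (1 + t0)) - 1 = t0" using t0 ab by simp
    then have "filterlim (\<lambda>s. exp s - 1) (nhds t0) (nhds (ln (1 + t0)))"
      using c by (simp add: isCont_def tendsto_nhds_iff)
    moreover have "\<forall>\<^sub>F u in nhds t0. u \<in> {a<..<b} \<inter> {-e<..<e}"
      using t0 by (intro eventually_nhds_in_open) auto
    ultimately have "\<forall>\<^sub>F s in nhds (ln (1 + t0)). exp s - 1 \<in> {a<..<b} \<inter> {-e<..<e}"
      by (auto simp: filterlim_iff)
    then show "\<forall>\<^sub>F s in nhds (ln (1 + t0)). mgf L s = ?h s"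
    proof eventually_elim
      case (elim s)
      then have l: "exp s - 1 \<in> fcgf_dom L"
        "rfcgf L (exp s - 1) = (rfcgf M (\<theta> + \<kappa> * (exp s - 1)) - rfcgf M \<theta>) / g"
        using local[of "exp s - 1"] by auto
      have "s \<in> mgf_dom L" using l(1) by (simp add: fcgf_dom_iff)
      then have "mgf L s = exp (rfcgf L (exp s - 1))"
        using rfcgf_eq[OF l(1)] L.mgf_pos[of s] by simp
      then show ?case using l(2) hs by simp
    qed
  qed
  moreover have "-1 < t" using t ab by auto
  ultimately have "t \<in> fcgf_dom L" "mgf L (ln (1 + t)) = exp ((rfcgf M (\<theta> + \<kappa> * t) - rfcgf M \<theta>) / g)"
    unfolding hs using interior_subset by (auto simp: fcgf_dom_iff)
  then show ?thesis by (simp add: rfcgf_eq)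
qed

lemma FD_dilation_fcgf:
  assumes FD: "is_FD M \<Theta> m g N" and dil: "is_dilation (inverse c) N L"
  obtains \<theta> where "\<theta> \<in> \<Theta>" "fcgf_deriv M \<theta> = m" "0 < g" "0 < c" "real_distribution L"
    "\<forall>\<^sub>F t in nhds 0. fcgf L t = ereal (1 / g) * (fcgf M (\<theta> + g / c * t) - fcgf M \<theta>)"
proof -
  obtain \<theta> where \<theta>: "\<theta> \<in> \<Theta>" "fcgf_deriv M \<theta> = m" "0 < g"
    and N: "\<forall>\<^sub>F t in nhds 0. fcgf N t = ereal (1 / g) * fcgf_tilt M \<theta> (g * t)"
    using FD by (auto simp: is_FD_def has_fcgf_def)
  have L: "0 < c" "real_distribution L" "\<forall>\<^sub>F t in nhds 0. fcgf L t = fcgf N (inverse c * t)"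
    using dil by (auto simp: is_dilation_def has_fcgf_def fcgf_class_def)
  have "filterlim (\<lambda>t. inverse c * t) (nhds 0) (nhds 0)"
    by (auto intro!: tendsto_eq_intros filterlim_ident)
  then have "\<forall>\<^sub>F t in nhds 0. fcgf N (inverse c * t) = ereal (1 / g) * fcgf_tilt M \<theta> (g * (inverse c * t))"
    using N by (auto simp: filterlim_iff)
  with L(3) have "\<forall>\<^sub>F t in nhds 0. fcgf L t = ereal (1 / g) * (fcgf M (\<theta> + g / c * t) - fcgf M \<theta>)"
    by eventually_elim (simp add: fcgf_tilt_def field_simps)
  from that[OF \<theta> L(1,2) this] show ?thesis .
qed

text \<open>A distribution whose mean \<open>m\<close> along the tilting parameter satisfies the differential equation
  \<open>m' = d m\<^sup>p\<close> is a power dispersion model generated by itself, with canonical parameter \<open>0\<close>.\<close>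

lemma is_PT_I:
  assumes P: "real_distribution P" and e: "0 < e" and d: "d \<noteq> 0"
    and D: "\<And>t. \<bar>t\<bar> < e \<Longrightarrow> t \<in> fcgf_dom P \<and> rfcgf P t = D t"
    and D': "\<And>t. \<bar>t\<bar> < e \<Longrightarrow> (D has_real_derivative m t) (at t)"
    and m': "\<And>t. \<bar>t\<bar> < e \<Longrightarrow> (m has_real_derivative d * m t powr p) (at t)"
    and m_pos: "\<And>t. \<bar>t\<bar> < e \<Longrightarrow> 0 < m t"
  shows "is_PT p (m 0) d P"
proof -
  interpret P: real_distribution P by fact
  let ?I = "{-e<..<e}"
  have I: "t \<in> ?I \<longleftrightarrow> \<bar>t\<bar> < e" for t by auto
  have sub: "?I \<subseteq> interior (fcgf_dom P)"
    using D by (intro interior_maximal) auto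
  have at: "at t within fcgf_dom P = at t" if "\<bar>t\<bar> < e" for t
    using sub I that by (intro at_within_interior) blast
  have d1: "(rfcgf P has_vector_derivative m t) (at t within fcgf_dom P)" if "\<bar>t\<bar> < e" for t
    unfolding at[OF that]
  proof (rule has_vector_derivative_transform_within_open)
    show "(D has_vector_derivative m t) (at t)"
      using D'[OF that] by (simp add: has_real_derivative_iff_has_vector_derivative)
  qed (use D that in \<open>auto simp: I intro: open_greaterThanLessThan[of "-e" e]\<close>)
  have fd: "fcgf_deriv P t = m t" if "\<bar>t\<bar> < e" for t
    unfolding fcgf_deriv_def using d1[OF that] at[OF that]
    by (simp add: vector_derivative_at)
  have d2: "(fcgf_deriv P has_vector_derivative d * m t powr p) (at t within fcgf_dom P)" if "\<bar>t\<bar> < e" for t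
    unfolding at[OF that]
  proof (rule has_vector_derivative_transform_within_open)
    show "(m has_vector_derivative d * m t powr p) (at t)"
      using m'[OF that] by (simp add: has_real_derivative_iff_has_vector_derivative)
  qed (use fd that in \<open>auto simp: I intro: open_greaterThanLessThan[of "-e" e]\<close>)
  have fd2: "fcgf_deriv2 P t = d * m t powr p" if "\<bar>t\<bar> < e" for t
    unfolding fcgf_deriv2_def using d2[OF that] at[OF that]
    by (simp add: vector_derivative_at)
  have inj: "inj_on (fcgf_deriv P) ?I"
  proof (rule linorder_inj_onI)
    fix x y assume xy: "x < y" "x \<in> ?I" "y \<in> ?I"
    have "\<exists>z. x < z \<and> z < y \<and> m y - m x = (y - x) * (d * m z powr p)"
      using xy by (intro MVT2 m') auto
    then obtain z where z: "x < z" "z < y" "m y - m x = (y - x) * (d * m z powr p)" by blast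
    moreover have "0 < m z" using z xy by (intro m_pos) auto
    ultimately have "m y - m x \<noteq> 0" using d xy by simp
    then show "fcgf_deriv P x \<noteq> fcgf_deriv P y" using xy by (simp add: fd)
  qed auto
  have model: "fd_model P ?I"
    unfolding fd_model_def
  proof (intro conjI ballI)
    show "fcgf_class P" using P sub e by (auto simp: fcgf_class_def)
    show "?I \<subseteq> fcgf_dom P" using D by auto
    show "is_interval ?I" by (rule is_interval_oo)
    show "\<exists>a\<in>?I. \<exists>b\<in>?I. a < b" using e by (intro bexI[of _ 0] bexI[of _ "e/2"]) auto
    show "rfcgf P differentiable at \<theta> within fcgf_dom P" if "\<theta> \<in> ?I" for \<theta>
      using differentiableI_vector[OF d1] that I by blast
    show "fcgf_deriv P differentiable at \<theta> within fcgf_dom P" if "\<theta> \<in> ?I" for \<theta>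
      using differentiableI_vector[OF d2] that I by blast
    have "0 < m t powr p" if "t \<in> ?I" for t using m_pos[OF I[THEN iffD1, OF that]] by simp
    moreover have "0 < d \<or> d < 0" using d by auto
    ultimately show "(\<forall>\<theta>\<in>?I. 0 < fcgf_deriv2 P \<theta>) \<or> (\<forall>\<theta>\<in>?I. fcgf_deriv2 P \<theta> < 0)"
      by (auto simp: fd2 I mult_less_0_iff zero_less_mult_iff simp del: powr_gt_zero)
  qed
  have ud: "unit_dispersion P ?I (m t) = d * m t powr p" if "\<bar>t\<bar> < e" for t
    using that inv_into_f_f[OF inj, of t] by (simp add: unit_dispersion_def fd fd2 I[symmetric])
  have md: "mean_domain P ?I = m ` ?I"
    unfolding mean_domain_def by (intro image_cong) (auto simp: fd)
  have "fcgf P 0 = 0"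
    using D[of 0] e by (simp add: fcgf_dom_iff fcgf_eq_mgf zero_ereal_def)
  then have "is_FD P ?I (m 0) 1 P"
    unfolding is_FD_def has_fcgf_def using e fd[of 0] model
    by (auto simp: fcgf_tilt_def fd_model_def one_ereal_def[symmetric] intro!: bexI[of _ 0])
  moreover have "1 * unit_dispersion P ?I x = d * power_fun p x" if "x \<in> mean_domain P ?I" for x
  proof -
    obtain t where t: "x = m t" "\<bar>t\<bar> < e" using \<open>x \<in> mean_domain P ?I\<close> I by (auto simp: md)
    then show ?thesis using ud[of t] m_pos[of t] by (simp add: power_fun_def)
  qed
  moreover have "mean_domain P ?I \<subseteq> power_domain p"
    using m_pos I by (force simp: md power_domain_def)
  ultimately show ?thesis
    unfolding is_PT_def using model by blast
qed

text \<open>A quadratic \<open>d t\<^sup>2 / 2 + \<mu> t\<close> is a limit of factorial cumulant generating functions only if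
  \<open>0 \<le> d \<le> \<mu>\<close>, even if the convergence takes place on a small interval away from \<open>0\<close> and only up to
  additive constants. Tilting by an inner point \<open>t1\<close> of the interval moves that point to \<open>0\<close> and removes the
  constants; the tilted distributions then have a weak limit whose moment generating function is the
  exponential of a quadratic in \<open>e\<^sup>s\<close> whose leading and linear coefficients are positive multiples
  of \<open>d\<close> and of \<open>\<mu> - d\<close>.\<close>

theorem quadratic_fcgf_limit:
  assumes L: "\<And>n. real_distribution (L n)" and ab: "-1 \<le> a" "a < b" and t1: "t1 \<in> {a<..<b}"
    and dom: "\<And>n t. t \<in> {a<..<b} \<Longrightarrow> t \<in> fcgf_dom (L n)"
    and conv: "\<And>t. t \<in> {a<..<b} \<Longrightarrow>
      (\<lambda>n. rfcgf (L n) t - rfcgf (L n) t1) \<longlonglongrightarrow> (d / 2 * t\<^sup>2 + \<mu> * t) - (d / 2 * t1\<^sup>2 + \<mu> * t1)"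
  shows "0 \<le> d" "d \<le> \<mu>"
proof -
  define s1 where "s1 = ln (1 + t1)"
  have es1: "exp s1 - 1 = t1" using t1 ab by (simp add: s1_def)
  have c: "isCont (\<lambda>s. exp (s1 + s) - 1 :: real) 0" by (intro continuous_intros)
  then have "filterlim (\<lambda>s. exp (s1 + s) - 1) (nhds t1) (nhds 0)"
    using es1 by (simp add: isCont_def tendsto_nhds_iff)
  moreover have "\<forall>\<^sub>F u in nhds t1. u \<in> {a<..<b}"
    using t1 by (intro eventually_nhds_in_open) auto
  ultimately have "\<forall>\<^sub>F s in nhds 0. exp (s1 + s) - 1 \<in> {a<..<b}"
    by (auto simp: filterlim_iff)
  then obtain \<delta> where \<delta>: "0 < \<delta>" "\<And>s. \<bar>s\<bar> < \<delta> \<Longrightarrow> exp (s1 + s) - 1 \<in> {a<..<b}"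
    by (auto simp: eventually_nhds_metric dist_real_def)
  have md: "s1 + s \<in> mgf_dom (L n)" if "\<bar>s\<bar> < \<delta>" for n s
    using dom[OF \<delta>(2)[OF that], of n] by (simp add: fcgf_dom_iff)
  have s1: "s1 \<in> mgf_dom (L n)" for n using md[of 0 n] \<delta> by simp
  let ?Q = "\<lambda>t. d / 2 * t\<^sup>2 + \<mu> * t"
  have lim: "(\<lambda>n. mgf (tilted (L n) s1) s) \<longlonglongrightarrow> exp (?Q (exp (s1 + s) - 1) - ?Q t1)" if "\<bar>s\<bar> < \<delta>" for s
  proof -
    have "mgf (tilted (L n) s1) s = exp (rfcgf (L n) (exp (s1 + s) - 1) - rfcgf (L n) t1)" for n
    proof -
      interpret Ln: real_distribution "L n" by (rule L)
      have "mgf (L n) (s1 + s) > 0" "mgf (L n) s1 > 0" using md[OF that] s1 Ln.mgf_pos by auto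
      then show ?thesis
        using Ln.mgf_tilted[OF s1] rfcgf_eq[OF dom[OF \<delta>(2)[OF that], of n]] rfcgf_eq[OF dom[OF t1, of n]]
        by (simp add: exp_diff s1_def[symmetric])
    qed
    then show ?thesis using conv[OF \<delta>(2)[OF that]] by (simp add: tendsto_exp)
  qed
  obtain P where P: "real_distribution P"
    "\<And>s. \<bar>s\<bar> < \<delta> \<Longrightarrow> s \<in> mgf_dom P \<and> mgf P s = exp (?Q (exp (s1 + s) - 1) - ?Q t1)"
  proof (rule mgf_continuity[of "\<lambda>n. tilted (L n) s1" \<delta>])
    show "real_distribution (tilted (L n) s1)" for n
      using real_distribution.real_distribution_tilted[OF L s1] .
    show "s \<in> mgf_dom (tilted (L n) s1)" if "\<bar>s\<bar> < \<delta>" for n s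
      using real_distribution.mgf_dom_tilted[OF L s1] md[OF that] by simp
  qed (use \<delta> lim in auto)
  define A B C where "A = d / 2 * (exp s1)\<^sup>2" and "B = (\<mu> - d) * exp s1" and "C = d / 2 - \<mu> - ?Q t1"
  have "?Q (exp (s1 + s) - 1) - ?Q t1 = A * (exp s)\<^sup>2 + B * exp s + C" for s
    by (simp add: A_def B_def C_def exp_add power2_eq_square algebra_simps)
  then have "s \<in> mgf_dom P \<and> mgf P s = exp (A * (exp s)\<^sup>2 + B * exp s + C)" if "s \<in> {-\<delta><..<\<delta>}" for s
    using P(2)[of s] that by (auto simp: abs_less_iff)
  from real_distribution.mgf_exp_quadratic_nonneg[OF P(1) _ this] \<delta>(1)
  have "0 \<le> A" "0 \<le> B" by auto
  then show "0 \<le> d" "d \<le> \<mu>" by (auto simp: A_def B_def zero_le_mult_iff)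
qed

section \<open>The rescaled differential equation\<close>

lemma mvt_on_convex:
  fixes g g' :: "real \<Rightarrow> real"
  assumes "convex S" "x \<in> S" "y \<in> S"
    and g: "\<And>z. z \<in> S \<Longrightarrow> (g has_real_derivative g' z) (at z within S)"
  obtains z where "z \<in> closed_segment x y" "z \<in> S" "g y - g x = g' z * (y - x)"
proof -
  have seg: "closed_segment x y \<subseteq> S" using assms closed_segment_subset by blast
  have *: "\<exists>z\<in>closed_segment u w. g w - g u = g' z * (w - u)" if "u < w" "closed_segment u w \<subseteq> S" for u w
  proof -
    have uw: "{u..w} \<subseteq> S" using that by (simp add: closed_segment_eq_real_ivl)
    have "\<exists>z\<in>{u<..<w}. g w - g u = (*) (g' z) (w - u)"
    proof (rule mvt_simple[OF that(1)])
      fix z assume "u \<le> z" "z \<le> w"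
      then show "(g has_derivative (*) (g' z)) (at z within {u..w})"
        using g[of z] uw has_derivative_subset unfolding has_field_derivative_def
        by (metis atLeastAtMost_iff subsetD)
    qed
    then show ?thesis using that by (auto simp: closed_segment_eq_real_ivl)
  qed
  consider "x < y" | "x = y" | "y < x" by linarith
  then show ?thesis
  proof cases
    case 1 then show ?thesis using *[OF 1 seg] seg that by blast
  next
    case 2 then show ?thesis using assms by (intro that[of x]) auto
  next
    case 3
    then obtain z where "z \<in> closed_segment x y" "g x - g y = g' z * (x - y)"
      using *[OF 3] seg by (auto simp: closed_segment_commute)
    then show ?thesis using seg by (intro that[of z]) (auto simp: algebra_simps)
  qed
qed

text \<open>Separation of variables for \<open>m' = d m\<^sup>p\<close>: the function \<open>T\<close> is a primitive of \<open>1 / (d m\<^sup>p)\<close> and \<open>G\<close> its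
  inverse, so that \<open>t \<mapsto> G (T \<mu> + t)\<close> is the solution with initial value \<open>\<mu>\<close>. The function \<open>S\<close>
  is a primitive of \<open>m T' m\<close>; along the solution its derivative is \<open>m\<close>, so it recovers the
  cumulant function from its derivative.\<close>

lemma power_ode:
  fixes \<mu> d p :: real
  assumes \<mu>: "0 < \<mu>" and d: "d \<noteq> 0"
  obtains T S G e where
    "\<And>x. 0 < x \<Longrightarrow> (T has_real_derivative 1 / (d * x powr p)) (at x)"
    "\<And>x. 0 < x \<Longrightarrow> (S has_real_derivative x / (d * x powr p)) (at x)"
    "\<And>x. 0 < x \<Longrightarrow> G (T x) = x" "0 < e"
    "\<And>t. \<bar>t\<bar> < e \<Longrightarrow> 0 < G (T \<mu> + t)"
    "\<And>t. \<bar>t\<bar> < e \<Longrightarrow> (G has_real_derivative d * G (T \<mu> + t) powr p) (at (T \<mu> + t))"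
proof -
  define S where "S x = (if p = 2 then ln x / d else x powr (2 - p) / ((2 - p) * d))" for x
  have S: "(S has_real_derivative x / (d * x powr p)) (at x)" if "0 < x" for x
  proof (cases "p = 2")
    case True
    then show ?thesis using that d unfolding S_def
      by (auto intro!: derivative_eq_intros simp: powr_numeral power2_eq_square)
  next
    case False
    have "x powr (1 - p) = x / x powr p" using that by (simp add: powr_diff)
    then show ?thesis using that d False unfolding S_def
      by (auto intro!: derivative_eq_intros)
  qed
  show ?thesis
  proof (cases "p = 1")
    case True
    define T where "T x = ln x / d" for x
    define G where "G y = exp (d * y)" for y
    show ?thesis
    proof (rule that[of T S G 1])
      show "(T has_real_derivative 1 / (d * x powr p)) (at x)" if "0 < x" for x
        using that d True unfolding T_def by (auto intro!: derivative_eq_intros)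
      show "(G has_real_derivative d * G (T \<mu> + t) powr p) (at (T \<mu> + t))" for t
        using True unfolding G_def by (auto intro!: derivative_eq_intros)
    qed (use S d in \<open>auto simp: T_def G_def\<close>)
  next
    case False
    define T where "T x = x powr (1 - p) / ((1 - p) * d)" for x
    define G where "G y = ((1 - p) * d * y) powr (1 / (1 - p))" for y
    define e where "e = \<mu> powr (1 - p) / \<bar>(1 - p) * d\<bar>"
    have e: "0 < e" using \<mu> d False by (simp add: e_def)
    have q: "(1 - p) * d * (T \<mu> + t) > 0" if "\<bar>t\<bar> < e" for t
    proof -
      have "\<bar>t\<bar> * \<bar>(1 - p) * d\<bar> < \<mu> powr (1 - p)"
        using that d False unfolding e_def by (subst (asm) pos_less_divide_eq) auto
      then have "\<bar>(1 - p) * d * t\<bar> < \<mu> powr (1 - p)" by (simp only: abs_mult mult_ac)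
      moreover have "(1 - p) * d * (T \<mu> + t) = \<mu> powr (1 - p) + (1 - p) * d * t"
        using d False by (simp add: T_def distrib_left)
      ultimately show ?thesis by linarith
    qed
    have ex: "1 / (1 - p) - 1 = 1 / (1 - p) * p" using False by (simp add: field_simps)
    show ?thesis
    proof (rule that[of T S G e])
      show "(T has_real_derivative 1 / (d * x powr p)) (at x)" if "0 < x" for x
      proof -
        have "x powr (- p) = 1 / x powr p" by (simp add: powr_minus_divide)
        then show ?thesis using that d False unfolding T_def
          by (auto intro!: derivative_eq_intros)
      qed
      show "G (T x) = x" if "0 < x" for x
        using that d False by (simp add: G_def T_def powr_powr)
      show "0 < G (T \<mu> + t)" if "\<bar>t\<bar> < e" for t
        using q[OF that] unfolding G_def by (metis powr_gt_zero less_irrefl)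
      show "(G has_real_derivative d * G (T \<mu> + t) powr p) (at (T \<mu> + t))" if "\<bar>t\<bar> < e" for t
      proof -
        have "((\<lambda>y. ((1 - p) * d * y) powr (1 / (1 - p))) has_real_derivative
            (1 / (1 - p)) * ((1 - p) * d * (T \<mu> + t)) powr (1 / (1 - p) - 1) * ((1 - p) * d)) (at (T \<mu> + t))"
          using q[OF that]
          by (intro DERIV_fun_powr[THEN DERIV_cong] derivative_eq_intros refl) (use d False in \<open>auto simp: zero_less_mult_iff\<close>)
        then show ?thesis
          unfolding G_def powr_powr ex
        proof (rule DERIV_cong)
          show "1 / (1 - p) * y * ((1 - p) * d) = d * y" for y
            using False by simp
        qed
      qed
    qed (use S e in auto)
  qed
qed

text \<open>The real-variable situation of a model: \<open>f\<close> is the cumulant function, \<open>f1\<close> the mean and \<open>f2\<close> the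
  dispersion along the canonical parameter. Only derivatives relative to \<open>\<Theta>\<close> are available at the end
  points of \<open>\<Theta>\<close>. The constant \<open>c0\<close> supplies the sign of the dispersion, which covers overdispersion
  and underdispersion at once.\<close>

locale cumulant_curve =
  fixes \<Theta> :: "real set" and f f1 f2 :: "real \<Rightarrow> real" and c0 :: real
  assumes cv: "convex \<Theta>"
    and f: "\<And>x. x \<in> \<Theta> \<Longrightarrow> (f has_real_derivative f1 x) (at x within \<Theta>)"
    and f1: "\<And>x. x \<in> \<Theta> \<Longrightarrow> (f1 has_real_derivative f2 x) (at x within \<Theta>)"
    and sgn: "\<And>x. x \<in> \<Theta> \<Longrightarrow> 0 < c0 * f2 x"
begin

lemma deriv_strict_mono:
  assumes "x \<in> \<Theta>" "y \<in> \<Theta>" "x < y"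
  shows "c0 * f1 x < c0 * f1 y"
proof -
  obtain z where z: "z \<in> \<Theta>" "f1 y - f1 x = f2 z * (y - x)"
    using mvt_on_convex[OF cv assms(1,2) f1] by blast
  have "0 < (c0 * f2 z) * (y - x)" using sgn[OF z(1)] assms(3) by simp
  also have "\<dots> = c0 * f1 y - c0 * f1 x" by (metis z(2) mult.assoc right_diff_distrib)
  finally show ?thesis by simp
qed

lemma deriv_less_iff:
  assumes "x \<in> \<Theta>" "y \<in> \<Theta>"
  shows "c0 * f1 x < c0 * f1 y \<longleftrightarrow> x < y" "c0 * f1 x \<le> c0 * f1 y \<longleftrightarrow> x \<le> y"
  using deriv_strict_mono[OF assms] deriv_strict_mono[OF assms(2,1)]
  by (metis less_asym linorder_neqE not_less_iff_gr_or_eq, metis leD le_less linorder_not_less)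

lemma inj_deriv: "inj_on f1 \<Theta>"
  using deriv_strict_mono by (intro linorder_inj_onI') (metis less_irrefl)

lemma c0_nonzero: "x \<in> \<Theta> \<Longrightarrow> c0 \<noteq> 0"
  using sgn[of x] by auto

lemma deriv_between:
  assumes "a \<in> \<Theta>" "b \<in> \<Theta>" "x \<in> closed_segment a b" "f1 a \<in> {u..w}" "f1 b \<in> {u..w}"
  shows "x \<in> \<Theta>" "f1 x \<in> {u..w}"
proof -
  show x: "x \<in> \<Theta>" using assms cv closed_segment_subset by blast
  have "a \<le> x \<and> x \<le> b \<or> b \<le> x \<and> x \<le> a"
    using assms(3) by (auto simp: closed_segment_eq_real_ivl split: if_splits)
  then have "c0 * f1 a \<le> c0 * f1 x \<and> c0 * f1 x \<le> c0 * f1 b \<or> c0 * f1 b \<le> c0 * f1 x \<and> c0 * f1 x \<le> c0 * f1 a"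
    using deriv_less_iff(2) assms(1,2) x by auto
  then show "f1 x \<in> {u..w}"
    using c0_nonzero[OF x] assms(4,5) by (auto simp: mult_le_cancel_left split: if_splits)
qed

text \<open>The rescaled mean \<open>f1 (\<theta> + \<kappa> t) / c\<close> satisfies, as a function of \<open>t\<close>, the equation
  \<open>m' = \<rho> \<gamma> c0 m\<^sup>p\<close> with \<open>\<rho>\<close> the ratio of the dispersion and its asymptotic value. Hence
  \<open>T\<close> of it has derivative \<open>\<rho>\<close>, within \<open>\<eta>\<close> of \<open>1\<close>, which avoids any Gronwall argument. In the same way
  \<open>S\<close> of it has derivative \<open>\<rho> m\<close>, whereas the rescaled cumulant function has derivative \<open>m\<close>.\<close>

lemma scaled_ode_estimate:
  assumes c: "0 < c" and \<gamma>: "0 < \<gamma>" and \<mu>: "0 < \<mu>"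
    and \<theta>: "\<theta> \<in> \<Theta>" "f1 \<theta> = c * \<mu>"
    and R: "\<And>x. x \<in> \<Theta> \<Longrightarrow> f1 x \<in> {c * (\<mu>/2)..c * (2*\<mu>)} \<Longrightarrow> \<bar>f2 x / (c0 * f1 x powr p) - 1\<bar> \<le> \<eta>"
    and T: "\<And>x. 0 < x \<Longrightarrow> (T has_real_derivative 1 / (\<gamma> * c0 * x powr p)) (at x)"
    and S: "\<And>x. 0 < x \<Longrightarrow> (S has_real_derivative x / (\<gamma> * c0 * x powr p)) (at x)"
    and \<kappa>: "\<kappa> = c powr (1 - p) * \<gamma>"
    and x: "x \<in> \<Theta>" "f1 x \<in> {c * (\<mu>/2)..c * (2*\<mu>)}"
  shows "\<bar>T (f1 x / c) - T \<mu> - (x - \<theta>) / \<kappa>\<bar> \<le> \<eta> * (\<bar>x - \<theta>\<bar> / \<kappa>)"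
    and "\<bar>S (f1 x / c) - S \<mu> - (f x - f \<theta>) / (\<kappa> * c)\<bar> \<le> 2 * \<mu> * (\<eta> * (\<bar>x - \<theta>\<bar> / \<kappa>))"
proof -
  have \<kappa>_pos: "0 < \<kappa>" using c \<gamma> by (simp add: \<kappa>)
  let ?V = "{y \<in> \<Theta>. f1 y \<in> {c * (\<mu>/2)..c * (2*\<mu>)}}"
  define \<rho> where "\<rho> y = f2 y / (c0 * f1 y powr p)" for y
  have V: "convex ?V" unfolding convex_contains_segment
    using deriv_between by blast
  have \<theta>V: "\<theta> \<in> ?V" and xV: "x \<in> ?V" using \<theta> x c \<mu> by auto
  have pos: "0 < f1 y" if "y \<in> ?V" for y
  proof -
    have "0 < c * (\<mu>/2)" using c \<mu> by simp
    then show ?thesis using that by auto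
  qed
  have alg: "1 / (\<gamma> * c0 * (f1 y / c) powr p) * (f2 y / c) = \<rho> y / \<kappa>" if "y \<in> ?V" for y
  proof -
    have gen: "1 / (\<gamma> * c0 * (X / K)) * (F / c) = F / (c0 * X) / (c / K * \<gamma>)"
      if "X \<noteq> 0" "K \<noteq> 0" for X K F
      using that c \<gamma> c0_nonzero[OF \<theta>(1)] by (simp add: field_simps)
    have "c powr (1 - p) = c / c powr p" using c by (simp add: powr_diff)
    moreover have "(f1 y / c) powr p = f1 y powr p / c powr p"
      using pos[OF that] c by (simp add: powr_divide)
    ultimately show ?thesis
      using gen[of "f1 y powr p" "c powr p" "f2 y"] pos[OF that] c by (simp add: \<rho>_def \<kappa>)
  qed
  have d1: "((\<lambda>y. f1 y / c) has_real_derivative f2 y / c) (at y within ?V)" if "y \<in> ?V" for y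
    using that by (auto intro!: DERIV_cdivide DERIV_subset[OF f1])
  have dT: "((\<lambda>y. T (f1 y / c) - y / \<kappa>) has_real_derivative (\<rho> y - 1) / \<kappa>) (at y within ?V)"
    if "y \<in> ?V" for y
  proof -
    have "((\<lambda>y. T (f1 y / c)) has_real_derivative 1 / (\<gamma> * c0 * (f1 y / c) powr p) * (f2 y / c)) (at y within ?V)"
      using pos[OF that] c by (intro DERIV_chain2[OF T d1[OF that]]) auto
    then have "((\<lambda>y. T (f1 y / c)) has_real_derivative \<rho> y / \<kappa>) (at y within ?V)"
      unfolding alg[OF that] .
    then show ?thesis
      by (rule DERIV_diff[THEN DERIV_cong, OF _ DERIV_cdivide[OF DERIV_ident]]) (simp add: diff_divide_distrib)
  qed
  have dS: "((\<lambda>y. S (f1 y / c) - f y / (\<kappa> * c)) has_real_derivative (f1 y / c) * (\<rho> y - 1) / \<kappa>) (at y within ?V)"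
    if "y \<in> ?V" for y
  proof -
    have "((\<lambda>y. S (f1 y / c)) has_real_derivative (f1 y / c) / (\<gamma> * c0 * (f1 y / c) powr p) * (f2 y / c)) (at y within ?V)"
      using pos[OF that] c by (intro DERIV_chain2[OF S d1[OF that]]) auto
    moreover have "(f1 y / c) / (\<gamma> * c0 * (f1 y / c) powr p) * (f2 y / c)
        = (f1 y / c) * (1 / (\<gamma> * c0 * (f1 y / c) powr p) * (f2 y / c))" by simp
    ultimately have "((\<lambda>y. S (f1 y / c)) has_real_derivative (f1 y / c) * (\<rho> y / \<kappa>)) (at y within ?V)"
      unfolding alg[OF that] by simp
    moreover have "(f has_real_derivative f1 y) (at y within ?V)"
      using that by (auto intro: DERIV_subset[OF f])
    ultimately show ?thesis
      by (rule DERIV_diff[THEN DERIV_cong, OF _ DERIV_cdivide]) (simp add: right_diff_distrib diff_divide_distrib)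
  qed
  have \<rho>: "\<bar>\<rho> y - 1\<bar> \<le> \<eta>" if "y \<in> ?V" for y using R that by (auto simp: \<rho>_def)
  have \<mu>c: "f1 \<theta> / c = \<mu>" using \<theta> c by simp
  obtain y where y: "y \<in> ?V"
    "(T (f1 x / c) - x / \<kappa>) - (T (f1 \<theta> / c) - \<theta> / \<kappa>) = (\<rho> y - 1) / \<kappa> * (x - \<theta>)"
    using mvt_on_convex[OF V \<theta>V xV dT] by blast
  have "\<bar>T (f1 x / c) - T \<mu> - (x - \<theta>) / \<kappa>\<bar> = \<bar>(\<rho> y - 1) / \<kappa> * (x - \<theta>)\<bar>"
    unfolding y(2)[symmetric] \<mu>c by (simp add: diff_divide_distrib)
  also have "\<dots> = \<bar>\<rho> y - 1\<bar> * (\<bar>x - \<theta>\<bar> / \<kappa>)"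
    using \<kappa>_pos by (simp add: abs_mult)
  also have "\<dots> \<le> \<eta> * (\<bar>x - \<theta>\<bar> / \<kappa>)"
    using \<rho>[OF y(1)] \<kappa>_pos by (intro mult_right_mono) auto
  finally show "\<bar>T (f1 x / c) - T \<mu> - (x - \<theta>) / \<kappa>\<bar> \<le> \<eta> * (\<bar>x - \<theta>\<bar> / \<kappa>)" .
  obtain y where y: "y \<in> ?V"
    "(S (f1 x / c) - f x / (\<kappa> * c)) - (S (f1 \<theta> / c) - f \<theta> / (\<kappa> * c)) = (f1 y / c) * (\<rho> y - 1) / \<kappa> * (x - \<theta>)"
    using mvt_on_convex[OF V \<theta>V xV dS] by blast
  have fy: "0 < f1 y / c" "f1 y / c \<le> 2 * \<mu>" using pos[OF y(1)] y(1) c by (auto simp: field_simps)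
  have "\<bar>S (f1 x / c) - S \<mu> - (f x - f \<theta>) / (\<kappa> * c)\<bar> = \<bar>(f1 y / c) * (\<rho> y - 1) / \<kappa> * (x - \<theta>)\<bar>"
    unfolding y(2)[symmetric] \<mu>c by (simp add: diff_divide_distrib)
  also have "\<dots> = (f1 y / c) * (\<bar>\<rho> y - 1\<bar> * (\<bar>x - \<theta>\<bar> / \<kappa>))"
    using \<kappa>_pos pos[OF y(1)] c by (simp add: abs_mult)
  also have "\<dots> \<le> 2 * \<mu> * (\<eta> * (\<bar>x - \<theta>\<bar> / \<kappa>))"
    using \<rho>[OF y(1)] \<kappa>_pos fy \<mu> by (intro mult_mono mult_right_mono mult_nonneg_nonneg) auto
  finally show "\<bar>S (f1 x / c) - S \<mu> - (f x - f \<theta>) / (\<kappa> * c)\<bar> \<le> 2 * \<mu> * (\<eta> * (\<bar>x - \<theta>\<bar> / \<kappa>))" .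
qed

text \<open>The parameters with rescaled mean \<open>\<mu> / 2\<close> and \<open>2 \<mu>\<close> lie on the two sides of \<open>\<theta>\<close>. As the speed in the
  coordinate \<open>T\<close> is at most \<open>2\<close>, the rescaled parameter takes a time bounded below, independently of
  \<open>c\<close>, to reach either of them.\<close>

lemma scaled_domain:
  assumes c: "0 < c" and \<gamma>: "0 < \<gamma>" and \<mu>: "0 < \<mu>"
    and \<theta>: "\<theta> \<in> \<Theta>" "f1 \<theta> = c * \<mu>"
    and surj: "\<And>m. m \<in> {\<mu>/2..2*\<mu>} \<Longrightarrow> c * m \<in> f1 ` \<Theta>"
    and R: "\<And>x. x \<in> \<Theta> \<Longrightarrow> f1 x \<in> {c * (\<mu>/2)..c * (2*\<mu>)} \<Longrightarrow> \<bar>f2 x / (c0 * f1 x powr p) - 1\<bar> \<le> 1"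
    and T: "\<And>x. 0 < x \<Longrightarrow> (T has_real_derivative 1 / (\<gamma> * c0 * x powr p)) (at x)"
    and \<kappa>: "\<kappa> = c powr (1 - p) * \<gamma>"
    and t: "2 * \<bar>t\<bar> < \<bar>T (\<mu>/2) - T \<mu>\<bar>" "2 * \<bar>t\<bar> < \<bar>T (2*\<mu>) - T \<mu>\<bar>"
  shows "\<theta> + \<kappa> * t \<in> interior \<Theta>" "f1 (\<theta> + \<kappa> * t) \<in> {c * (\<mu>/2)..c * (2*\<mu>)}"
proof -
  have \<kappa>_pos: "0 < \<kappa>" using c \<gamma> by (simp add: \<kappa>)
  obtain a b where a: "a \<in> \<Theta>" "f1 a = c * (\<mu>/2)" and b: "b \<in> \<Theta>" "f1 b = c * (2*\<mu>)"
    using surj[of "\<mu>/2"] surj[of "2*\<mu>"] \<mu> by (auto simp: image_iff)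
  have "c * (\<mu>/2) \<le> c * (2*\<mu>)" using c \<mu> by (intro mult_left_mono) auto
  then have mem: "f1 a \<in> {c * (\<mu>/2)..c * (2*\<mu>)}" "f1 b \<in> {c * (\<mu>/2)..c * (2*\<mu>)}"
    unfolding a(2) b(2) by (simp_all only: atLeastAtMost_iff order_refl simp_thms)
  have est: "\<kappa> * \<bar>t\<bar> < \<bar>y - \<theta>\<bar>" if "y \<in> \<Theta>" "f1 y \<in> {c * (\<mu>/2)..c * (2*\<mu>)}" "2 * \<bar>t\<bar> < \<bar>T (f1 y / c) - T \<mu>\<bar>" for y
  proof -
    obtain S where S: "\<And>x. 0 < x \<Longrightarrow> (S has_real_derivative x / (\<gamma> * c0 * x powr p)) (at x)"
    proof (rule power_ode[OF \<mu>, of "\<gamma> * c0" p])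
      show "\<gamma> * c0 \<noteq> 0" using \<gamma> c0_nonzero[OF \<theta>(1)] by simp
      fix S :: "real \<Rightarrow> real"
      assume "\<And>x. 0 < x \<Longrightarrow> (S has_real_derivative x / (\<gamma> * c0 * x powr p)) (at x)"
      then show thesis by (rule that)
    qed
    have "\<bar>T (f1 y / c) - T \<mu> - (y - \<theta>) / \<kappa>\<bar> \<le> 1 * (\<bar>y - \<theta>\<bar> / \<kappa>)"
      by (rule scaled_ode_estimate(1)[OF c \<gamma> \<mu> \<theta> R T S \<kappa> that(1,2)])
    moreover have "\<bar>(y - \<theta>) / \<kappa>\<bar> = \<bar>y - \<theta>\<bar> / \<kappa>" using \<kappa>_pos by simp
    ultimately have "\<bar>t\<bar> < \<bar>y - \<theta>\<bar> / \<kappa>" using that(3) by linarith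
    then show ?thesis using \<kappa>_pos by (simp add: field_simps)
  qed
  have ab: "\<kappa> * \<bar>t\<bar> < \<bar>a - \<theta>\<bar>" "\<kappa> * \<bar>t\<bar> < \<bar>b - \<theta>\<bar>"
  proof -
    have "f1 a / c = \<mu>/2" "f1 b / c = 2*\<mu>" using a b c by auto
    then show "\<kappa> * \<bar>t\<bar> < \<bar>a - \<theta>\<bar>" "\<kappa> * \<bar>t\<bar> < \<bar>b - \<theta>\<bar>"
      using est[OF a(1) mem(1)] est[OF b(1) mem(2)] t by (simp_all only:)
  qed
  have lt: "c * (\<mu>/2) < c * \<mu>" "c * \<mu> < c * (2*\<mu>)" using c \<mu> by auto
  have k: "\<bar>\<kappa> * t\<bar> = \<kappa> * \<bar>t\<bar>" using \<kappa>_pos by (simp add: abs_mult)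
  have "c0 > 0 \<or> c0 < 0" using c0_nonzero[OF \<theta>(1)] by auto
  then have side: "a < \<theta> + \<kappa> * t \<and> \<theta> + \<kappa> * t < b \<or> b < \<theta> + \<kappa> * t \<and> \<theta> + \<kappa> * t < a"
  proof
    assume "c0 > 0"
    then have "c0 * f1 a < c0 * f1 \<theta>" "c0 * f1 \<theta> < c0 * f1 b"
      unfolding a b \<theta>(2) using lt by (simp_all only: mult_strict_left_mono)
    then have "a < \<theta>" "\<theta> < b" using deriv_less_iff(1)[OF a(1) \<theta>(1)] deriv_less_iff(1)[OF \<theta>(1) b(1)] by simp_all
    then show ?thesis using ab k by linarith
  next
    assume "c0 < 0"
    then have "c0 * f1 b < c0 * f1 \<theta>" "c0 * f1 \<theta> < c0 * f1 a"
      unfolding a b \<theta>(2) using lt by (simp_all only: mult_strict_left_mono_neg)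
    then have "b < \<theta>" "\<theta> < a" using deriv_less_iff(1)[OF b(1) \<theta>(1)] deriv_less_iff(1)[OF \<theta>(1) a(1)] by simp_all
    then show ?thesis using ab k by linarith
  qed
  have seg: "closed_segment a b \<subseteq> \<Theta>" using a(1) b(1) cv closed_segment_subset by blast
  have bt: "y \<in> {min a b<..<max a b} \<and> y \<in> closed_segment a b"
    if "a < y \<and> y < b \<or> b < y \<and> y < a" for y
    using that by (auto simp: closed_segment_eq_real_ivl)
  have "{min a b<..<max a b} \<subseteq> closed_segment a b"
    unfolding closed_segment_eq_real_ivl by (cases "a \<le> b") auto
  with seg have "{min a b<..<max a b} \<subseteq> interior \<Theta>"
    by (intro interior_maximal open_greaterThanLessThan) blast
  with bt[OF side] show "\<theta> + \<kappa> * t \<in> interior \<Theta>" by blast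
  show "f1 (\<theta> + \<kappa> * t) \<in> {c * (\<mu>/2)..c * (2*\<mu>)}"
    using deriv_between(2)[OF a(1) b(1) _ mem] bt[OF side] by blast
qed

end

section \<open>Limits of rescaled cumulant functions\<close>

lemma eventually_at_scaled:
  fixes F :: "real filter"
  assumes F: "F = at_right 0 \<or> F = at_top" and c: "filterlim c F sequentially"
    and Q: "\<forall>\<^sub>F m in F. Q m" and u: "0 < u" "u \<le> w"
  shows "\<forall>\<^sub>F n in sequentially. \<forall>m\<in>{u..w}. Q (c n * m)"
  using F
proof
  assume F: "F = at_right 0"
  obtain b where b: "0 < b" "\<And>m. 0 < m \<Longrightarrow> m < b \<Longrightarrow> Q m"
    using Q unfolding F eventually_at_right_field by auto
  have "\<forall>\<^sub>F m in at_right 0. m \<in> {0<..<b / w}"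
    using b u by (intro eventually_at_right_real) auto
  then have "\<forall>\<^sub>F n in sequentially. c n \<in> {0<..<b / w}"
    using c by (auto simp: F filterlim_iff)
  then show ?thesis
  proof eventually_elim
    case (elim n)
    show ?case
    proof
      fix m assume m: "m \<in> {u..w}"
      have "c n * m \<le> c n * w" using elim m by (intro mult_left_mono) auto
      also have "\<dots> < b" using elim u by (simp add: field_simps)
      finally show "Q (c n * m)" using elim m u by (intro b(2)) auto
    qed
  qed
next
  assume F: "F = at_top"
  obtain B where B: "\<And>m. B \<le> m \<Longrightarrow> Q m"
    using Q unfolding F eventually_at_top_linorder by auto
  have "\<forall>\<^sub>F n in sequentially. max 0 B / u \<le> c n"
    using c by (auto simp: F filterlim_at_top)
  then show ?thesis
  proof eventually_elim
    case (elim n)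
    show ?case
    proof
      fix m assume m: "m \<in> {u..w}"
      have cn: "0 \<le> c n" using elim u by (meson divide_nonneg_pos max.cobounded1 order_trans)
      have "B \<le> c n * u" using elim u by (simp add: field_simps)
      also have "\<dots> \<le> c n * m" using m cn by (intro mult_left_mono) auto
      finally show "Q (c n * m)" by (rule B)
    qed
  qed
qed

context cumulant_curve
begin

text \<open>For \<open>\<mu> > 0\<close> the rescaled means stay in a compact part of \<open>(0, \<infinity>)\<close>, where the ratio \<open>\<rho>\<close> tends to
  \<open>1\<close> uniformly. Therefore \<open>T\<close> of the rescaled mean tends to \<open>T \<mu> + t\<close>, and applying \<open>G\<close> gives the
  solution of the limiting equation.\<close>

lemma positive_mean_limit:
  fixes F :: "real filter"
  assumes F: "F = at_right 0 \<or> F = at_top" and c: "filterlim c F sequentially" and c_pos: "\<And>n. 0 < c n"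
    and near: "\<And>\<eta>. 0 < \<eta> \<Longrightarrow> \<forall>\<^sub>F m in F. m \<in> f1 ` \<Theta> \<and>
      (\<forall>x\<in>\<Theta>. f1 x = m \<longrightarrow> \<bar>f2 x / (c0 * m powr p) - 1\<bar> \<le> \<eta>)"
    and \<gamma>: "0 < \<gamma>" and \<mu>: "0 < \<mu>"
    and \<theta>: "\<And>n. \<theta> n \<in> \<Theta>" "\<And>n. f1 (\<theta> n) = c n * \<mu>"
    and \<kappa>: "\<And>n. \<kappa> n = c n powr (1 - p) * \<gamma>"
  obtains D m e n0 where "0 < e" "e \<le> 1" "m 0 = \<mu>"
    "\<And>t. \<bar>t\<bar> < e \<Longrightarrow> (D has_real_derivative m t) (at t)"
    "\<And>t. \<bar>t\<bar> < e \<Longrightarrow> (m has_real_derivative (\<gamma> * c0) * m t powr p) (at t)"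
    "\<And>t. \<bar>t\<bar> < e \<Longrightarrow> 0 < m t"
    "\<And>n t. n \<ge> n0 \<Longrightarrow> \<bar>t\<bar> < e \<Longrightarrow> \<theta> n + \<kappa> n * t \<in> interior \<Theta>"
    "\<And>t. \<bar>t\<bar> < e \<Longrightarrow> (\<lambda>n. (f (\<theta> n + \<kappa> n * t) - f (\<theta> n)) / (\<kappa> n * c n)) \<longlonglongrightarrow> D t"
proof -
  have c0: "\<gamma> * c0 \<noteq> 0" using \<gamma> c0_nonzero[OF \<theta>(1)] by simp
  show ?thesis
  proof (rule power_ode[OF \<mu> c0, of p])
    fix T S G e0
    assume T: "\<And>x. 0 < x \<Longrightarrow> (T has_real_derivative 1 / (\<gamma> * c0 * x powr p)) (at x)"
      and S: "\<And>x. 0 < x \<Longrightarrow> (S has_real_derivative x / (\<gamma> * c0 * x powr p)) (at x)"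
      and GT: "\<And>x. 0 < x \<Longrightarrow> G (T x) = x" and e0: "0 < e0"
      and G_pos: "\<And>t. \<bar>t\<bar> < e0 \<Longrightarrow> 0 < G (T \<mu> + t)"
      and G': "\<And>t. \<bar>t\<bar> < e0 \<Longrightarrow> (G has_real_derivative \<gamma> * c0 * G (T \<mu> + t) powr p) (at (T \<mu> + t))"
    define m where "m t = G (T \<mu> + t)" for t
    define D where "D t = S (m t) - S \<mu>" for t
    have T_neq: "T x \<noteq> T \<mu>" if "0 < x" "x \<noteq> \<mu>" for x
      using GT[OF that(1)] GT[OF \<mu>] that(2) by metis
    define e where "e = min (min e0 1) (min (\<bar>T (\<mu>/2) - T \<mu>\<bar> / 2) (\<bar>T (2*\<mu>) - T \<mu>\<bar> / 2))"
    have e: "0 < e" using e0 T_neq[of "\<mu>/2"] T_neq[of "2*\<mu>"] \<mu> by (simp add: e_def)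
    have e_le: "e \<le> e0" "e \<le> 1" "2 * e \<le> \<bar>T (\<mu>/2) - T \<mu>\<bar>" "2 * e \<le> \<bar>T (2*\<mu>) - T \<mu>\<bar>"
      by (auto simp: e_def min_def)
    have m': "(m has_real_derivative (\<gamma> * c0) * m t powr p) (at t)" if "\<bar>t\<bar> < e" for t
    proof -
      have "((\<lambda>t. G (T \<mu> + t)) has_real_derivative \<gamma> * c0 * G (T \<mu> + t) powr p * 1) (at t)"
        using that e_le
        by (intro DERIV_chain2[where g = "\<lambda>t. T \<mu> + t", OF G']) (auto intro!: derivative_eq_intros)
      then show ?thesis by (simp add: m_def[abs_def])
    qed
    have m_pos: "0 < m t" if "\<bar>t\<bar> < e" for t
      using G_pos[of t] that e_le by (simp add: m_def)
    have D': "(D has_real_derivative m t) (at t)" if "\<bar>t\<bar> < e" for t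
    proof -
      have "((\<lambda>t. S (m t) - S \<mu>) has_real_derivative
          m t / (\<gamma> * c0 * m t powr p) * ((\<gamma> * c0) * m t powr p) - 0) (at t)"
        by (intro DERIV_diff DERIV_const DERIV_chain2[OF S[OF m_pos[OF that]] m'[OF that]])
      then show ?thesis using m_pos[OF that] c0 by (simp add: D_def[abs_def])
    qed
    have ev: "\<forall>\<^sub>F n in sequentially. (\<forall>u\<in>{\<mu>/2..2*\<mu>}. c n * u \<in> f1 ` \<Theta>) \<and>
        (\<forall>x\<in>\<Theta>. f1 x \<in> {c n * (\<mu>/2)..c n * (2*\<mu>)} \<longrightarrow> \<bar>f2 x / (c0 * f1 x powr p) - 1\<bar> \<le> \<eta>)"
      if "0 < \<eta>" for \<eta>
    proof -
      have "\<forall>\<^sub>F n in sequentially. \<forall>u\<in>{\<mu>/2..2*\<mu>}. c n * u \<in> f1 ` \<Theta> \<and>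
        (\<forall>x\<in>\<Theta>. f1 x = c n * u \<longrightarrow> \<bar>f2 x / (c0 * (c n * u) powr p) - 1\<bar> \<le> \<eta>)"
        using \<mu> by (intro eventually_at_scaled[OF F c near[OF that]]) auto
      then show ?thesis
      proof eventually_elim
        case (elim n)
        have "\<bar>f2 x / (c0 * f1 x powr p) - 1\<bar> \<le> \<eta>"
          if x: "x \<in> \<Theta>" "f1 x \<in> {c n * (\<mu>/2)..c n * (2*\<mu>)}" for x
        proof -
          have "f1 x / c n \<in> {\<mu>/2..2*\<mu>}" using x(2) c_pos[of n] by (auto simp: field_simps)
          moreover have "f1 x = c n * (f1 x / c n)" using c_pos[of n] by simp
          ultimately show ?thesis using elim x(1) by metis
        qed
        then show ?case using elim by blast
      qed
    qed
    obtain n0 where n0: "\<And>n. n \<ge> n0 \<Longrightarrow> (\<forall>u\<in>{\<mu>/2..2*\<mu>}. c n * u \<in> f1 ` \<Theta>) \<and>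
        (\<forall>x\<in>\<Theta>. f1 x \<in> {c n * (\<mu>/2)..c n * (2*\<mu>)} \<longrightarrow> \<bar>f2 x / (c0 * f1 x powr p) - 1\<bar> \<le> 1)"
      using ev[of 1] by (auto simp: eventually_sequentially)
    have dom: "\<theta> n + \<kappa> n * t \<in> interior \<Theta>" "f1 (\<theta> n + \<kappa> n * t) \<in> {c n * (\<mu>/2)..c n * (2*\<mu>)}"
      if "n \<ge> n0" "\<bar>t\<bar> < e" for n t
      using scaled_domain[OF c_pos \<gamma> \<mu> \<theta> _ _ T \<kappa>, of n t] n0[OF that(1)] that(2) e_le by auto
    have lim: "(\<lambda>n. (f (\<theta> n + \<kappa> n * t) - f (\<theta> n)) / (\<kappa> n * c n)) \<longlonglongrightarrow> D t" if t: "\<bar>t\<bar> < e" for t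
    proof -
      define x where "x n = f1 (\<theta> n + \<kappa> n * t) / c n" for n
      define q where "q n = (f (\<theta> n + \<kappa> n * t) - f (\<theta> n)) / (\<kappa> n * c n)" for n
      have est: "\<forall>\<^sub>F n in sequentially. \<bar>T (x n) - T \<mu> - t\<bar> \<le> \<eta> \<and> \<bar>S (x n) - S \<mu> - q n\<bar> \<le> 2 * \<mu> * \<eta>"
        if "0 < \<eta>" for \<eta>
        using ev[OF that] eventually_ge_at_top[of n0]
      proof eventually_elim
        case (elim n)
        have "\<kappa> n > 0" using c_pos[of n] \<gamma> by (simp add: \<kappa>)
        then have s: "(\<theta> n + \<kappa> n * t - \<theta> n) / \<kappa> n = t" "\<bar>\<theta> n + \<kappa> n * t - \<theta> n\<bar> / \<kappa> n = \<bar>t\<bar>"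
          by (simp_all add: abs_mult)
        have i: "\<theta> n + \<kappa> n * t \<in> \<Theta>" using dom(1)[OF elim(2) t] interior_subset by blast
        have t1: "\<eta> * \<bar>t\<bar> \<le> \<eta> * 1" using that t e_le by (intro mult_left_mono) auto
        note E = scaled_ode_estimate[OF c_pos \<gamma> \<mu> \<theta> _ T S \<kappa> i dom(2)[OF elim(2) t], of \<eta>, unfolded s]
        have "\<bar>T (x n) - T \<mu> - t\<bar> \<le> \<eta> * \<bar>t\<bar>"
          unfolding x_def by (rule E(1)) (use elim in auto)
        moreover have "\<bar>S (x n) - S \<mu> - q n\<bar> \<le> 2 * \<mu> * (\<eta> * \<bar>t\<bar>)"
          unfolding x_def q_def by (rule E(2)) (use elim in auto)
        moreover have "2 * \<mu> * (\<eta> * \<bar>t\<bar>) \<le> 2 * \<mu> * \<eta>" using t1 \<mu> by (intro mult_left_mono) auto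
        ultimately show ?case using t1 by linarith
      qed
      have "(\<lambda>n. T (x n) - T \<mu> - t) \<longlonglongrightarrow> 0"
        unfolding tendsto_iff dist_real_def
      proof (intro allI impI)
        fix r :: real assume "0 < r"
        then show "\<forall>\<^sub>F n in sequentially. \<bar>T (x n) - T \<mu> - t - 0\<bar> < r"
          using est[of "r/2"] by (auto elim!: eventually_mono)
      qed
      then have "(\<lambda>n. (T (x n) - T \<mu> - t) + (T \<mu> + t)) \<longlonglongrightarrow> 0 + (T \<mu> + t)"
        by (intro tendsto_add tendsto_const)
      then have "(\<lambda>n. T (x n)) \<longlonglongrightarrow> T \<mu> + t" by simp
      moreover have "isCont G (T \<mu> + t)" using G'[of t] t e_le by (intro DERIV_isCont) auto
      ultimately have "(\<lambda>n. G (T (x n))) \<longlonglongrightarrow> m t"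
        unfolding m_def using isCont_tendsto_compose by blast
      moreover have "\<forall>\<^sub>F n in sequentially. G (T (x n)) = x n"
        using eventually_ge_at_top[of n0]
      proof eventually_elim
        case (elim n)
        have "0 < c n * (\<mu>/2)" using c_pos[of n] \<mu> by simp
        then have "0 < x n" using dom(2)[OF elim t] c_pos[of n] by (auto simp: x_def)
        then show ?case by (rule GT)
      qed
      ultimately have "x \<longlonglongrightarrow> m t" by (rule Lim_transform_eventually)
      moreover have "isCont S (m t)" using S[OF m_pos[OF t]] by (rule DERIV_isCont)
      ultimately have "(\<lambda>n. S (x n)) \<longlonglongrightarrow> S (m t)" using isCont_tendsto_compose by blast
      moreover have "(\<lambda>n. S (x n) - S \<mu> - q n) \<longlonglongrightarrow> 0"
        unfolding tendsto_iff dist_real_def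
      proof (intro allI impI)
        fix r :: real assume r: "0 < r"
        have "2 * \<mu> * (r / (4 * \<mu>)) < r" using r \<mu> by simp
        then show "\<forall>\<^sub>F n in sequentially. \<bar>S (x n) - S \<mu> - q n - 0\<bar> < r"
          using est[of "r / (4 * \<mu>)"] r \<mu> by (auto elim!: eventually_mono)
      qed
      ultimately have "(\<lambda>n. S (x n) - S \<mu> - (S (x n) - S \<mu> - q n)) \<longlonglongrightarrow> S (m t) - S \<mu> - 0"
        by (intro tendsto_diff tendsto_const)
      then show ?thesis by (simp add: q_def D_def)
    qed
    show ?thesis
      by (rule that[of e m D n0]) (use e e_le GT[OF \<mu>] D' m' m_pos dom lim in \<open>auto simp: m_def\<close>)
  qed
qed


text \<open>Second-order Taylor expansion at a zero of the mean, obtained from the first-order expansion of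
  \<open>f1\<close> by the mean value theorem; the zero may be an end point of \<open>\<Theta>\<close>.\<close>

lemma quadratic_approximation:
  assumes z: "z \<in> \<Theta>" "f1 z = 0"
    and x: "\<And>n. x n \<in> \<Theta>" "x \<longlonglongrightarrow> z"
  obtains r where "\<And>n. f (x n) - f z = (f2 z / 2 + r n) * (x n - z)\<^sup>2" "r \<longlonglongrightarrow> 0"
proof -
  define R where "R y = (if y = z then 0 else (f y - f z) / (y - z)\<^sup>2 - f2 z / 2)" for y
  have "(\<lambda>n. R (x n)) \<longlonglongrightarrow> 0"
    unfolding tendsto_iff dist_real_def
  proof (intro allI impI)
    fix r :: real assume r: "0 < r"
    define \<eta> where "\<eta> = r / 2"
    have \<eta>: "0 < \<eta>" "\<eta> < r" using r by (auto simp: \<eta>_def)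
    have "((\<lambda>y. (f1 y - f1 z) / (y - z)) \<longlongrightarrow> f2 z) (at z within \<Theta>)"
      using f1[OF z(1)] by (simp add: has_field_derivative_iff)
    then have "\<forall>\<^sub>F y in at z within \<Theta>. dist ((f1 y - f1 z) / (y - z)) (f2 z) < \<eta>"
      using \<eta>(1) by (rule tendstoD)
    then obtain \<rho> where \<rho>: "0 < \<rho>"
      "\<And>y. y \<in> \<Theta> \<Longrightarrow> y \<noteq> z \<Longrightarrow> dist y z < \<rho> \<Longrightarrow> \<bar>f1 y / (y - z) - f2 z\<bar> < \<eta>"
      by (auto simp: eventually_at z dist_real_def)
    have e1: "\<bar>f1 y - f2 z * (y - z)\<bar> \<le> \<eta> * \<bar>y - z\<bar>" if "y \<in> \<Theta>" "dist y z < \<rho>" for y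
    proof (cases "y = z")
      case False
      have "f1 y - f2 z * (y - z) = (f1 y / (y - z) - f2 z) * (y - z)"
        using False by (simp add: left_diff_distrib)
      then show ?thesis using \<rho>(2)[OF that(1) False that(2)] False
        by (simp add: abs_mult mult_right_mono less_imp_le)
    qed (simp add: z)
    let ?V = "\<Theta> \<inter> ball z \<rho>"
    have V: "convex ?V" by (intro convex_Int cv convex_ball)
    have dV: "((\<lambda>y. f y - f2 z / 2 * (y - z)\<^sup>2) has_real_derivative f1 y - f2 z * (y - z)) (at y within ?V)"
      if "y \<in> ?V" for y
    proof -
      have "(f has_real_derivative f1 y) (at y within ?V)"
        using that by (auto intro: DERIV_subset[OF f])
      then show ?thesis by (auto intro!: derivative_eq_intros)
    qed
    have R_le: "\<bar>R y\<bar> \<le> \<eta>" if y: "y \<in> \<Theta>" "dist y z < \<rho>" for y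
    proof (cases "y = z")
      case False
      have yV: "z \<in> ?V" "y \<in> ?V" using y z \<rho>(1) by (auto simp: dist_commute)
      obtain w where w: "w \<in> closed_segment z y" "w \<in> ?V"
        "(f y - f2 z / 2 * (y - z)\<^sup>2) - (f z - f2 z / 2 * (z - z)\<^sup>2) = (f1 w - f2 z * (w - z)) * (y - z)"
        using mvt_on_convex[OF V yV dV] by blast
      have wz: "\<bar>w - z\<bar> \<le> \<bar>y - z\<bar>"
        using w(1) by (auto simp: closed_segment_eq_real_ivl split: if_splits)
      have "\<bar>f1 w - f2 z * (w - z)\<bar> \<le> \<eta> * \<bar>w - z\<bar>"
        using w(2) by (intro e1) (auto simp: dist_commute)
      also have "\<dots> \<le> \<eta> * \<bar>y - z\<bar>" using wz \<eta> by (intro mult_left_mono) auto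
      finally have "\<bar>(f1 w - f2 z * (w - z)) * (y - z)\<bar> \<le> \<eta> * \<bar>y - z\<bar> * \<bar>y - z\<bar>"
        unfolding abs_mult by (rule mult_right_mono) simp
      also have "\<dots> = \<eta> * (y - z)\<^sup>2" by (simp add: power2_eq_square mult.assoc flip: abs_mult)
      finally have "\<bar>f y - f z - f2 z / 2 * (y - z)\<^sup>2\<bar> \<le> \<eta> * (y - z)\<^sup>2" using w(3) by simp
      moreover have "R y = (f y - f z - f2 z / 2 * (y - z)\<^sup>2) / (y - z)\<^sup>2"
        using False by (simp add: R_def diff_divide_distrib)
      ultimately show ?thesis using False by (simp add: abs_divide pos_divide_le_eq)
    qed (use \<eta> in \<open>simp add: R_def\<close>)
    have "\<forall>\<^sub>F n in sequentially. dist (x n) z < \<rho>" using x(2) \<rho>(1) by (rule tendstoD)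
    then show "\<forall>\<^sub>F n in sequentially. \<bar>R (x n) - 0\<bar> < r"
    proof eventually_elim
      case (elim n)
      show ?case using R_le[OF x(1) elim] \<eta>(2) by simp
    qed
  qed
  then show ?thesis
    by (rule that[of "\<lambda>n. R (x n)", rotated]) (auto simp: R_def)
qed

text \<open>Inverse function rule for the mean at its zero \<open>z\<close>. For \<open>\<mu> \<noteq> 0\<close> the parameters \<open>\<theta> n\<close> approach \<open>z\<close>
  from one side by monotonicity.\<close>

lemma preimage_of_null_sequence:
  assumes z: "z \<in> \<Theta>" "f1 z = 0" and \<mu>: "\<mu> \<le> 0"
    and c: "c \<longlonglongrightarrow> 0" "\<And>n. 0 < c n"
    and \<theta>: "\<And>n. \<theta> n \<in> \<Theta>" "\<And>n. f1 (\<theta> n) = c n * \<mu>"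
  shows "\<theta> \<longlonglongrightarrow> z" "(\<lambda>n. (\<theta> n - z) / c n) \<longlonglongrightarrow> \<mu> / f2 z"
proof -
  show conv: "\<theta> \<longlonglongrightarrow> z"
  proof (cases "\<mu> = 0")
    case True
    then have "\<theta> n = z" for n
      using inj_onD[OF inj_deriv, of "\<theta> n" z] \<theta> z by simp
    then have "\<theta> = (\<lambda>_. z)" by (rule ext)
    then show ?thesis by simp
  next
    case False
    then have \<mu>': "\<mu> < 0" using \<mu> by simp
    show ?thesis
      unfolding tendsto_iff dist_real_def
    proof (intro allI impI)
      fix r :: real assume r: "0 < r"
      define x where "x = \<theta> 0"
      have x: "x \<in> \<Theta>" "f1 x < 0" using \<theta>[of 0] c(2)[of 0] \<mu>' by (auto simp: x_def mult_pos_neg)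
      have xz: "x \<noteq> z" using x z by auto
      define s where "s = min 1 (r / (2 * \<bar>x - z\<bar>))"
      have s: "0 < s" "s \<le> 1" "s * \<bar>x - z\<bar> < r"
      proof -
        show "0 < s" "s \<le> 1" using r xz by (auto simp: s_def)
        have "s * \<bar>x - z\<bar> \<le> r / (2 * \<bar>x - z\<bar>) * \<bar>x - z\<bar>"
          by (intro mult_right_mono) (auto simp: s_def)
        also have "\<dots> = r / 2" using xz by simp
        finally show "s * \<bar>x - z\<bar> < r" using r by simp
      qed
      define y where "y = z + s * (x - z)"
      have yseg: "y \<in> closed_segment z x"
        unfolding closed_segment_def y_def using s by (auto intro!: exI[of _ s] simp: algebra_simps)
      have y: "y \<in> \<Theta>" "f1 y \<in> {f1 x..0}"
        using deriv_between[OF z(1) x(1) yseg, of "f1 x" 0] x z by auto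
      have "y \<noteq> z" using s xz by (simp add: y_def)
      then have "f1 y \<noteq> 0" using inj_onD[OF inj_deriv, of y z] y z by auto
      then have fy: "f1 y < 0" using y by auto
      have yz: "\<bar>y - z\<bar> < r" using s by (simp add: y_def abs_mult)
      have "(\<lambda>n. c n * \<mu>) \<longlonglongrightarrow> 0 * \<mu>" by (intro tendsto_mult c tendsto_const)
      then have "\<forall>\<^sub>F n in sequentially. f1 y < c n * \<mu>" using fy by (intro order_tendstoD) auto
      then show "\<forall>\<^sub>F n in sequentially. \<bar>\<theta> n - z\<bar> < r"
      proof eventually_elim
        case (elim n)
        have n: "f1 y < f1 (\<theta> n)" "f1 (\<theta> n) < f1 z"
          using elim \<theta>(2)[of n] z c(2)[of n] \<mu>' by (auto simp: mult_pos_neg)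
        have "c0 > 0 \<or> c0 < 0" using c0_nonzero[OF z(1)] by auto
        then have "\<theta> n \<in> closed_segment y z"
        proof
          assume "c0 > 0"
          then have "c0 * f1 y < c0 * f1 (\<theta> n)" "c0 * f1 (\<theta> n) < c0 * f1 z"
            using n by (simp_all only: mult_strict_left_mono)
          then show ?thesis
            using deriv_less_iff(1)[OF y(1) \<theta>(1)] deriv_less_iff(1)[OF \<theta>(1) z(1)]
            by (simp add: closed_segment_eq_real_ivl)
        next
          assume "c0 < 0"
          then have "c0 * f1 (\<theta> n) < c0 * f1 y" "c0 * f1 z < c0 * f1 (\<theta> n)"
            using n by (simp_all only: mult_strict_left_mono_neg)
          then show ?thesis
            using deriv_less_iff(1)[OF \<theta>(1) y(1)] deriv_less_iff(1)[OF z(1) \<theta>(1)]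
            by (simp add: closed_segment_eq_real_ivl)
        qed
        then have "\<bar>\<theta> n - z\<bar> \<le> \<bar>y - z\<bar>" by (auto simp: closed_segment_eq_real_ivl split: if_splits)
        then show ?case using yz by simp
      qed
    qed
  qed
  define S where "S x = (if x = z then f2 z else f1 x / (x - z))" for x
  have f2z: "f2 z \<noteq> 0" using sgn[OF z(1)] by auto
  have "(\<lambda>n. S (\<theta> n)) \<longlonglongrightarrow> f2 z"
    unfolding tendsto_iff
  proof (intro allI impI)
    fix r :: real assume r: "0 < r"
    have "((\<lambda>y. (f1 y - f1 z) / (y - z)) \<longlongrightarrow> f2 z) (at z within \<Theta>)"
      using f1[OF z(1)] by (simp add: has_field_derivative_iff)
    then have "\<forall>\<^sub>F y in at z within \<Theta>. dist ((f1 y - f1 z) / (y - z)) (f2 z) < r"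
      using r by (rule tendstoD)
    then obtain \<rho> where \<rho>: "0 < \<rho>"
      "\<And>y. y \<in> \<Theta> \<Longrightarrow> y \<noteq> z \<Longrightarrow> dist y z < \<rho> \<Longrightarrow> dist (f1 y / (y - z)) (f2 z) < r"
      by (auto simp: eventually_at z)
    have "\<forall>\<^sub>F n in sequentially. dist (\<theta> n) z < \<rho>" using conv \<rho>(1) by (rule tendstoD)
    then show "\<forall>\<^sub>F n in sequentially. dist (S (\<theta> n)) (f2 z) < r"
      by eventually_elim (use \<rho>(2) \<theta>(1) r in \<open>auto simp: S_def\<close>)
  qed
  then have "(\<lambda>n. \<mu> / S (\<theta> n)) \<longlonglongrightarrow> \<mu> / f2 z" using f2z by (intro tendsto_divide tendsto_const)
  moreover have "\<mu> / S (\<theta> n) = (\<theta> n - z) / c n" for n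
  proof (cases "\<theta> n = z")
    case True
    then have "c n * \<mu> = 0" using \<theta>(2)[of n] z by simp
    then show ?thesis using True c(2)[of n] by auto
  next
    case False
    then have "f1 (\<theta> n) \<noteq> 0" using inj_onD[OF inj_deriv, of "\<theta> n" z] \<theta> z by auto
    then show ?thesis using False \<theta>(2)[of n] c(2)[of n] by (auto simp: S_def field_simps)
  qed
  ultimately show "(\<lambda>n. (\<theta> n - z) / c n) \<longlonglongrightarrow> \<mu> / f2 z" by simp
qed

text \<open>The nonpositive means \<open>c n * \<mu>\<close> and the positive mean at \<open>b\<close>
  force a zero \<open>z\<close> of the mean in \<open>\<Theta>\<close>, and the rescaled cumulant functions see only the quadratic
  part at \<open>z\<close>. The factor \<open>sgn c0\<close> selects the side of \<open>z\<close> on which the mean is positive: if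
  \<open>\<mu> = 0\<close>, it may be the only side that belongs to \<open>\<Theta>\<close>.\<close>

lemma nonpositive_mean_limit_at_0:
  assumes b: "b \<in> \<Theta>" "0 < f1 b" and \<mu>: "\<mu> \<le> 0" and \<gamma>: "0 < \<gamma>"
    and c: "c \<longlonglongrightarrow> 0" "\<And>n. 0 < c n"
    and \<theta>: "\<And>n. \<theta> n \<in> \<Theta>" "\<And>n. f1 (\<theta> n) = c n * \<mu>"
    and \<kappa>: "\<And>n. \<kappa> n = c n * \<gamma>"
  obtains z n0 where "z \<in> \<Theta>"
    "\<And>n t. n \<ge> n0 \<Longrightarrow> 0 < t \<Longrightarrow> t < 1 \<Longrightarrow> \<theta> n + \<kappa> n * (sgn c0 * t) \<in> interior \<Theta>"
    "\<And>t. 0 < t \<Longrightarrow> t < 1 \<Longrightarrow>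
      (\<lambda>n. (f (\<theta> n + \<kappa> n * (sgn c0 * t)) - f (\<theta> n)) / (\<kappa> n * c n))
        \<longlonglongrightarrow> \<gamma> * f2 z / 2 * (sgn c0 * t)\<^sup>2 + \<mu> * (sgn c0 * t)"
proof -
  have c0: "c0 \<noteq> 0" using b c0_nonzero by blast
  have "continuous_on \<Theta> f1"
    using f1 by (intro DERIV_continuous_on) auto
  then have "connected (f1 ` \<Theta>)"
    using cv by (intro connected_continuous_image convex_connected)
  then have "is_interval (f1 ` \<Theta>)" by (simp add: is_interval_connected_1)
  moreover have "f1 (\<theta> 0) \<le> 0" using \<theta>(2)[of 0] c(2)[of 0] \<mu> by (simp add: mult_nonneg_nonpos)
  ultimately have "0 \<in> f1 ` \<Theta>"
    using b \<theta>(1)[of 0] unfolding is_interval_1 by (meson imageI less_imp_le)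
  then obtain z where z: "z \<in> \<Theta>" "f1 z = 0" by auto
  have f2z: "f2 z \<noteq> 0" using sgn[OF z(1)] by auto
  note lim = preimage_of_null_sequence[OF z \<mu> c \<theta>]
  let ?s = "sgn c0"
  have s: "?s = 1 \<and> c0 > 0 \<or> ?s = -1 \<and> c0 < 0" using c0 by (auto simp: sgn_if)
  have sb: "0 < ?s * (b - z)"
    using s deriv_less_iff(1)[OF z(1) b(1)] deriv_less_iff(1)[OF b(1) z(1)] b(2) z(2)
    by (auto simp: mult_less_0_iff zero_less_mult_iff)
  have s\<theta>: "?s * (\<theta> n - z) \<le> 0" for n
  proof -
    have "f1 (\<theta> n) \<le> 0" using \<theta>(2)[of n] c(2)[of n] \<mu> by (simp add: mult_nonneg_nonpos)
    then show ?thesis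
      using s deriv_less_iff(2)[OF z(1) \<theta>(1)] deriv_less_iff(2)[OF \<theta>(1) z(1)] z(2)
      by (auto simp: mult_le_0_iff zero_le_mult_iff)
  qed
  have k0: "\<kappa> \<longlonglongrightarrow> 0" using tendsto_mult[OF c(1) tendsto_const[of \<gamma>]] by (simp add: \<kappa>[abs_def])
  have "\<forall>\<^sub>F n in sequentially. \<kappa> n < ?s * (b - z)" using k0 sb by (rule order_tendstoD)
  then obtain n0 where n0: "\<And>n. n \<ge> n0 \<Longrightarrow> \<kappa> n < ?s * (b - z)" by (auto simp: eventually_sequentially)
  have dom: "\<theta> n + \<kappa> n * (?s * t) \<in> interior \<Theta>" if n: "n \<ge> n0" and t: "0 < t" "t < 1" for n t
  proof -
    have k: "0 < \<kappa> n" using c(2) \<gamma> by (simp add: \<kappa>)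
    have kt: "0 < \<kappa> n * t" "\<kappa> n * t < \<kappa> n" using k t by auto
    have seg: "closed_segment (\<theta> n) b \<subseteq> \<Theta>" using \<theta>(1) b(1) cv closed_segment_subset by blast
    have "{min (\<theta> n) b<..<max (\<theta> n) b} \<subseteq> closed_segment (\<theta> n) b"
      unfolding closed_segment_eq_real_ivl by (cases "\<theta> n \<le> b") auto
    with seg have "{min (\<theta> n) b<..<max (\<theta> n) b} \<subseteq> interior \<Theta>"
      by (intro interior_maximal open_greaterThanLessThan) blast
    moreover have "\<theta> n + \<kappa> n * (?s * t) \<in> {min (\<theta> n) b<..<max (\<theta> n) b}"
      using s n0[OF n] s\<theta>[of n] sb kt by auto
    ultimately show ?thesis by blast
  qed
  have conv: "(\<lambda>n. (f (\<theta> n + \<kappa> n * (?s * t)) - f (\<theta> n)) / (\<kappa> n * c n))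
        \<longlonglongrightarrow> \<gamma> * f2 z / 2 * (?s * t)\<^sup>2 + \<mu> * (?s * t)" if t: "0 < t" "t < 1" for t
  proof -
    let ?u = "?s * t"
    define x where "x n = (if n \<ge> n0 then \<theta> n + \<kappa> n * ?u else z)" for n
    have x_in: "x n \<in> \<Theta>" for n
      using dom[OF _ t, of n] z interior_subset by (auto simp: x_def)
    have x_ev: "\<forall>\<^sub>F n in sequentially. \<theta> n + \<kappa> n * ?u = x n"
      by (intro eventually_sequentiallyI[of n0]) (simp add: x_def)
    have "(\<lambda>n. \<theta> n + \<kappa> n * ?u) \<longlonglongrightarrow> z + 0 * ?u"
      by (intro tendsto_intros lim(1) k0)
    then have x_lim: "x \<longlonglongrightarrow> z" using x_ev by (simp add: Lim_transform_eventually)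
    obtain r1 where r1: "\<And>n. f (x n) - f z = (f2 z / 2 + r1 n) * (x n - z)\<^sup>2" "r1 \<longlonglongrightarrow> 0"
      using quadratic_approximation[OF z x_in x_lim] by blast
    obtain r2 where r2: "\<And>n. f (\<theta> n) - f z = (f2 z / 2 + r2 n) * (\<theta> n - z)\<^sup>2" "r2 \<longlonglongrightarrow> 0"
      using quadratic_approximation[OF z \<theta>(1) lim(1)] by blast
    define h where "h n = (\<theta> n - z) / c n" for n
    have h: "h \<longlonglongrightarrow> \<mu> / f2 z" using lim(2) by (simp add: h_def[abs_def])
    have "(\<lambda>n. ((f2 z / 2 + r1 n) * (h n + \<gamma> * ?u)\<^sup>2 - (f2 z / 2 + r2 n) * (h n)\<^sup>2) / \<gamma>)
       \<longlonglongrightarrow> ((f2 z / 2 + 0) * (\<mu> / f2 z + \<gamma> * ?u)\<^sup>2 - (f2 z / 2 + 0) * (\<mu> / f2 z)\<^sup>2) / \<gamma>"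
      using \<gamma> by (intro tendsto_intros h r1 r2) auto
    moreover have "((f2 z / 2 + 0) * (\<mu> / f2 z + \<gamma> * ?u)\<^sup>2 - (f2 z / 2 + 0) * (\<mu> / f2 z)\<^sup>2) / \<gamma>
      = \<gamma> * f2 z / 2 * ?u\<^sup>2 + \<mu> * ?u"
      using \<gamma> f2z by (simp add: power2_eq_square field_simps)
    moreover have "\<forall>\<^sub>F n in sequentially.
        ((f2 z / 2 + r1 n) * (h n + \<gamma> * ?u)\<^sup>2 - (f2 z / 2 + r2 n) * (h n)\<^sup>2) / \<gamma>
        = (f (\<theta> n + \<kappa> n * ?u) - f (\<theta> n)) / (\<kappa> n * c n)"
      using x_ev
    proof eventually_elim
      case (elim n)
      have cn: "c n \<noteq> 0" using c(2)[of n] by simp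
      have a: "x n - z = c n * (h n + \<gamma> * ?u)" "\<theta> n - z = c n * h n"
        using cn elim by (auto simp: h_def \<kappa> field_simps)
      have "f (x n) - f (\<theta> n) = (f (x n) - f z) - (f (\<theta> n) - f z)" by simp
      also have "\<dots> = (c n)\<^sup>2 * ((f2 z / 2 + r1 n) * (h n + \<gamma> * ?u)\<^sup>2 - (f2 z / 2 + r2 n) * (h n)\<^sup>2)"
        unfolding r1(1) r2(1) a by (simp add: power_mult_distrib right_diff_distrib mult_ac)
      finally show ?case using cn \<gamma> elim by (simp add: \<kappa> power2_eq_square)
    qed
    ultimately show ?thesis by (simp add: Lim_transform_eventually)
  qed
  show ?thesis by (rule that[OF z(1) dom conv])
qed

text \<open>If the mean tends to infinity while the dispersion stays bounded, the parameter must tend to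
  infinity too. As \<open>\<Theta>\<close> is bounded below by \<open>-1\<close>, this happens only for increasing means, and then
  \<open>f x / (x\<^sup>2 / 2)\<close> tends to \<open>c0\<close> by de l'Hospital's rule. The parameters of nonpositive mean stay
  bounded, so that on the scale of \<open>\<kappa> n\<close> they are all at the origin.\<close>

lemma nonpositive_mean_limit_at_top:
  assumes gt: "\<And>x. x \<in> \<Theta> \<Longrightarrow> -1 < x"
    and near: "\<And>\<eta>. 0 < \<eta> \<Longrightarrow> \<forall>\<^sub>F m in at_top. m \<in> f1 ` \<Theta> \<and> (\<forall>x\<in>\<Theta>. f1 x = m \<longrightarrow> \<bar>f2 x / c0 - 1\<bar> \<le> \<eta>)"
    and \<mu>: "\<mu> \<le> 0" and \<gamma>: "0 < \<gamma>"
    and c: "filterlim c at_top sequentially" "\<And>n. 0 < c n"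
    and \<theta>: "\<And>n. \<theta> n \<in> \<Theta>" "\<And>n. f1 (\<theta> n) = c n * \<mu>"
    and \<kappa>: "\<And>n. \<kappa> n = c n * \<gamma>"
  shows "0 < c0"
    and "\<And>n t. 0 < t \<Longrightarrow> \<theta> n + \<kappa> n * t \<in> interior \<Theta>"
    and "\<And>t. 0 < t \<Longrightarrow> (\<lambda>n. f (\<theta> n + \<kappa> n * t) / (\<kappa> n * c n)) \<longlonglongrightarrow> \<gamma> * c0 / 2 * t\<^sup>2"
proof -
  have c0: "c0 \<noteq> 0" using \<theta>(1) c0_nonzero by blast
  obtain B0 where B0: "\<And>m. B0 \<le> m \<Longrightarrow> m \<in> f1 ` \<Theta> \<and> (\<forall>x\<in>\<Theta>. f1 x = m \<longrightarrow> \<bar>f2 x / c0 - 1\<bar> \<le> 1)"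
    using near[of 1] by (auto simp: eventually_at_top_linorder)
  define B where "B = max B0 1"
  have B: "0 < B" "\<And>m. B \<le> m \<Longrightarrow> m \<in> f1 ` \<Theta>"
    "\<And>x. x \<in> \<Theta> \<Longrightarrow> B \<le> f1 x \<Longrightarrow> \<bar>f2 x\<bar> \<le> 2 * \<bar>c0\<bar>"
  proof -
    show "0 < B" by (simp add: B_def)
    show "m \<in> f1 ` \<Theta>" if "B \<le> m" for m using B0[of m] that by (simp add: B_def)
    show "\<bar>f2 x\<bar> \<le> 2 * \<bar>c0\<bar>" if "x \<in> \<Theta>" "B \<le> f1 x" for x
    proof -
      have "\<bar>f2 x / c0 - 1\<bar> \<le> 1" using B0[of "f1 x"] that by (simp add: B_def)
      then have "\<bar>f2 x / c0\<bar> \<le> 2" by linarith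
      then show ?thesis using c0 by (simp add: field_simps)
    qed
  qed
  obtain x1 where x1: "x1 \<in> \<Theta>" "f1 x1 = B" using B(2)[of B] by auto
  have growth: "f1 x - B \<le> 2 * \<bar>c0\<bar> * \<bar>x - x1\<bar>" if x: "x \<in> \<Theta>" "B \<le> f1 x" for x
  proof -
    obtain w where w: "w \<in> closed_segment x1 x" "w \<in> \<Theta>" "f1 x - f1 x1 = f2 w * (x - x1)"
      using mvt_on_convex[OF cv x1(1) x(1) f1] by blast
    have "f1 w \<in> {B..f1 x}" using deriv_between(2)[OF x1(1) x(1) w(1)] x1 x by auto
    then have "\<bar>f2 w\<bar> \<le> 2 * \<bar>c0\<bar>" using B(3) w(2) by auto
    then have "\<bar>f2 w\<bar> * \<bar>x - x1\<bar> \<le> 2 * \<bar>c0\<bar> * \<bar>x - x1\<bar>" by (intro mult_right_mono) auto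
    moreover have "f2 w * (x - x1) \<le> \<bar>f2 w\<bar> * \<bar>x - x1\<bar>" by (metis abs_ge_self abs_mult)
    ultimately show ?thesis using w(3) x1(2) by linarith
  qed
  show c0_pos: "0 < c0"
  proof (rule ccontr)
    assume "\<not> 0 < c0"
    then have neg: "c0 < 0" using c0 by simp
    \<comment> \<open>a mean that would need a parameter below -1\<close>
    define m where "m = B + 2 * \<bar>c0\<bar> * (x1 + 1) + 1"
    have mB: "B < m" using gt[OF x1(1)] by (simp add: m_def add_nonneg_pos)
    then obtain x where x: "x \<in> \<Theta>" "f1 x = m" using B(2)[of m] by auto
    have "c0 * f1 x < c0 * f1 x1" using x x1 mB neg by simp
    then have "x < x1" using deriv_less_iff(1)[OF x(1) x1(1)] by simp
    then have "\<bar>x - x1\<bar> \<le> x1 + 1" using gt[OF x(1)] by simp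
    then have "2 * \<bar>c0\<bar> * \<bar>x - x1\<bar> \<le> 2 * \<bar>c0\<bar> * (x1 + 1)" by (intro mult_left_mono) auto
    then show False using growth[OF x(1)] x(2) mB by (simp add: m_def)
  qed
  have mono: "f1 x \<le> f1 y \<longleftrightarrow> x \<le> y" if "x \<in> \<Theta>" "y \<in> \<Theta>" for x y
    using deriv_less_iff(2)[OF that] c0_pos by simp
  have ray: "y \<in> \<Theta>" if y: "x1 \<le> y" for y
  proof -
    define m where "m = B + 2 * c0 * (y - x1)"
    have mB: "B \<le> m" using y c0_pos by (simp add: m_def)
    then obtain x where x: "x \<in> \<Theta>" "f1 x = m" using B(2)[of m] by auto
    have "x1 \<le> x" using mono[OF x1(1) x(1)] x x1 mB by simp
    moreover have "2 * c0 * (y - x1) \<le> 2 * c0 * \<bar>x - x1\<bar>"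
      using growth[OF x(1)] x(2) mB c0_pos by (simp add: m_def)
    ultimately have "y \<le> x" using c0_pos by simp
    then have "y \<in> closed_segment x1 x" using y by (simp add: closed_segment_eq_real_ivl)
    then show ?thesis using x(1) x1(1) cv closed_segment_subset by blast
  qed
  have ray': "{x<..} \<subseteq> interior \<Theta>" if x: "x \<in> \<Theta>" for x
  proof (rule interior_maximal)
    show "{x<..} \<subseteq> \<Theta>"
    proof
      fix y assume "y \<in> {x<..}"
      then have "y \<in> closed_segment x (max x1 y)" by (simp add: closed_segment_eq_real_ivl)
      moreover have "max x1 y \<in> \<Theta>" by (rule ray) simp
      ultimately show "y \<in> \<Theta>" using closed_segment_subset[OF x _ cv] by blast
    qed
  qed simp
  have k: "0 < \<kappa> n" for n using c(2) \<gamma> by (simp add: \<kappa>)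
  show dom: "\<theta> n + \<kappa> n * t \<in> interior \<Theta>" if "0 < t" for n t
  proof -
    have "0 < \<kappa> n * t" using k that by simp
    then show ?thesis using ray'[OF \<theta>(1)[of n]] by (simp add: subset_iff)
  qed
  have within: "at x within \<Theta> = at x" if "x1 < x" for x
    using ray'[OF x1(1)] that by (intro at_within_interior) auto
  have f1_large: "\<forall>\<^sub>F x in at_top. x1 < x \<and> K \<le> f1 x" for K
  proof -
    obtain y where y: "y \<in> \<Theta>" "f1 y = max K B" using B(2)[of "max K B"] by auto
    have "\<forall>\<^sub>F x in at_top. x1 < x \<and> y \<le> x"
      by (intro eventually_conj eventually_gt_at_top eventually_ge_at_top)
    then show ?thesis
    proof eventually_elim
      case (elim x)
      then have "f1 y \<le> f1 x" using mono[OF y(1) ray[of x]] by simp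
      then show ?case using y elim by simp
    qed
  qed
  have f2_lim: "(f2 \<longlongrightarrow> c0) at_top"
    unfolding tendsto_iff dist_real_def
  proof (intro allI impI)
    fix r :: real assume r: "0 < r"
    define \<eta> where "\<eta> = r / (2 * c0)"
    have \<eta>: "0 < \<eta>" "\<eta> * c0 < r" using r c0_pos by (auto simp: \<eta>_def)
    obtain K where K: "\<And>m. K \<le> m \<Longrightarrow> (\<forall>x\<in>\<Theta>. f1 x = m \<longrightarrow> \<bar>f2 x / c0 - 1\<bar> \<le> \<eta>)"
      using near[OF \<eta>(1)] by (auto simp: eventually_at_top_linorder)
    show "\<forall>\<^sub>F x in at_top. \<bar>f2 x - c0\<bar> < r"
      using f1_large[of K]
    proof eventually_elim
      case (elim x)
      then have "\<bar>f2 x / c0 - 1\<bar> \<le> \<eta>" using K ray[of x] by auto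
      then have "\<bar>f2 x / c0 - 1\<bar> * c0 \<le> \<eta> * c0" using c0_pos by (intro mult_right_mono) auto
      moreover have "f2 x - c0 = (f2 x / c0 - 1) * c0"
        using c0_pos by (simp add: left_diff_distrib)
      then have "\<bar>f2 x / c0 - 1\<bar> * c0 = \<bar>f2 x - c0\<bar>"
        using c0_pos by (simp only: abs_mult abs_of_pos)
      ultimately show ?case using \<eta>(2) by linarith
    qed
  qed
  have lin: "((\<lambda>x. f1 x / x) \<longlongrightarrow> c0) at_top"
  proof (rule lhospital_at_top_at_top[where f' = f2 and g' = "\<lambda>_. 1"])
    show "\<forall>\<^sub>F x in at_top. (f1 has_real_derivative f2 x) (at x)"
      using eventually_gt_at_top[of x1]
    proof eventually_elim
      case (elim x)
      then show ?case using f1[of x] within[of x] ray[of x] by simp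
    qed
  qed (use f2_lim in \<open>auto simp: filterlim_ident\<close>)
  have quad: "((\<lambda>x. f x / (x\<^sup>2 / 2)) \<longlongrightarrow> c0) at_top"
  proof (rule lhospital_at_top_at_top[where f' = f1 and g' = "\<lambda>x. x"])
    show "\<forall>\<^sub>F x in at_top. (f has_real_derivative f1 x) (at x)"
      using eventually_gt_at_top[of x1]
    proof eventually_elim
      case (elim x)
      then show ?case using f[of x] within[of x] ray[of x] by simp
    qed
    show "filterlim (\<lambda>x::real. x\<^sup>2 / 2) at_top at_top"
      by real_asymp
    show "\<forall>\<^sub>F x::real in at_top. x \<noteq> 0" using eventually_gt_at_top[of 0] by eventually_elim simp
    show "\<forall>\<^sub>F x in at_top. ((\<lambda>x. x\<^sup>2 / 2) has_real_derivative x) (at x)"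
      by (auto intro!: always_eventually derivative_eq_intros)
    show "((\<lambda>x. f1 x / x) \<longlongrightarrow> c0) at_top" by (rule lin)
  qed
  have bound: "\<bar>\<theta> n\<bar> \<le> 1 + \<bar>x1\<bar>" for n
  proof -
    have "c n * \<mu> \<le> 0" using c(2)[of n] \<mu> by (simp add: mult_nonneg_nonpos)
    then have "f1 (\<theta> n) \<le> f1 x1" using \<theta>(2)[of n] x1(2) B(1) by simp
    then have "\<theta> n \<le> x1" using mono[OF \<theta>(1) x1(1)] by simp
    then show ?thesis using gt[OF \<theta>(1), of n] by linarith
  qed
  have inv0: "(\<lambda>n. inverse (c n)) \<longlonglongrightarrow> 0"
    using c(1) by (rule tendsto_inverse_0_at_top)
  have "(\<lambda>n. \<theta> n * inverse (c n)) \<longlonglongrightarrow> 0"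
  proof (rule Lim_null_comparison)
    show "\<forall>\<^sub>F n in sequentially. norm (\<theta> n * inverse (c n)) \<le> (1 + \<bar>x1\<bar>) * inverse (c n)"
      using bound c(2) by (intro always_eventually) (auto simp: abs_mult less_imp_le intro!: mult_right_mono)
    show "(\<lambda>n. (1 + \<bar>x1\<bar>) * inverse (c n)) \<longlonglongrightarrow> 0"
      using tendsto_mult[OF tendsto_const inv0] by simp
  qed
  then have \<theta>c: "(\<lambda>n. \<theta> n / c n) \<longlonglongrightarrow> 0" by (simp add: divide_inverse)
  show "(\<lambda>n. f (\<theta> n + \<kappa> n * t) / (\<kappa> n * c n)) \<longlonglongrightarrow> \<gamma> * c0 / 2 * t\<^sup>2" if t: "0 < t" for t
  proof -
    define x where "x n = \<theta> n + \<kappa> n * t" for n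
    have x_top: "filterlim x at_top sequentially"
    proof (rule filterlim_at_top_mono)
      have "filterlim (\<lambda>n. (\<gamma> * t) * c n) at_top sequentially"
        using \<gamma> t c(1) by (intro filterlim_tendsto_pos_mult_at_top[OF tendsto_const]) auto
      then show "filterlim (\<lambda>n. -1 + (\<gamma> * t) * c n) at_top sequentially"
        by (intro filterlim_tendsto_add_at_top[OF tendsto_const])
      show "\<forall>\<^sub>F n in sequentially. -1 + (\<gamma> * t) * c n \<le> x n"
        using gt[OF \<theta>(1)] by (intro always_eventually allI) (auto simp: x_def \<kappa> mult_ac less_imp_le)
    qed
    have "(\<lambda>n. f (x n) / ((x n)\<^sup>2 / 2)) \<longlonglongrightarrow> c0" by (rule filterlim_compose[OF quad x_top])
    moreover have "(\<lambda>n. \<theta> n / c n + \<gamma> * t) \<longlonglongrightarrow> 0 + \<gamma> * t" by (intro tendsto_add \<theta>c tendsto_const)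
    ultimately have A: "(\<lambda>n. f (x n) / ((x n)\<^sup>2 / 2) * ((\<theta> n / c n + \<gamma> * t)\<^sup>2 / (2 * \<gamma>)))
        \<longlonglongrightarrow> c0 * ((0 + \<gamma> * t)\<^sup>2 / (2 * \<gamma>))"
      using \<gamma> by (intro tendsto_mult tendsto_divide tendsto_power tendsto_const) auto
    have E: "c0 * ((0 + \<gamma> * t)\<^sup>2 / (2 * \<gamma>)) = \<gamma> * c0 / 2 * t\<^sup>2"
      using \<gamma> by (simp add: power2_eq_square field_simps)
    have "\<forall>\<^sub>F n in sequentially. 0 < x n" using x_top by (simp add: filterlim_at_top_dense)
    then have V: "\<forall>\<^sub>F n in sequentially. f (x n) / ((x n)\<^sup>2 / 2) * ((\<theta> n / c n + \<gamma> * t)\<^sup>2 / (2 * \<gamma>))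
        = f (\<theta> n + \<kappa> n * t) / (\<kappa> n * c n)"
    proof eventually_elim
      case (elim n)
      have cn: "c n \<noteq> 0" using c(2)[of n] by simp
      have "\<theta> n / c n + \<gamma> * t = x n / c n" using cn by (simp add: x_def \<kappa> field_simps)
      then have "f (x n) / ((x n)\<^sup>2 / 2) * ((\<theta> n / c n + \<gamma> * t)\<^sup>2 / (2 * \<gamma>)) = f (x n) / (\<kappa> n * c n)"
        using elim cn \<gamma> by (simp add: \<kappa> power2_eq_square)
      then show ?case by (simp add: x_def)
    qed
    show ?thesis using Lim_transform_eventually[OF A V] unfolding E .
  qed
qed

end

section \<open>Convergence of factorial dispersion models\<close>

lemma cumulant_curve_of_fd_model:
  assumes model: "fd_model M \<Theta>" and sgn: "\<And>x. x \<in> \<Theta> \<Longrightarrow> 0 < k * fcgf_deriv2 M x"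
  shows "cumulant_curve \<Theta> (rfcgf M) (fcgf_deriv M) (fcgf_deriv2 M) k"
proof
  have sub: "\<Theta> \<subseteq> fcgf_dom M" using model by (simp add: fd_model_def)
  show "convex \<Theta>" using model by (auto simp: fd_model_def intro: is_interval_convex)
  show "0 < k * fcgf_deriv2 M x" if "x \<in> \<Theta>" for x using sgn[OF that] .
  fix x assume x: "x \<in> \<Theta>"
  have "(rfcgf M has_vector_derivative fcgf_deriv M x) (at x within fcgf_dom M)"
    using model x unfolding fcgf_deriv_def fd_model_def by (simp add: vector_derivative_works)
  then show "(rfcgf M has_real_derivative fcgf_deriv M x) (at x within \<Theta>)"
    using sub by (auto simp: has_real_derivative_iff_has_vector_derivative
        intro: has_vector_derivative_within_subset)
  have "(fcgf_deriv M has_vector_derivative fcgf_deriv2 M x) (at x within fcgf_dom M)"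
    using model x unfolding fcgf_deriv2_def fd_model_def by (simp add: vector_derivative_works)
  then show "(fcgf_deriv M has_real_derivative fcgf_deriv2 M x) (at x within \<Theta>)"
    using sub by (auto simp: has_real_derivative_iff_has_vector_derivative
        intro: has_vector_derivative_within_subset)
qed

text \<open>Since the mean is injective on \<open>\<Theta>\<close>, the asymptotic condition on the unit dispersion function is a
  condition on the second derivative at the parameter with the given mean. It determines the sign of
  the dispersion.\<close>

lemma eventually_dispersion_ratio:
  assumes model: "fd_model M \<Theta>"
    and F: "F = at_right 0 \<or> F = at_top"
    and c0: "c0 \<noteq> 0"
    and defined_near: "\<forall>\<^sub>F m in F. m \<in> mean_domain M \<Theta>"
    and asym: "unit_dispersion M \<Theta> \<sim>[F] (\<lambda>m. c0 * m powr p)"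
  shows "\<And>\<eta>. 0 < \<eta> \<Longrightarrow> \<forall>\<^sub>F m in F. 0 < m \<and> m \<in> fcgf_deriv M ` \<Theta> \<and>
      (\<forall>x\<in>\<Theta>. fcgf_deriv M x = m \<longrightarrow> \<bar>fcgf_deriv2 M x / (c0 * m powr p) - 1\<bar> \<le> \<eta>)"
    and "\<And>x. x \<in> \<Theta> \<Longrightarrow> 0 < c0 * fcgf_deriv2 M x"
proof -
  let ?f1 = "fcgf_deriv M" and ?f2 = "fcgf_deriv2 M"
  have alt: "(\<forall>x\<in>\<Theta>. 0 < ?f2 x) \<or> (\<forall>x\<in>\<Theta>. ?f2 x < 0)"
    using model by (simp add: fd_model_def)
  have inj: "inj_on ?f1 \<Theta>"
    using alt
  proof
    assume "\<forall>x\<in>\<Theta>. 0 < ?f2 x"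
    then show ?thesis
      using cumulant_curve.inj_deriv[OF cumulant_curve_of_fd_model[OF model, of 1]] by simp
  next
    assume "\<forall>x\<in>\<Theta>. ?f2 x < 0"
    then show ?thesis
      using cumulant_curve.inj_deriv[OF cumulant_curve_of_fd_model[OF model, of "-1"]] by simp
  qed
  have pos: "\<forall>\<^sub>F m in F. 0 < m"
    using F by (auto simp: eventually_at_right_less eventually_gt_at_top)
  show near: "\<forall>\<^sub>F m in F. 0 < m \<and> m \<in> ?f1 ` \<Theta> \<and>
      (\<forall>x\<in>\<Theta>. ?f1 x = m \<longrightarrow> \<bar>?f2 x / (c0 * m powr p) - 1\<bar> \<le> \<eta>)" if \<eta>: "0 < \<eta>" for \<eta>
  proof -
    have "\<forall>\<^sub>F m in F. dist (if unit_dispersion M \<Theta> m = 0 \<and> c0 * m powr p = 0 then 1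
        else unit_dispersion M \<Theta> m / (c0 * m powr p)) 1 < \<eta>"
      using asymp_equivD[OF asym] \<eta> by (rule tendstoD)
    with defined_near pos show ?thesis
    proof eventually_elim
      case (elim m)
      have "\<bar>?f2 x / (c0 * m powr p) - 1\<bar> \<le> \<eta>" if x: "x \<in> \<Theta>" "?f1 x = m" for x
      proof -
        have "unit_dispersion M \<Theta> m = ?f2 x"
          using inv_into_f_f[OF inj x(1)] x(2) by (simp add: unit_dispersion_def)
        then show ?thesis using elim c0 by (simp add: dist_real_def)
      qed
      then show ?case using elim by (auto simp: mean_domain_def)
    qed
  qed
  have "F \<noteq> bot" using F trivial_limit_at_right_real[of "0::real"] trivial_limit_at_top_linorder by metis
  then obtain m where m: "0 < m" "m \<in> ?f1 ` \<Theta>" "\<forall>x\<in>\<Theta>. ?f1 x = m \<longrightarrow> \<bar>?f2 x / (c0 * m powr p) - 1\<bar> \<le> 1/2"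
    using eventually_happens[OF near[of "1/2"]] by (auto simp: trivial_limit_def)
  then obtain x where x: "x \<in> \<Theta>" "\<bar>?f2 x / (c0 * m powr p) - 1\<bar> \<le> 1/2" by auto
  then have "0 < ?f2 x / (c0 * m powr p)" by linarith
  then have "0 < c0 * ?f2 x" using m(1) by (auto simp: zero_less_divide_iff zero_less_mult_iff mult_less_0_iff)
  then show "0 < c0 * ?f2 y" if "y \<in> \<Theta>" for y
    using alt x(1) that by (auto simp: zero_less_mult_iff)
qed

theorem fcgf_continuity:
  assumes L: "\<And>n. real_distribution (L n)" and e: "0 < e" "e \<le> 1"
    and dom: "\<And>n t. \<bar>t\<bar> < e \<Longrightarrow> t \<in> fcgf_dom (L n)"
    and conv: "\<And>t. \<bar>t\<bar> < e \<Longrightarrow> (\<lambda>n. rfcgf (L n) t) \<longlonglongrightarrow> D t"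
  obtains P e' where "real_distribution P" "weak_conv_m L P" "0 < e'" "e' \<le> e"
    "\<And>t. \<bar>t\<bar> < e' \<Longrightarrow> t \<in> fcgf_dom P \<and> rfcgf P t = D t"
proof -
  have "isCont (\<lambda>s. exp s - 1 :: real) 0" by (intro continuous_intros)
  then have "((\<lambda>s. exp s - 1 :: real) \<longlongrightarrow> 0) (nhds 0)" by (simp add: isCont_def tendsto_nhds_iff)
  then have "\<forall>\<^sub>F s in nhds 0. dist (exp s - 1 :: real) 0 < e" using e(1) by (rule tendstoD)
  then obtain \<delta> where \<delta>: "0 < \<delta>" "\<And>s::real. \<bar>s\<bar> < \<delta> \<Longrightarrow> \<bar>exp s - 1\<bar> < e"
    by (auto simp: eventually_nhds_metric dist_real_def)
  have "isCont (\<lambda>t. ln (1 + t) :: real) 0" by (intro continuous_intros) auto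
  then have "((\<lambda>t. ln (1 + t) :: real) \<longlongrightarrow> 0) (nhds 0)" by (simp add: isCont_def tendsto_nhds_iff)
  then have "\<forall>\<^sub>F t in nhds 0. dist (ln (1 + t) :: real) 0 < \<delta>" using \<delta>(1) by (rule tendstoD)
  then obtain e1 where e1: "0 < e1" "\<And>t::real. \<bar>t\<bar> < e1 \<Longrightarrow> \<bar>ln (1 + t)\<bar> < \<delta>"
    by (auto simp: eventually_nhds_metric dist_real_def)
  have mgfL: "s \<in> mgf_dom (L n) \<and> mgf (L n) s = exp (rfcgf (L n) (exp s - 1))" if "\<bar>s\<bar> < \<delta>" for n s
  proof -
    have d: "exp s - 1 \<in> fcgf_dom (L n)" by (rule dom[OF \<delta>(2)[OF that]])
    then have s: "s \<in> mgf_dom (L n)" by (simp add: fcgf_dom_iff)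
    then show ?thesis using rfcgf_eq[OF d] real_distribution.mgf_pos[OF L s] by simp
  qed
  obtain P where P: "real_distribution P" "weak_conv_m L P"
    "\<And>s. \<bar>s\<bar> < \<delta> \<Longrightarrow> s \<in> mgf_dom P \<and> mgf P s = exp (D (exp s - 1))"
  proof (rule mgf_continuity[OF L \<delta>(1)])
    show "(\<lambda>n. mgf (L n) s) \<longlonglongrightarrow> exp (D (exp s - 1))" if "\<bar>s\<bar> < \<delta>" for s
      using tendsto_exp[OF conv[OF \<delta>(2)[OF that]]] mgfL[OF that] by simp
  qed (use mgfL in auto)
  show ?thesis
  proof (rule that[OF P(1,2), of "min e e1"])
    fix t :: real assume t: "\<bar>t\<bar> < min e e1"
    then have "-1 < t" using e by linarith
    moreover from this t have "ln (1 + t) \<in> mgf_dom P \<and> mgf P (ln (1 + t)) = exp (D t)"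
      using P(3)[OF e1(2), of t] by simp
    ultimately have "t \<in> fcgf_dom P" "mgf P (ln (1 + t)) = exp (D t)" by (auto simp: fcgf_dom_iff)
    then show "t \<in> fcgf_dom P \<and> rfcgf P t = D t" by (simp add: rfcgf_eq)
  qed (use e e1 in auto)
qed

lemma weak_conv_m_offset:
  assumes "weak_conv_m (\<lambda>n. L (n + k)) P"
  shows "weak_conv_m L P"
  using assms unfolding weak_conv_m_def weak_conv_def by (auto intro: LIMSEQ_offset[of _ k])

text \<open>For \<open>\<mu> > 0\<close> the limit is taken on an interval around \<open>0\<close>. For \<open>\<mu> \<le> 0\<close>, hence \<open>p = 0\<close>, the
  sequence cannot exist: the limiting quadratic would contradict \<open>quadratic_fcgf_limit\<close>.\<close>

theorem theorem4p2:
  fixes M :: "real measure" and \<Theta> :: "real set" and p c0 \<gamma> \<mu> :: real and F :: "real filter"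
  assumes model: "fd_model M \<Theta>"
    and range: "Inf (ereal ` mean_domain M \<Theta>) \<le> 0 \<or> Sup (ereal ` mean_domain M \<Theta>) = \<infinity>"
    and limit: "F = at_right 0 \<or> F = at_top"
    and c0: "c0 \<noteq> 0"
    and defined_near: "\<forall>\<^sub>F m in F. m \<in> mean_domain M \<Theta>"
    and power_asymptotics: "unit_dispersion M \<Theta> \<sim>[F] (\<lambda>m. c0 * m powr p)"
    and dilatable: "F = at_right 0 \<Longrightarrow> fd_infinitely_dilatable M \<Theta>"
    and divisible: "filterlim (\<lambda>c. c powr (2 - p)) at_top F \<Longrightarrow> fd_infinitely_divisible M \<Theta>"
    and gamma: "0 < \<gamma>"
    and mu: "\<mu> \<in> power_domain p"
  shows "\<forall>(c :: nat \<Rightarrow> real) (L :: nat \<Rightarrow> real measure).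
    filterlim c F sequentially \<and>
    (\<forall>n. 0 < c n \<and>
         (\<exists>N. is_FD M \<Theta> (c n * \<mu>) (c n powr (2 - p) * \<gamma>) N \<and> is_dilation (inverse (c n)) N (L n)))
    \<longrightarrow> (\<exists>P. is_PT p \<mu> (\<gamma> * c0) P \<and> weak_conv_m L P)"
proof (intro allI impI)
  fix c :: "nat \<Rightarrow> real" and L :: "nat \<Rightarrow> real measure"
  assume "filterlim c F sequentially \<and> (\<forall>n. 0 < c n \<and>
         (\<exists>N. is_FD M \<Theta> (c n * \<mu>) (c n powr (2 - p) * \<gamma>) N \<and> is_dilation (inverse (c n)) N (L n)))"
  then have c: "filterlim c F sequentially" "\<And>n. 0 < c n"
    and FD: "\<And>n. \<exists>N. is_FD M \<Theta> (c n * \<mu>) (c n powr (2 - p) * \<gamma>) N \<and> is_dilation (inverse (c n)) N (L n)"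
    by auto
  let ?f = "rfcgf M" and ?f1 = "fcgf_deriv M" and ?f2 = "fcgf_deriv2 M"
  note ratio = eventually_dispersion_ratio[OF model limit c0 defined_near power_asymptotics]
  interpret curve: cumulant_curve \<Theta> ?f ?f1 ?f2 c0
    by (rule cumulant_curve_of_fd_model[OF model ratio(2)])
  have M: "real_distribution M" and \<Theta>_dom: "\<Theta> \<subseteq> fcgf_dom M"
    using model by (auto simp: fd_model_def fcgf_class_def)
  define \<kappa> where "\<kappa> n = c n powr (1 - p) * \<gamma>" for n
  have \<kappa>_pos: "0 < \<kappa> n" for n using c(2)[of n] gamma by (simp add: \<kappa>_def)
  have g: "c n powr (2 - p) * \<gamma> = \<kappa> n * c n" for n
  proof -
    have "c n powr (2 - p) = c n powr (1 - p) * c n powr 1"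
      unfolding powr_add[symmetric] by simp
    then show ?thesis using c(2)[of n] by (simp add: \<kappa>_def)
  qed
  have "\<exists>\<theta>. \<theta> \<in> \<Theta> \<and> ?f1 \<theta> = c n * \<mu> \<and> real_distribution (L n) \<and>
      (\<forall>\<^sub>F t in nhds 0. fcgf (L n) t = ereal (1 / (\<kappa> n * c n)) * (fcgf M (\<theta> + \<kappa> n * t) - fcgf M \<theta>))" for n
  proof -
    obtain N where N: "is_FD M \<Theta> (c n * \<mu>) (c n powr (2 - p) * \<gamma>) N" "is_dilation (inverse (c n)) N (L n)"
      using FD by blast
    have \<kappa>c: "\<kappa> n * c n / c n = \<kappa> n" using c(2)[of n] by simp
    show ?thesis
      by (rule FD_dilation_fcgf[OF N, unfolded g \<kappa>c]) blast
  qed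
  then obtain \<theta> where \<theta>: "\<And>n. \<theta> n \<in> \<Theta>" "\<And>n. ?f1 (\<theta> n) = c n * \<mu>" and L: "\<And>n. real_distribution (L n)"
    and local: "\<And>n. \<forall>\<^sub>F t in nhds 0.
      fcgf (L n) t = ereal (1 / (\<kappa> n * c n)) * (fcgf M (\<theta> n + \<kappa> n * t) - fcgf M (\<theta> n))"
    using choice[of "\<lambda>n \<theta>. \<theta> \<in> \<Theta> \<and> ?f1 \<theta> = c n * \<mu> \<and> real_distribution (L n) \<and>
      (\<forall>\<^sub>F t in nhds 0. fcgf (L n) t = ereal (1 / (\<kappa> n * c n)) * (fcgf M (\<theta> + \<kappa> n * t) - fcgf M \<theta>))"]
    by blast
  have rep: "t \<in> fcgf_dom (L n) \<and> rfcgf (L n) t = (?f (\<theta> n + \<kappa> n * t) - ?f (\<theta> n)) / (\<kappa> n * c n)"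
    if "-1 \<le> a" "a \<le> 0" "0 \<le> b" "a < b" "t \<in> {a<..<b}"
      and "\<And>t. t \<in> {a<..<b} \<Longrightarrow> \<theta> n + \<kappa> n * t \<in> interior \<Theta>" for a b t n
    using that(6) interior_mono[OF \<Theta>_dom] \<theta>(1)[of n] \<Theta>_dom
    by (intro fcgf_extends[OF M L that(1-4) \<kappa>_pos _ _ local that(5)]) auto
  show "\<exists>P. is_PT p \<mu> (\<gamma> * c0) P \<and> weak_conv_m L P"
  proof (cases "0 < \<mu>")
    case True
    have near: "\<forall>\<^sub>F m in F. m \<in> ?f1 ` \<Theta> \<and> (\<forall>x\<in>\<Theta>. ?f1 x = m \<longrightarrow> \<bar>?f2 x / (c0 * m powr p) - 1\<bar> \<le> \<eta>)"
      if "0 < \<eta>" for \<eta>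
      using ratio(1)[OF that] by eventually_elim auto
    obtain D m e n0 where e: "0 < e" "e \<le> 1" and m: "m 0 = \<mu>"
      and D': "\<And>t. \<bar>t\<bar> < e \<Longrightarrow> (D has_real_derivative m t) (at t)"
      and m': "\<And>t. \<bar>t\<bar> < e \<Longrightarrow> (m has_real_derivative (\<gamma> * c0) * m t powr p) (at t)"
      and m_pos: "\<And>t. \<bar>t\<bar> < e \<Longrightarrow> 0 < m t"
      and dom: "\<And>n t. n \<ge> n0 \<Longrightarrow> \<bar>t\<bar> < e \<Longrightarrow> \<theta> n + \<kappa> n * t \<in> interior \<Theta>"
      and conv: "\<And>t. \<bar>t\<bar> < e \<Longrightarrow> (\<lambda>n. (?f (\<theta> n + \<kappa> n * t) - ?f (\<theta> n)) / (\<kappa> n * c n)) \<longlonglongrightarrow> D t"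
    proof (rule curve.positive_mean_limit[OF limit c near gamma True \<theta> \<kappa>_def])
      fix D m e n0
      assume "0 < e"
        and "e \<le> 1"
        and "m 0 = \<mu>"
        and "\<And>t. \<bar>t\<bar> < e \<Longrightarrow> (D has_real_derivative m t) (at t)"
        and "\<And>t. \<bar>t\<bar> < e \<Longrightarrow> (m has_real_derivative (\<gamma> * c0) * m t powr p) (at t)"
        and "\<And>t. \<bar>t\<bar> < e \<Longrightarrow> 0 < m t"
        and "\<And>n t. n \<ge> n0 \<Longrightarrow> \<bar>t\<bar> < e \<Longrightarrow> \<theta> n + \<kappa> n * t \<in> interior \<Theta>"
        and "\<And>t. \<bar>t\<bar> < e \<Longrightarrow> (\<lambda>n. (?f (\<theta> n + \<kappa> n * t) - ?f (\<theta> n)) / (\<kappa> n * c n)) \<longlonglongrightarrow> D t"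
      then show thesis by (rule that)
    qed
    have LD: "t \<in> fcgf_dom (L n) \<and> rfcgf (L n) t = (?f (\<theta> n + \<kappa> n * t) - ?f (\<theta> n)) / (\<kappa> n * c n)"
      if "n \<ge> n0" "\<bar>t\<bar> < e" for n t
      using e that by (intro rep[of "-e" e] dom) (auto simp: abs_less_iff)
    obtain P e' where P: "real_distribution P" "weak_conv_m (\<lambda>n. L (n + n0)) P" "0 < e'" "e' \<le> e"
      "\<And>t. \<bar>t\<bar> < e' \<Longrightarrow> t \<in> fcgf_dom P \<and> rfcgf P t = D t"
    proof (rule fcgf_continuity[of "\<lambda>n. L (n + n0)" e])
      show "(\<lambda>n. rfcgf (L (n + n0)) t) \<longlonglongrightarrow> D t" if "\<bar>t\<bar> < e" for t
        using LIMSEQ_ignore_initial_segment[OF conv[OF that], of n0] LD[OF _ that] by simp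
    qed (use L e LD in auto)
    have "is_PT p (m 0) (\<gamma> * c0) P"
      using gamma c0 P(4) by (intro is_PT_I[OF P(1,3) _ P(5) D' m' m_pos]) auto
    then show ?thesis using weak_conv_m_offset[OF P(2)] m by auto
  next
    case False
    then have \<mu>: "\<mu> \<le> 0" by simp
    have p0: "p = 0" using mu False by (auto simp: power_domain_def split: if_splits)
    have \<kappa>: "\<kappa> n = c n * \<gamma>" for n using c(2)[of n] by (simp add: \<kappa>_def p0)
    show ?thesis
      using limit
    proof
      assume F: "F = at_right 0"
      have c_lim: "c \<longlonglongrightarrow> 0" using c(1) unfolding F by (simp add: filterlim_at)
      have "\<exists>m. 0 < m \<and> m \<in> ?f1 ` \<Theta>"
        using eventually_happens'[OF trivial_limit_at_right_real ratio(1)[of 1, unfolded F]] by auto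
      then obtain y where y: "y \<in> \<Theta>" "0 < ?f1 y" by auto
      obtain z n0 where z: "z \<in> \<Theta>"
        and dom: "\<And>n t. n \<ge> n0 \<Longrightarrow> 0 < t \<Longrightarrow> t < 1 \<Longrightarrow> \<theta> n + \<kappa> n * (sgn c0 * t) \<in> interior \<Theta>"
        and conv: "\<And>t. 0 < t \<Longrightarrow> t < 1 \<Longrightarrow>
          (\<lambda>n. (?f (\<theta> n + \<kappa> n * (sgn c0 * t)) - ?f (\<theta> n)) / (\<kappa> n * c n))
            \<longlonglongrightarrow> \<gamma> * ?f2 z / 2 * (sgn c0 * t)\<^sup>2 + \<mu> * (sgn c0 * t)"
      proof (rule curve.nonpositive_mean_limit_at_0[OF y \<mu> gamma c_lim c(2) \<theta> \<kappa>])
        fix z n0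
        assume "z \<in> \<Theta>"
          and "\<And>n t. n \<ge> n0 \<Longrightarrow> 0 < t \<Longrightarrow> t < 1 \<Longrightarrow> \<theta> n + \<kappa> n * (sgn c0 * t) \<in> interior \<Theta>"
          and "\<And>t. 0 < t \<Longrightarrow> t < 1 \<Longrightarrow>
            (\<lambda>n. (?f (\<theta> n + \<kappa> n * (sgn c0 * t)) - ?f (\<theta> n)) / (\<kappa> n * c n))
              \<longlonglongrightarrow> \<gamma> * ?f2 z / 2 * (sgn c0 * t)\<^sup>2 + \<mu> * (sgn c0 * t)"
        then show thesis by (rule that)
      qed
      \<comment> \<open>only the side of 0 that leads into positive means is used, as in the choice of sgn c0\<close>
      define a b where "a = (if 0 < c0 then 0 else -1 :: real)" and "b = (if 0 < c0 then 1 else 0 :: real)"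
      have ab: "-1 \<le> a" "a \<le> 0" "0 \<le> b" "a < b" by (auto simp: a_def b_def)
      have J: "sgn c0 * (sgn c0 * t) = t \<and> 0 < sgn c0 * t \<and> sgn c0 * t < 1" if "t \<in> {a<..<b}" for t
        using that c0 by (auto simp: a_def b_def sgn_if split: if_splits)
      have dom': "\<theta> n + \<kappa> n * t \<in> interior \<Theta>" if "n \<ge> n0" "t \<in> {a<..<b}" for n t
        using dom[OF that(1), of "sgn c0 * t"] J[OF that(2)] c0 by simp
      have conv': "(\<lambda>n. (?f (\<theta> n + \<kappa> n * t) - ?f (\<theta> n)) / (\<kappa> n * c n))
            \<longlonglongrightarrow> \<gamma> * ?f2 z / 2 * t\<^sup>2 + \<mu> * t" if "t \<in> {a<..<b}" for t
        using conv[of "sgn c0 * t"] J[OF that] c0 by simp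
      have LD: "t \<in> fcgf_dom (L n) \<and> rfcgf (L n) t = (?f (\<theta> n + \<kappa> n * t) - ?f (\<theta> n)) / (\<kappa> n * c n)"
        if "n \<ge> n0" "t \<in> {a<..<b}" for n t
        by (rule rep[OF ab that(2) dom'[OF that(1)]])
      have t1: "(a + b) / 2 \<in> {a<..<b}" using ab by auto
      have dom'': "t \<in> fcgf_dom (L (n + n0))" if "t \<in> {a<..<b}" for n t
        using LD[OF _ that, of "n + n0"] by simp
      have conv'': "(\<lambda>n. rfcgf (L (n + n0)) t - rfcgf (L (n + n0)) ((a + b) / 2)) \<longlonglongrightarrow>
          (\<gamma> * ?f2 z / 2 * t\<^sup>2 + \<mu> * t) - (\<gamma> * ?f2 z / 2 * ((a + b) / 2)\<^sup>2 + \<mu> * ((a + b) / 2))"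
        if "t \<in> {a<..<b}" for t
        using LIMSEQ_ignore_initial_segment[OF tendsto_diff[OF conv'[OF that] conv'[OF t1]], of n0]
          LD[OF _ that] LD[OF _ t1] by simp
      have "0 \<le> \<gamma> * ?f2 z" "\<gamma> * ?f2 z \<le> \<mu>"
        by (rule quadratic_fcgf_limit[where L = "\<lambda>n. L (n + n0)", OF L ab(1,4) t1 dom'' conv''];
            assumption)+
      then have "\<gamma> * ?f2 z = 0" using \<mu> by linarith
      then show ?thesis using gamma curve.sgn[OF z] by simp
    next
      assume F: "F = at_top"
      have gt: "-1 < x" if "x \<in> \<Theta>" for x using that \<Theta>_dom fcgf_dom_gt by blast
      have near: "\<forall>\<^sub>F m in at_top. m \<in> ?f1 ` \<Theta> \<and> (\<forall>x\<in>\<Theta>. ?f1 x = m \<longrightarrow> \<bar>?f2 x / c0 - 1\<bar> \<le> \<eta>)"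
        if "0 < \<eta>" for \<eta>
        using ratio(1)[OF that] unfolding F p0 by eventually_elim auto
      note lim = curve.nonpositive_mean_limit_at_top[OF gt near \<mu> gamma c(1)[unfolded F] c(2) \<theta> \<kappa>]
      have LD: "t \<in> fcgf_dom (L n) \<and> rfcgf (L n) t = (?f (\<theta> n + \<kappa> n * t) - ?f (\<theta> n)) / (\<kappa> n * c n)"
        if "t \<in> {0<..<1}" for n t
        using that lim(2) by (intro rep[of 0 1]) auto
      have half: "(1/2 :: real) \<in> {0<..<1}" by simp
      \<comment> \<open>the limit is known up to a constant, and its linear coefficient is 0 instead of \<open>\<mu>\<close>\<close>
      have "\<gamma> * c0 \<le> 0"
      proof (rule quadratic_fcgf_limit(2)[of L 0 1 "1/2"])
        show "(\<lambda>n. rfcgf (L n) t - rfcgf (L n) (1/2)) \<longlonglongrightarrow>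
          (\<gamma> * c0 / 2 * t\<^sup>2 + 0 * t) - (\<gamma> * c0 / 2 * (1/2)\<^sup>2 + 0 * (1/2))" if "t \<in> {0<..<1}" for t
        proof -
          have "rfcgf (L n) t - rfcgf (L n) (1/2) =
              ?f (\<theta> n + \<kappa> n * t) / (\<kappa> n * c n) - ?f (\<theta> n + \<kappa> n * (1/2)) / (\<kappa> n * c n)" for n
            using LD[OF that, of n] LD[OF half, of n] by (simp add: diff_divide_distrib)
          then show ?thesis
            using tendsto_diff[OF lim(3)[of t] lim(3)[of "1/2"]] that by simp
        qed
      qed (use L LD half in auto)
      then show ?thesis using gamma lim(1) by (simp add: mult_le_0_iff)
    qed
  qed
qed

end
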